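(* Let $g:\mathbb{R}_+\to\mathbb{R}_+$ be convex with $g(0)=0$ and let $\chi>0$. Suppose the probability space supports a $d$-dimensional Brownian motion $(B_t)_{t\in[0,T]}$ whose augmented natural filtration $\mathbb{G}=(\mathcal{G}_t)_{t\in[0,T]}$ satisfies that $\mathcal{G}_T$ is independent of $\mathcal{F}_T$, and let $\mathcal{H}_t=\mathcal{F}_t\vee\mathcal{G}_t$, $\mathbb{H}=(\mathcal{H}_t)_{t\in[0,T]}$. Assume that $S=(S_t)_{t\in[0,T]}$ is a c\`adl\`ag $\mathbb{R}^d$-valued $\mathbb{F}$-local martingale under $P$ which is sticky with respect to $\mathbb{F}$. Then there exist $Q\sim P$ with $\|Q-P\|_{tv}<\chi$ and a $d$-dimensional $Q$-martingale $\tilde S$ with respect to $\mathbb{H}$ such that $$E_Q\, g\Big(\sup_{t\in[0,T]}|S_t-\tilde S_t|\Big)<\chi.$$ If $S$ has continuous trajectories then even $\sup_{t\in[0,T]}|S_t-\tilde S_t|<\chi$ holds a.s. Finally, $S$ is also a local martingale with respect to $\mathbb{H}$.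
   Context: $(\Omega,\mathcal{F},P)$ is a probability space with a filtration $\mathbb{F}=(\mathcal{F}_t)_{t\in[0,T]}$ satisfying the usual conditions (right-continuous, $\mathcal{F}_0$ contains all $P$-null sets). $\|\cdot\|_{tv}$ is the total variation norm of finite signed measures on $(\Omega,\mathcal{F})$. $|\cdot|$ is the Euclidean norm. A process $S$ is sticky with respect to $\mathbb{F}$ if for every $\mathbb{F}$-stopping time $\tau$ with values in $[0,T]$ and every strictly positive $\mathcal{F}_\tau$-measurable random variable $\kappa$, $P(\sup_{u\in[\tau,T]}|S_u-S_\tau|<\kappa\mid\mathcal{F}_\tau)>0$ a.s. *)

theory Defs
  imports "HOL-Probability.Probability"
begin

definition filtration_usual :: "'a measure \<Rightarrow> real \<Rightarrow> (real \<Rightarrow> 'a set set) \<Rightarrow> bool" where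
  "filtration_usual P T F \<longleftrightarrow>
     (\<forall>t\<in>{0..T}. sigma_algebra (space P) (F t) \<and> F t \<subseteq> sets P) \<and>
     (\<forall>s t. 0 \<le> s \<longrightarrow> s \<le> t \<longrightarrow> t \<le> T \<longrightarrow> F s \<subseteq> F t) \<and>
     (\<forall>t\<in>{0..<T}. F t = (\<Inter>u\<in>{t<..T}. F u)) \<and>
     null_sets P \<subseteq> F 0"

definition adapted_on :: "'a measure \<Rightarrow> (real \<Rightarrow> 'a set set) \<Rightarrow> real
    \<Rightarrow> (real \<Rightarrow> 'a \<Rightarrow> 'b::topological_space) \<Rightarrow> bool" where
  "adapted_on M F T X \<longleftrightarrow>
     (\<forall>t\<in>{0..T}. \<forall>A\<in>sets borel. X t -` A \<inter> space M \<in> F t)"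

definition stopping_time_on :: "'a measure \<Rightarrow> (real \<Rightarrow> 'a set set) \<Rightarrow> real \<Rightarrow> ('a \<Rightarrow> real) \<Rightarrow> bool" where
  "stopping_time_on M F T \<tau> \<longleftrightarrow>
     (\<forall>\<omega>\<in>space M. \<tau> \<omega> \<in> {0..T}) \<and>
     (\<forall>t\<in>{0..T}. {\<omega>\<in>space M. \<tau> \<omega> \<le> t} \<in> F t)"

definition pre_sigma_on :: "'a measure \<Rightarrow> (real \<Rightarrow> 'a set set) \<Rightarrow> real \<Rightarrow> ('a \<Rightarrow> real) \<Rightarrow> 'a set set" where
  "pre_sigma_on M F T \<tau> =
     {A. A \<subseteq> space M \<and> (\<forall>t\<in>{0..T}. A \<inter> {\<omega>\<in>space M. \<tau> \<omega> \<le> t} \<in> F t)}"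

text \<open>Martingale (vector valued) on {0..T} w.r.t. filtration F under the measure M:
  adapted, integrable, and E[X_t 1_A] = E[X_s 1_A] for s <= t and A in F_s
  (this is literally E[X_t | F_s] = X_s).\<close>
definition martingale_on :: "'a measure \<Rightarrow> (real \<Rightarrow> 'a set set) \<Rightarrow> real
    \<Rightarrow> (real \<Rightarrow> 'a \<Rightarrow> real ^ 'd) \<Rightarrow> bool" where
  "martingale_on M F T X \<longleftrightarrow>
     adapted_on M F T X \<and>
     (\<forall>t\<in>{0..T}. integrable M (X t)) \<and>
     (\<forall>s t. 0 \<le> s \<longrightarrow> s \<le> t \<longrightarrow> t \<le> T \<longrightarrow>
        (\<forall>A\<in>F s. (LINT \<omega>:A|M. X t \<omega>) = (LINT \<omega>:A|M. X s \<omega>)))"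

definition local_martingale_on :: "'a measure \<Rightarrow> (real \<Rightarrow> 'a set set) \<Rightarrow> real
    \<Rightarrow> (real \<Rightarrow> 'a \<Rightarrow> real ^ 'd) \<Rightarrow> bool" where
  "local_martingale_on M F T X \<longleftrightarrow>
     (\<exists>\<tau>::nat \<Rightarrow> 'a \<Rightarrow> real.
        (\<forall>n. stopping_time_on M F T (\<tau> n)) \<and>
        (\<forall>\<omega>\<in>space M. mono (\<lambda>n. \<tau> n \<omega>)) \<and>
        (AE \<omega> in M. \<exists>n. \<tau> n \<omega> = T) \<and>
        (\<forall>n. martingale_on M F T (\<lambda>t \<omega>. X (min t (\<tau> n \<omega>)) \<omega>)))"

definition cadlag_on :: "real \<Rightarrow> (real \<Rightarrow> 'b::topological_space) \<Rightarrow> bool" where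
  "cadlag_on T f \<longleftrightarrow>
     (\<forall>t\<in>{0..<T}. continuous (at_right t) f) \<and>
     (\<forall>t\<in>{0<..T}. \<exists>l. (f \<longlongrightarrow> l) (at_left t))"

definition sticky_on :: "'a measure \<Rightarrow> (real \<Rightarrow> 'a set set) \<Rightarrow> real
    \<Rightarrow> (real \<Rightarrow> 'a \<Rightarrow> real ^ 'd) \<Rightarrow> bool" where
  "sticky_on P F T S \<longleftrightarrow>
     (\<forall>\<tau> \<kappa>. stopping_time_on P F T \<tau> \<longrightarrow>
        \<kappa> \<in> borel_measurable (sigma (space P) (pre_sigma_on P F T \<tau>)) \<longrightarrow>
        (\<forall>\<omega>\<in>space P. \<kappa> \<omega> > 0) \<longrightarrow>
        (AE \<omega> in P. real_cond_exp P (sigma (space P) (pre_sigma_on P F T \<tau>))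
            (indicator {\<omega>'\<in>space P.
               (\<Squnion>u\<in>{\<tau> \<omega>'..T}. ennreal (norm (S u \<omega>' - S (\<tau> \<omega>') \<omega>'))) < ennreal (\<kappa> \<omega>')}) \<omega> > 0))"

definition brownian_motion_on :: "'a measure \<Rightarrow> real \<Rightarrow> (real \<Rightarrow> 'a \<Rightarrow> real ^ 'd) \<Rightarrow> bool" where
  "brownian_motion_on P T B \<longleftrightarrow>
     (\<forall>t\<in>{0..T}. B t \<in> borel_measurable P) \<and>
     (AE \<omega> in P. B 0 \<omega> = 0) \<and>
     (AE \<omega> in P. continuous_on {0..T} (\<lambda>t. B t \<omega>)) \<and>
     (\<forall>(n::nat) (t::nat \<Rightarrow> real). 0 \<le> t 0 \<longrightarrow> t n \<le> T \<longrightarrow> (\<forall>k<n. t k < t (Suc k)) \<longrightarrow>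
        prob_space.indep_vars P (\<lambda>_. borel) (\<lambda>k \<omega>. B (t (Suc k)) \<omega> - B (t k) \<omega>) {..<n}) \<and>
     (\<forall>s t. 0 \<le> s \<longrightarrow> s < t \<longrightarrow> t \<le> T \<longrightarrow>
        prob_space.indep_vars P (\<lambda>_. borel) (\<lambda>i \<omega>. (B t \<omega> - B s \<omega>) $ i) UNIV \<and>
        (\<forall>i. distributed P lborel (\<lambda>\<omega>. (B t \<omega> - B s \<omega>) $ i)
                (\<lambda>x. ennreal (normal_density 0 (sqrt (t - s)) x))))"

definition augmented_natural_filtration :: "'a measure \<Rightarrow> (real \<Rightarrow> 'a \<Rightarrow> 'b::topological_space)
    \<Rightarrow> real \<Rightarrow> 'a set set" where
  "augmented_natural_filtration P B t =
     sigma_sets (space P)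
       ((\<Union>s\<in>{0..t}. {B s -` A \<inter> space P | A. A \<in> sets borel}) \<union> null_sets P)"

definition join_filtration :: "'a measure \<Rightarrow> (real \<Rightarrow> 'a set set) \<Rightarrow> (real \<Rightarrow> 'a set set)
    \<Rightarrow> real \<Rightarrow> 'a set set" where
  "join_filtration P F G t = sigma_sets (space P) (F t \<union> G t)"

text \<open>Total variation norm of the signed measure Q - P (sup over finite measurable partitions,
  i.e. |Q - P|(Omega)).\<close>
definition tv_norm_diff :: "'a measure \<Rightarrow> 'a measure \<Rightarrow> real" where
  "tv_norm_diff Q P =
     Sup {(\<Sum>A\<in>\<A>. \<bar>measure Q A - measure P A\<bar>) | \<A>. finite \<A> \<and> \<A> \<subseteq> sets P \<and> disjoint \<A>}"

definition g_ext :: "(real \<Rightarrow> real) \<Rightarrow> ennreal \<Rightarrow> ennreal" where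
  "g_ext g u = (if u = \<infinity> then (\<Squnion>x\<in>{0..}. ennreal (g x)) else ennreal (g (enn2real u)))"

end

theory Submission
  imports Defs
begin

text \<open>
  The Brownian motion enters only through independence: if \<open>Q\<close> has a density that is measurable with respect to the
  final sigma-algebra of \<open>F\<close>, then every \<open>F\<close>-martingale under \<open>Q\<close> is also a martingale for the enlarged filtration, so
  everything can be done in \<open>F\<close>. Choose a localizing time \<open>\<tau>\<close> with \<open>P (\<tau> < T)\<close> small and a density \<open>Z\<close> that equals \<open>1\<close> on \<open>\<tau> = T\<close>
  and has conditional expectation \<open>1\<close> given the past at \<open>\<tau>\<close>. Then the total variation distance is at most
  \<open>2 P (\<tau> < T)\<close>, and the process stopped at \<open>\<tau>\<close> remains a martingale.

  In the cadlag case \<open>S\<close> stopped at \<open>\<tau>\<close> is the approximating martingale. By stickiness the deviation after \<open>\<tau>\<close> is small with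
  positive conditional probability, so \<open>Z\<close> can concentrate on this event and weigh down the remaining paths by
  the inverse of \<open>1 + g\<close> of their deviation.

  In the continuous case let \<open>\<sigma>\<^sub>0 = \<tau>\<close> and let \<open>\<sigma>\<^sub>k\<^sub>+\<^sub>1\<close> be the next time the process has moved by \<open>\<kappa>\<close>, or \<open>T\<close>; the walk
  retires when \<open>T\<close> is reached. Stickiness makes every conditional retirement probability \<open>p\<^sub>k\<close> positive, so \<open>Z\<close> can
  give weight \<open>1/2\<close> to each continuation, and the number of steps gets geometric tails. On retirement at step \<open>k\<close> the
  terminal value is corrected by an amount of size at most \<open>\<kappa>\<close>, known at time \<open>\<sigma>\<^sub>k\<close>, which makes the walk a martingale.
  The conditional expectations of the terminal value then stay within a multiple of \<open>\<kappa>\<close> of \<open>S\<close>.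
\<close>

section \<open>Conditional expectations\<close>

text \<open>Since \<open>Q\<close> must be equivalent to \<open>P\<close>, a density cannot kill the
  paths that move far after \<open>\<tau>\<close>. The stopped process therefore only achieves a
  small moment of the deviation; a uniform bound needs a martingale that follows \<open>S\<close>.
  Following \<open>S\<close> meets two obstacles. Reweighting may give the walk a drift, which the
  value at retirement has to absorb, and under \<open>P\<close> the probability \<open>p\<close> of
  retiring can be tiny, so that a correction of the form drift over \<open>p\<close> would be
  unbounded. Moreover, nothing bounds the moments of the number of steps under \<open>P\<close>.
  Halving the density on continuation cures both: retirement gets conditional mass
  \<open>(1 + p) / 2\<close>, at least one half whatever \<open>p\<close> is, against a halved
  drift, so the correction is the drift divided by \<open>1 + p\<close>; and the geometric tails
  dominate the linear growth of the walk. A recurring technical point is that conditional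
  probabilities and adaptedness are controlled only up to null sets, whereas densities should be
  positive and stopping times exact at every point; suitable versions are fixed at each such
  place.\<close>

context finite_measure_subalgebra
begin

lemma real_cond_exp_indicator_le_1:
  assumes "A \<in> sets M"
  shows "AE x in M. real_cond_exp M F (indicator A) x \<le> 1"
  using assms by (intro real_cond_exp_le_c) (auto simp: indicator_def emeasure_finite less_top[symmetric])

text \<open>Conditioning of nonnegative functions is available while integrability is still to be
  shown; this identifies it with the real-valued version.\<close>

lemma nn_cond_exp_indicator:
  assumes [measurable]: "A \<in> sets M"
  shows "AE x in M. nn_cond_exp M F (indicator A) x = ennreal (real_cond_exp M F (indicator A) x)"
proof -
  have "AE x in M. (0::ennreal) = nn_cond_exp M F (\<lambda>_. 0) x"
    by (rule nn_cond_exp_F_meas) simp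
  moreover have "AE x in M. nn_cond_exp M F (indicator A) x \<le> nn_cond_exp M F (\<lambda>_. 1) x"
    by (rule nn_cond_exp_mono) (auto simp: indicator_def)
  moreover have "AE x in M. (1::ennreal) = nn_cond_exp M F (\<lambda>_. 1) x"
    by (rule nn_cond_exp_F_meas) simp
  ultimately show ?thesis
  proof eventually_elim
    case (elim x)
    have "(\<lambda>x. ennreal (indicator A x)) = indicator A" "(\<lambda>x. ennreal (- indicator A x)) = (\<lambda>_. 0)"
      by (auto simp: indicator_def fun_eq_iff ennreal_neg)
    moreover have "nn_cond_exp M F (indicator A) x < top"
      using elim by (metis ennreal_one_less_top le_less_trans)
    ultimately show ?case
      using elim unfolding real_cond_exp_def by simp
  qed
qed

text \<open>Division by the conditional probability of \<open>A\<close> is undone by conditioning on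
  \<open>F\<close>, so the mass of \<open>\<phi>\<close> on \<open>N\<close> is moved onto
  \<open>A\<close>. Both densities below rest on this. Integrability comes first, through
  \<open>nn_cond_exp\<close>, since \<open>real_cond_exp_intg\<close> presupposes it.\<close>

lemma integral_weight_by_inverse_cond_prob:
  fixes p \<phi> :: "'a \<Rightarrow> real"
  assumes A[measurable]: "A \<in> sets M" and N[measurable]: "N \<in> sets F"
    and p[measurable]: "p \<in> borel_measurable F" and \<phi>[measurable]: "\<phi> \<in> borel_measurable F"
    and p_pos: "\<And>x. x \<in> space M \<Longrightarrow> p x > 0"
    and p_eq: "AE x in M. x \<in> N \<longrightarrow> real_cond_exp M F (indicator A) x = p x"
    and int: "integrable M (\<lambda>x. indicator N x * \<phi> x)"
  shows "integrable M (\<lambda>x. indicator N x * (\<phi> x / p x) * indicator A x)"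
    and "(\<integral>x. indicator N x * (\<phi> x / p x) * indicator A x \<partial>M) = (\<integral>x. indicator N x * \<phi> x \<partial>M)"
proof -
  have N'[measurable]: "N \<in> sets M" using N subalg by (auto simp: subalgebra_def)
  have [measurable]: "p \<in> borel_measurable M" "\<phi> \<in> borel_measurable M"
    using measurable_from_subalg[OF subalg p] measurable_from_subalg[OF subalg \<phi>] by auto
  let ?f = "\<lambda>x. indicator N x * (\<phi> x / p x)"
  have "(\<integral>\<^sup>+x. ennreal (norm (?f x * indicator A x)) \<partial>M) = (\<integral>\<^sup>+x. ennreal \<bar>?f x\<bar> * indicator A x \<partial>M)"
    by (intro nn_integral_cong) (auto simp: indicator_def)
  also have "\<dots> = (\<integral>\<^sup>+x. ennreal \<bar>?f x\<bar> * nn_cond_exp M F (indicator A) x \<partial>M)"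
    by (rule nn_cond_exp_intg[symmetric]) auto
  also have "\<dots> = (\<integral>\<^sup>+x. ennreal (norm (indicator N x * \<phi> x)) \<partial>M)"
  proof (rule nn_integral_cong_AE)
    show "AE x in M. ennreal \<bar>?f x\<bar> * nn_cond_exp M F (indicator A) x = ennreal (norm (indicator N x * \<phi> x))"
      using p_eq nn_cond_exp_indicator[OF A] AE_space
    proof eventually_elim
      case (elim x)
      show ?case
        using elim p_pos[of x]
        by (cases "x \<in> N") (auto simp: ennreal_mult[symmetric] abs_mult)
    qed
  qed
  also have "\<dots> < \<infinity>" using int by (simp add: integrable_iff_bounded)
  finally show 1: "integrable M (\<lambda>x. ?f x * indicator A x)"
    by (auto simp: integrable_iff_bounded)
  have "(\<integral>x. ?f x * indicator A x \<partial>M) = (\<integral>x. ?f x * real_cond_exp M F (indicator A) x \<partial>M)"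
    by (rule real_cond_exp_intg(2)[OF 1, symmetric]) auto
  also have "\<dots> = (\<integral>x. indicator N x * \<phi> x \<partial>M)"
  proof (rule integral_cong_AE)
    show "AE x in M. ?f x * real_cond_exp M F (indicator A) x = indicator N x * \<phi> x"
      using p_eq AE_space
    proof eventually_elim
      case (elim x)
      show ?case
        using elim p_pos[of x] by (cases "x \<in> N") auto
    qed
  qed auto
  finally show "(\<integral>x. ?f x * indicator A x \<partial>M) = (\<integral>x. indicator N x * \<phi> x \<partial>M)" .
qed

lemma AE_le_of_set_integral_le:
  fixes D :: "'a \<Rightarrow> real"
  assumes D: "integrable M D" and DF[measurable]: "D \<in> borel_measurable F" and C0[measurable]: "C0 \<in> sets F"
    and le: "\<And>C. C \<in> sets F \<Longrightarrow> C \<subseteq> C0 \<Longrightarrow> (\<integral>x. indicator C x * D x \<partial>M) \<le> c * measure M C"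
  shows "AE x in M. x \<in> C0 \<longrightarrow> D x \<le> c"
proof -
  \<comment> \<open>The test set is the violation itself: on it \<open>D - c\<close> is positive and
    yet has a nonpositive integral.\<close>
  define C where "C = {x \<in> space F. x \<in> C0 \<and> D x > c}"
  have CF[measurable]: "C \<in> sets F" unfolding C_def by measurable
  have CM[measurable]: "C \<in> sets M" using CF subalg by (auto simp: subalgebra_def)
  have int: "integrable M (\<lambda>x. indicator C x * D x)" "integrable M (\<lambda>x. indicator C x * c)"
    using integrable_mult_indicator[OF CM D] integrable_mult_indicator[OF CM, of "\<lambda>_. c"] by auto
  have eq: "(\<lambda>x. indicator C x * (D x - c)) = (\<lambda>x. indicator C x * D x - indicator C x * c)"
    by (auto simp: algebra_simps)
  have "C \<subseteq> C0" "C \<inter> space M = C" using sets.sets_into_space[OF CM] by (auto simp: C_def)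
  then have "(\<integral>x. indicator C x * (D x - c) \<partial>M) \<le> 0"
    using le[OF CF] unfolding eq by (subst Bochner_Integration.integral_diff[OF int]) (simp add: mult.commute)
  moreover have nn: "AE x in M. 0 \<le> indicator C x * (D x - c)"
    by (auto simp: C_def indicator_def)
  moreover have i: "integrable M (\<lambda>x. indicator C x * (D x - c))"
    unfolding eq using int by auto
  ultimately have "(\<integral>x. indicator C x * (D x - c) \<partial>M) = 0"
    using integral_nonneg_AE[OF nn] by simp
  then have "AE x in M. indicator C x * (D x - c) = 0"
    using integral_nonneg_eq_0_iff_AE[OF i nn] by simp
  then show ?thesis
    using AE_space
  proof eventually_elim
    case (elim x)
    then show ?case
      using subalg by (auto simp: C_def indicator_def subalgebra_def split: if_splits)
  qed
qed

lemma AE_abs_le_of_set_integral_le: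
  fixes D :: "'a \<Rightarrow> real"
  assumes D: "integrable M D" and DF[measurable]: "D \<in> borel_measurable F" and C0: "C0 \<in> sets F"
    and le: "\<And>C. C \<in> sets F \<Longrightarrow> C \<subseteq> C0 \<Longrightarrow> \<bar>\<integral>x. indicator C x * D x \<partial>M\<bar> \<le> c * measure M C"
  shows "AE x in M. x \<in> C0 \<longrightarrow> \<bar>D x\<bar> \<le> c"
proof -
  have "AE x in M. x \<in> C0 \<longrightarrow> D x \<le> c"
    using le by (intro AE_le_of_set_integral_le D DF C0) (auto simp: abs_le_iff)
  moreover have "AE x in M. x \<in> C0 \<longrightarrow> - D x \<le> c"
    using le D by (intro AE_le_of_set_integral_le C0) (auto simp: abs_le_iff)
  ultimately show ?thesis
    by eventually_elim (auto simp: abs_le_iff)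
qed

end

section \<open>Reweighting a process with random retirement\<close>

text \<open>\<open>G k\<close> is the past when step \<open>k\<close> begins and \<open>N k\<close>
  the set of paths still walking then. The intersection of all \<open>N k\<close> is empty, not
  merely null, so that every path in \<open>N 0\<close> has an exit index.\<close>

locale retirement = prob_space M for M :: "'a measure" +
  fixes G :: "nat \<Rightarrow> 'a measure" and N :: "nat \<Rightarrow> 'a set"
  assumes subalg: "\<And>k. subalgebra M (G k)"
    and filt: "\<And>k. sets (G k) \<subseteq> sets (G (Suc k))"
    and N_sets: "\<And>k. N k \<in> sets (G k)"
    and N_decr: "\<And>k. N (Suc k) \<subseteq> N k"
    and N_Inter: "(\<Inter>k. N k) = {}"
    and retire_pos: "\<And>k. AE x in M. real_cond_exp M (G k) (indicator (space M - N (Suc k))) x > 0"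
begin

text \<open>The default \<open>1\<close> takes effect on a null set only, by
  \<open>retire_pos\<close>, and makes division safe at every point.\<close>

definition retire_prob :: "nat \<Rightarrow> 'a \<Rightarrow> real" where
  "retire_prob k x =
     (let q = real_cond_exp M (G k) (indicator (space M - N (Suc k))) x in if q > 0 then q else 1)"

text \<open>The step during which a path of \<open>N 0\<close> leaves: \<open>k\<close> on
  \<open>N k - N (Suc k)\<close>.\<close>

definition exit_index :: "'a \<Rightarrow> nat" where
  "exit_index x = (LEAST k. x \<notin> N (Suc k))"

text \<open>Solves the balance that keeps the conditional mean of the density given
  \<open>G k\<close> at \<open>(1/2)^k\<close> on \<open>N k\<close>: with
  \<open>p = retire_prob k\<close>, retirement contributes
  \<open>p * weight k = (1/2)^Suc k * (1 + p)\<close> and continuation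
  \<open>(1/2)^Suc k * (1 - p)\<close>.\<close>

definition weight :: "nat \<Rightarrow> 'a \<Rightarrow> real" where
  "weight k x = (1/2)^k * (1 + retire_prob k x) / (2 * retire_prob k x)"

definition dens :: "'a \<Rightarrow> real" where
  "dens x = (if x \<in> N 0 then weight (exit_index x) x else 1)"

definition drift :: "(nat \<Rightarrow> 'a \<Rightarrow> real) \<Rightarrow> nat \<Rightarrow> 'a \<Rightarrow> real" where
  "drift f k = real_cond_exp M (G k) (\<lambda>x. indicator (N (Suc k)) x * (f (Suc k) x - f k x))"

text \<open>The divisor comes from the same balance for \<open>f\<close>: continuation brings
  \<open>(1/2)^Suc k * (drift f k + (1 - p) * f k)\<close>, and retirement, of mass
  \<open>(1/2)^Suc k * (1 + p)\<close>, has to supply what is missing to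
  \<open>(1/2)^k * f k\<close>.\<close>

definition terminal :: "(nat \<Rightarrow> 'a \<Rightarrow> real) \<Rightarrow> 'a \<Rightarrow> real" where
  "terminal f x = (if x \<in> N 0
     then f (exit_index x) x - drift f (exit_index x) x / (1 + retire_prob (exit_index x) x) else f 0 x)"

lemma filt_le: "j \<le> k \<Longrightarrow> sets (G j) \<subseteq> sets (G k)"
  by (induction k rule: dec_induct) (use filt in auto)

lemma space_G: "space (G k) = space M"
  using subalg by (auto simp: subalgebra_def)

lemma N_antimono: "j \<le> k \<Longrightarrow> N k \<subseteq> N j"
  by (induction k rule: dec_induct) (use N_decr in auto)

lemma sets_G_M: "A \<in> sets (G k) \<Longrightarrow> A \<in> sets M"
  using subalg by (auto simp: subalgebra_def)

lemma N_sets_M[measurable]: "N k \<in> sets M"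
  using N_sets sets_G_M by auto

lemma fin_subalg: "finite_measure_subalgebra M (G k)"
  using subalg by unfold_locales auto

lemma exit_index_eq:
  assumes "x \<in> N k" "x \<notin> N (Suc k)" shows "exit_index x = k"
  unfolding exit_index_def
proof (rule Least_equality)
  fix j assume "x \<notin> N (Suc j)"
  then show "k \<le> j" using assms N_antimono[of "Suc j" k] by (auto simp: not_less_eq_eq[symmetric])
qed (use assms in simp)

lemma exit_index: assumes "x \<in> N 0" shows "x \<in> N (exit_index x)" "x \<notin> N (Suc (exit_index x))"
proof -
  obtain k where "x \<notin> N k" using N_Inter by auto
  then have "\<exists>k. x \<notin> N (Suc k)" using assms by (metis not0_implies_Suc)
  then show *: "x \<notin> N (Suc (exit_index x))" unfolding exit_index_def by (rule LeastI_ex)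
  show "x \<in> N (exit_index x)"
  proof (cases "exit_index x")
    case (Suc j)
    then have "j < (LEAST k. x \<notin> N (Suc k))" by (simp add: exit_index_def)
    then have "\<not> x \<notin> N (Suc j)" by (rule not_less_Least)
    then show ?thesis using Suc by simp
  qed (use assms in simp)
qed

lemma retire_prob_pos: "retire_prob k x > 0"
  by (auto simp: retire_prob_def Let_def)

lemma retire_prob_measurable[measurable]: "retire_prob k \<in> borel_measurable (G k)"
  unfolding retire_prob_def Let_def by measurable

lemma retire_prob_AE: "AE x in M. real_cond_exp M (G k) (indicator (space M - N (Suc k))) x = retire_prob k x"
  using retire_pos[of k] by eventually_elim (simp add: retire_prob_def Let_def)

lemma weight_measurable[measurable]: "weight k \<in> borel_measurable (G k)"
  unfolding weight_def by measurable

lemma drift_measurable[measurable]: "drift f k \<in> borel_measurable (G k)"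
  unfolding drift_def by measurable

lemma exit_index_measurable:
  assumes "\<And>k. subalgebra H (G k)"
  shows "exit_index \<in> measurable H (count_space UNIV)"
proof -
  have [measurable]: "N k \<in> sets H" for k using assms[of k] N_sets[of k] by (auto simp: subalgebra_def)
  show ?thesis unfolding exit_index_def by measurable
qed

lemma dens_measurable:
  assumes "\<And>k. subalgebra H (G k)"
  shows "dens \<in> borel_measurable H"
proof -
  have [measurable]: "N 0 \<in> sets H" using assms[of 0] N_sets[of 0] by (auto simp: subalgebra_def)
  note [measurable] = exit_index_measurable[OF assms]
  have [measurable]: "weight k \<in> borel_measurable H" for k
    by (rule measurable_from_subalg[OF assms weight_measurable])
  have [measurable]: "(\<lambda>x. weight (exit_index x) x) \<in> borel_measurable H"
    by (rule measurable_compose_countable) auto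
  show ?thesis unfolding dens_def by measurable
qed

lemma terminal_measurable:
  assumes "\<And>k. subalgebra H (G k)" and f: "\<And>k. f k \<in> borel_measurable (G k)"
  shows "terminal f \<in> borel_measurable H"
proof -
  have [measurable]: "N 0 \<in> sets H" using assms(1)[of 0] N_sets[of 0] by (auto simp: subalgebra_def)
  note [measurable] = exit_index_measurable[OF assms(1)]
  have [measurable]: "drift f k \<in> borel_measurable H" "f k \<in> borel_measurable H" "retire_prob k \<in> borel_measurable H" for k
    by (auto intro!: measurable_from_subalg[OF assms(1)[of k]] f)
  have [measurable]: "(\<lambda>x. f (exit_index x) x - drift f (exit_index x) x / (1 + retire_prob (exit_index x) x)) \<in> borel_measurable H"
    by (rule measurable_compose_countable[where f="\<lambda>k x. f k x - drift f k x / (1 + retire_prob k x)"]) auto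
  show ?thesis unfolding terminal_def by measurable
qed

lemma dens_measurable_M[measurable]: "dens \<in> borel_measurable M"
  by (rule dens_measurable[OF subalg])

lemma dens_pos: "dens x > 0"
  using retire_prob_pos[of "exit_index x" x]
  by (auto simp: dens_def weight_def intro!: divide_pos_pos mult_pos_pos add_pos_pos)

lemma dens_eq_1: "x \<notin> N 0 \<Longrightarrow> dens x = 1"
  by (simp add: dens_def)

text \<open>The weights are chosen such that this one-step identity telescopes in the step number.\<close>

lemma dens_terminal_step:
  fixes f :: "nat \<Rightarrow> 'a \<Rightarrow> real"
  assumes f[measurable]: "\<And>k. f k \<in> borel_measurable (G k)" and int: "\<And>k. integrable M (f k)"
    and C: "C \<in> sets (G k)"
  shows "integrable M (\<lambda>x. indicator (C \<inter> (N k - N (Suc k))) x * (dens x * terminal f x))"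
    and "(\<integral>x. indicator (C \<inter> (N k - N (Suc k))) x * (dens x * terminal f x) \<partial>M) =
      (1/2)^k * (\<integral>x. indicator (C \<inter> N k) x * f k x \<partial>M)
      - (1/2)^Suc k * (\<integral>x. indicator (C \<inter> N (Suc k)) x * f (Suc k) x \<partial>M)"
proof -
  interpret fs: finite_measure_subalgebra M "G k" by (rule fin_subalg)
  \<comment> \<open>This is \<open>retire_prob k\<close> times density times terminal value on
    retirement at step \<open>k\<close>, arranged so that
    \<open>integral_weight_by_inverse_cond_prob\<close> applies to
    \<open>\<phi> x / retire_prob k x\<close>.\<close>
  define \<phi> where "\<phi> x = (1/2)^Suc k * ((1 + retire_prob k x) * f k x - drift f k x)" for x
  let ?A = "space M - N (Suc k)"
  let ?N = "C \<inter> N k"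
  note C[measurable] N_sets[of k, measurable]
  have CM[measurable]: "C \<in> sets M" by (rule sets_G_M[OF C])
  have NM[measurable]: "?N \<in> sets M" "C \<inter> N (Suc k) \<in> sets M" by auto
  have [measurable]: "f k \<in> borel_measurable M" "f (Suc k) \<in> borel_measurable M" for k
    using int by auto
  have [measurable]: "retire_prob k \<in> borel_measurable M"
    by (rule measurable_from_subalg[OF subalg retire_prob_measurable])
  let ?g = "\<lambda>x. indicator (N (Suc k)) x * (f (Suc k) x - f k x)"
  have g_int: "integrable M ?g"
    using integrable_mult_indicator[OF N_sets_M, of "\<lambda>x. f (Suc k) x - f k x" "Suc k"] int by auto
  have d_int: "integrable M (drift f k)"
    unfolding drift_def by (rule fs.real_cond_exp_int(1)[OF g_int])
  have p_AE: "AE x in M. real_cond_exp M (G k) (indicator ?A) x = retire_prob k x"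
    by (rule retire_prob_AE)
  have p_AE': "AE x in M. x \<in> ?N \<longrightarrow> real_cond_exp M (G k) (indicator ?A) x = retire_prob k x"
    using p_AE by eventually_elim simp
  have p_bd: "AE x in M. retire_prob k x \<le> 1"
    using p_AE fs.real_cond_exp_indicator_le_1[OF sets.compl_sets[OF N_sets_M[of "Suc k"]]] by eventually_elim simp
  have pf_int: "integrable M (\<lambda>x. f k x * retire_prob k x)"
  proof (rule Bochner_Integration.integrable_bound[OF int[of k]])
    show "AE x in M. norm (f k x * retire_prob k x) \<le> norm (f k x)"
      using p_bd
      by eventually_elim (use retire_prob_pos[of k] in \<open>auto simp: abs_mult mult_left_le less_imp_le\<close>)
  qed measurable
  have \<phi>_int: "integrable M \<phi>"
  proof -
    have "\<phi> = (\<lambda>x. (1/2)^Suc k * (f k x + f k x * retire_prob k x - drift f k x))"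
      by (auto simp: \<phi>_def algebra_simps)
    then show ?thesis using pf_int int[of k] d_int by simp
  qed
  have \<phi>_meas: "\<phi> \<in> borel_measurable (G k)" unfolding \<phi>_def by measurable
  have N\<phi>_int: "integrable M (\<lambda>x. indicator ?N x * \<phi> x)"
    using integrable_mult_indicator[OF NM(1) \<phi>_int] by simp
  have pt: "indicator (C \<inter> (N k - N (Suc k))) x * (dens x * terminal f x) =
      indicator ?N x * (\<phi> x / retire_prob k x) * indicator ?A x" if "x \<in> space M" for x
  proof (cases "x \<in> C \<inter> (N k - N (Suc k))")
    case True
    then have "x \<in> N 0" "exit_index x = k" using N_antimono[of 0 k] exit_index_eq by auto
    moreover have "1 + retire_prob k x \<noteq> 0" "retire_prob k x \<noteq> 0" using retire_prob_pos[of k x] by auto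
    ultimately show ?thesis
      using True that
      by (simp add: dens_def terminal_def weight_def \<phi>_def right_diff_distrib' diff_divide_distrib mult.assoc)
  qed (auto simp: indicator_def that)
  have "integrable M (\<lambda>x. indicator ?N x * (\<phi> x / retire_prob k x) * indicator ?A x)"
    and eq: "(\<integral>x. indicator ?N x * (\<phi> x / retire_prob k x) * indicator ?A x \<partial>M)
      = (\<integral>x. indicator ?N x * \<phi> x \<partial>M)"
    using fs.integral_weight_by_inverse_cond_prob[OF _ _ retire_prob_measurable \<phi>_meas retire_prob_pos p_AE' N\<phi>_int]
    by auto
  then show "integrable M (\<lambda>x. indicator (C \<inter> (N k - N (Suc k))) x * (dens x * terminal f x))"
    using pt by (simp cong: Bochner_Integration.integrable_cong)
  have i1: "integrable M (\<lambda>x. (indicator ?N x * f k x) * retire_prob k x)"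
    using integrable_mult_indicator[OF NM(1) pf_int] by (simp add: mult.assoc)
  have i2: "integrable M (\<lambda>x. indicator ?N x * f k x)"
    using integrable_mult_indicator[OF NM(1) int[of k]] by simp
  have i3: "integrable M (\<lambda>x. indicator ?N x * drift f k x)"
    using integrable_mult_indicator[OF NM(1) d_int] by simp
  have i4: "integrable M (\<lambda>x. indicator (C \<inter> N (Suc k)) x * f j x)" for j
    using integrable_mult_indicator[OF NM(2) int[of j]] by simp
  \<comment> \<open>Conditioning is read backwards: \<open>retire_prob k\<close> becomes the
    indicator of retirement and splits \<open>N k\<close> into retiring and continuing paths. The
    integrals of \<open>f k\<close> over \<open>N (Suc k)\<close> in \<open>e1\<close> and
    \<open>e2\<close> cancel at the end.\<close>
  have e1: "(\<integral>x. (indicator ?N x * f k x) * retire_prob k x \<partial>M) =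
      (\<integral>x. indicator ?N x * f k x \<partial>M) - (\<integral>x. indicator (C \<inter> N (Suc k)) x * f k x \<partial>M)"
  proof -
    have i: "integrable M (\<lambda>x. (indicator ?N x * f k x) * indicator ?A x)"
      using integrable_mult_indicator[OF _ i2, of ?A] by (simp add: mult.commute)
    have "(\<integral>x. (indicator ?N x * f k x) * retire_prob k x \<partial>M) =
        (\<integral>x. (indicator ?N x * f k x) * real_cond_exp M (G k) (indicator ?A) x \<partial>M)"
      using p_AE by (intro integral_cong_AE) (auto)
    also have "\<dots> = (\<integral>x. (indicator ?N x * f k x) * indicator ?A x \<partial>M)"
      by (rule fs.real_cond_exp_intg(2)[OF i]) auto
    also have "\<dots> = (\<integral>x. indicator ?N x * f k x - indicator (C \<inter> N (Suc k)) x * f k x \<partial>M)"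
      using N_decr[of k] by (intro Bochner_Integration.integral_cong) (auto simp: indicator_def)
    finally show ?thesis
      using i2 i4 by simp
  qed
  have e2: "(\<integral>x. indicator ?N x * drift f k x \<partial>M) =
      (\<integral>x. indicator (C \<inter> N (Suc k)) x * f (Suc k) x \<partial>M) - (\<integral>x. indicator (C \<inter> N (Suc k)) x * f k x \<partial>M)"
  proof -
    have "(\<integral>x. indicator ?N x * drift f k x \<partial>M) = (\<integral>x. indicator ?N x * ?g x \<partial>M)"
      unfolding drift_def using integrable_mult_indicator[OF NM(1) g_int]
      by (intro fs.real_cond_exp_intg(2)) auto
    also have "\<dots> = (\<integral>x. indicator (C \<inter> N (Suc k)) x * f (Suc k) x - indicator (C \<inter> N (Suc k)) x * f k x \<partial>M)"
      using N_decr[of k] by (intro Bochner_Integration.integral_cong) (auto simp: indicator_def)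
    finally show ?thesis using i4 by simp
  qed
  have "(\<integral>x. indicator (C \<inter> (N k - N (Suc k))) x * (dens x * terminal f x) \<partial>M) = (\<integral>x. indicator ?N x * \<phi> x \<partial>M)"
    unfolding eq[symmetric] using pt by (intro Bochner_Integration.integral_cong) auto
  also have "\<dots> = (\<integral>x. (1/2)^Suc k * (indicator ?N x * f k x + indicator ?N x * f k x * retire_prob k x - indicator ?N x * drift f k x) \<partial>M)"
    by (intro Bochner_Integration.integral_cong) (auto simp: \<phi>_def algebra_simps)
  also have "\<dots> = (1/2)^Suc k * ((\<integral>x. indicator ?N x * f k x \<partial>M) + (\<integral>x. indicator ?N x * f k x * retire_prob k x \<partial>M)
      - (\<integral>x. indicator ?N x * drift f k x \<partial>M))"
    using i1 i2 i3 by simp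
  also have "\<dots> = (1/2)^k * (\<integral>x. indicator ?N x * f k x \<partial>M)
      - (1/2)^Suc k * (\<integral>x. indicator (C \<inter> N (Suc k)) x * f (Suc k) x \<partial>M)"
    unfolding e1 e2 by (simp add: algebra_simps)
  finally show "(\<integral>x. indicator (C \<inter> (N k - N (Suc k))) x * (dens x * terminal f x) \<partial>M) = \<dots>" .
qed

text \<open>Kept to finitely many steps because integrability of the full product is not known yet;
  the last term is the remainder that later has to vanish.\<close>

lemma dens_terminal_telescope:
  fixes f :: "nat \<Rightarrow> 'a \<Rightarrow> real"
  assumes f: "\<And>k. f k \<in> borel_measurable (G k)" and int: "\<And>k. integrable M (f k)"
    and C: "C \<in> sets (G k)" "C \<subseteq> N k"
  shows "integrable M (\<lambda>x. indicator (C - N (k + m)) x * (dens x * terminal f x)) \<and>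
    (\<integral>x. indicator (C - N (k + m)) x * (dens x * terminal f x) \<partial>M) =
      (1/2)^k * (\<integral>x. indicator C x * f k x \<partial>M)
      - (1/2)^(k + m) * (\<integral>x. indicator (C \<inter> N (k + m)) x * f (k + m) x \<partial>M)"
proof (induction m)
  case 0
  have *: "indicator (C - N k) x = (0::real)" "C \<inter> N k = C" for x using C by (auto simp: indicator_def)
  show ?case unfolding add_0_right * by simp
next
  case (Suc m)
  have "C \<in> sets (G (k + m))" using filt_le[of k "k+m"] C by auto
  note s = dens_terminal_step[of f, OF f int this]
  have eq: "indicator (C - N (k + Suc m)) x * y =
    indicator (C - N (k + m)) x * y + indicator (C \<inter> (N (k + m) - N (Suc (k + m)))) x * y" for x and y :: real
    using N_decr[of "k + m"] by (auto simp: indicator_def)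
  show ?case
    unfolding eq using Suc s by simp
qed

text \<open>For the constant walk the drift vanishes, so the density itself becomes an instance of
  the telescoping identity.\<close>

lemma terminal_const_AE: "AE x in M. terminal (\<lambda>_ _. 1) x = 1"
proof -
  have "AE x in M. drift (\<lambda>_ _. 1) k x = 0" for k
  proof -
    interpret fs: finite_measure_subalgebra M "G k" by (rule fin_subalg)
    show ?thesis unfolding drift_def by (simp add: fs.real_cond_exp_F_meas)
  qed
  then have "AE x in M. \<forall>k. drift (\<lambda>_ _. 1) k x = 0" by (simp add: AE_all_countable)
  then show ?thesis by eventually_elim (simp add: terminal_def)
qed

lemma eventually_left: "\<forall>\<^sub>F m in sequentially. x \<notin> N (k + m)"
proof -
  obtain j where "x \<notin> N j" using N_Inter by auto
  then have "x \<notin> N (k + m)" if "m \<ge> j" for m using N_antimono[of j "k+m"] that by auto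
  then show ?thesis by (auto simp: eventually_sequentially)
qed

lemma indicator_left_tendsto:
  "(\<lambda>m. indicator (C - N (k + m)) x * y) \<longlonglongrightarrow> indicator C x * (y::real)"
  by (rule tendsto_eventually, rule eventually_mono[OF eventually_left[of x k]]) (auto simp: indicator_def)

text \<open>The invariant behind the choice of \<open>weight\<close>: the conditional mean of
  \<open>dens\<close> given \<open>G k\<close> is \<open>(1/2)^k\<close> on \<open>N k\<close>.
  Truncations away from \<open>N (k + m)\<close> increase with \<open>m\<close>, and the remainder
  is at most \<open>(1/2)^(k + m)\<close>; monotone convergence therefore yields integrability
  together with the value.\<close>

lemma integral_dens:
  assumes C: "C \<in> sets (G k)" "C \<subseteq> N k"
  shows "integrable M (\<lambda>x. indicator C x * dens x)"
    and "(\<integral>x. indicator C x * dens x \<partial>M) = (1/2)^k * prob C"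
proof -
  have CM[measurable]: "C \<in> sets M" by (rule sets_G_M[OF C(1)])
  let ?one = "\<lambda>_ _. 1 :: real"
  have s: "integrable M (\<lambda>x. indicator (C - N (k + m)) x * (dens x * terminal ?one x)) \<and>
    (\<integral>x. indicator (C - N (k + m)) x * (dens x * terminal ?one x) \<partial>M) =
      (1/2)^k * (\<integral>x. indicator C x * 1 \<partial>M) - (1/2)^(k + m) * (\<integral>x. indicator (C \<inter> N (k + m)) x * 1 \<partial>M)" for m
    by (rule dens_terminal_telescope[OF _ _ C, of ?one]) simp_all
  have [measurable]: "terminal ?one \<in> borel_measurable M"
    by (rule terminal_measurable[OF subalg, of ?one]) simp
  define u where "u m x = indicator (C - N (k + m)) x * dens x" for m x
  have ue: "integrable M (u m) = integrable M (\<lambda>x. indicator (C - N (k + m)) x * (dens x * terminal (\<lambda>_ _. 1) x))"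
    "(\<integral>x. u m x \<partial>M) = (\<integral>x. indicator (C - N (k + m)) x * (dens x * terminal (\<lambda>_ _. 1) x) \<partial>M)" for m
    unfolding u_def
    by (rule integrable_cong_AE[OF _ _ eventually_mono[OF terminal_const_AE]]; simp)
      (rule integral_cong_AE[OF _ _ eventually_mono[OF terminal_const_AE]]; simp)
  have u_int: "integrable M (u m)" for m using s[of m] ue(1)[of m] by simp
  have int_eq: "(\<integral>x. u m x \<partial>M) = (1/2)^k * prob (C \<inter> space M) - (1/2)^(k + m) * prob (C \<inter> N (k + m) \<inter> space M)" for m
    using s[of m] ue(2)[of m] by (simp add: Int_assoc)
  have "C \<inter> space M = C" using sets.sets_into_space[OF CM] by auto
  then have lim: "(\<lambda>m. \<integral>x. u m x \<partial>M) \<longlonglongrightarrow> (1/2)^k * prob C - 0"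
    unfolding int_eq
  proof (intro tendsto_diff, simp)
    have "(\<lambda>m. (1/2::real)^(k + m)) \<longlonglongrightarrow> 0"
      using LIMSEQ_ignore_initial_segment[OF LIMSEQ_power_zero[of "1/2::real"], of k] by (simp add: add.commute)
    then show "(\<lambda>m. (1/2) ^ (k + m) * prob (C \<inter> N (k + m) \<inter> space M)) \<longlonglongrightarrow> 0"
      by (rule Lim_null_comparison[rotated]) (auto intro!: always_eventually mult_left_le)
  qed
  have mono: "AE x in M. mono (\<lambda>m. u m x)"
  proof (intro AE_I2 monoI)
    fix x and m n :: nat assume "m \<le> n"
    then have "C - N (k + m) \<subseteq> C - N (k + n)" using N_antimono[of "k + m" "k + n"] by auto
    then show "u m x \<le> u n x"
      unfolding u_def using dens_pos[of x] by (intro mult_right_mono) (auto simp: indicator_def)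
  qed
  have conv: "AE x in M. (\<lambda>m. u m x) \<longlonglongrightarrow> indicator C x * dens x"
    unfolding u_def by (auto intro: indicator_left_tendsto)
  show "integrable M (\<lambda>x. indicator C x * dens x)"
    by (rule integrable_monotone_convergence[OF u_int mono conv lim]) measurable
  show "(\<integral>x. indicator C x * dens x \<partial>M) = (1/2)^k * prob C"
    using integral_monotone_convergence[OF u_int mono conv lim] by simp
qed

lemma integral_dens_0:
  assumes C: "C \<in> sets (G 0)"
  shows "integrable M (\<lambda>x. indicator C x * dens x)"
    and "(\<integral>x. indicator C x * dens x \<partial>M) = prob C"
proof -
  have CM[measurable]: "C \<in> sets M" by (rule sets_G_M[OF C])
  have CN: "C \<inter> N 0 \<in> sets (G 0)" "C \<inter> N 0 \<subseteq> N 0" using C N_sets by auto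
  have eq: "indicator C x * dens x = indicator (C \<inter> N 0) x * dens x + indicator (C - N 0) x" for x
    by (auto simp: indicator_def dens_eq_1)
  have i: "integrable M (indicator (C - N 0) :: 'a \<Rightarrow> real)"
    by (auto simp: emeasure_finite less_top[symmetric])
  show "integrable M (\<lambda>x. indicator C x * dens x)"
    unfolding eq using integral_dens[OF CN] i by auto
  have "(C - N 0) \<inter> space M = C - N 0" using sets.sets_into_space[OF CM] by auto
  then show "(\<integral>x. indicator C x * dens x \<partial>M) = prob C"
    unfolding eq using integral_dens[OF CN] i finite_measure_Diff'[OF CM N_sets_M[of 0]] by simp
qed

lemma dens_int: "integrable M dens"
proof -
  have "integrable M dens \<longleftrightarrow> integrable M (\<lambda>x. indicator (space M) x * dens x)"
    by (rule Bochner_Integration.integrable_cong) (auto simp: indicator_def)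
  then show ?thesis using integral_dens_0(1)[of "space M"] space_G[of 0] sets.top[of "G 0"] by auto
qed

text \<open>A \<open>G k\<close>-measurable factor comes out of the conditional expectation of
  \<open>dens\<close>. This turns integrals under \<open>M\<close> that carry the factor
  \<open>(1/2)^k\<close> back into integrals under the new measure.\<close>

lemma integral_dens_mult:
  assumes C: "C \<in> sets (G k)" "C \<subseteq> N k" and h[measurable]: "h \<in> borel_measurable (G k)"
    and int: "integrable M (\<lambda>x. dens x * h x)"
  shows "(\<integral>x. indicator C x * (dens x * h x) \<partial>M) = (1/2)^k * (\<integral>x. indicator C x * h x \<partial>M)"
proof -
  interpret fs: finite_measure_subalgebra M "G k" by (rule fin_subalg)
  note C(1)[measurable] N_sets[of k, measurable]
  have [measurable]: "C \<in> sets M" using sets_G_M[OF C(1)] by auto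
  have [measurable]: "h \<in> borel_measurable M" by (rule measurable_from_subalg[OF subalg h])
  have AE: "AE x in M. real_cond_exp M (G k) (\<lambda>x. indicator (N k) x * dens x) x = (1/2)^k * indicator (N k) x"
  proof (rule fs.real_cond_exp_charact)
    fix A assume A: "A \<in> sets (G k)"
    then have AN: "A \<inter> N k \<in> sets (G k)" "A \<inter> N k \<subseteq> N k" by auto
    have AM: "A \<inter> N k \<inter> space M = A \<inter> N k" using sets.sets_into_space[OF N_sets_M[of k]] by auto
    have "(\<integral>x\<in>A. indicator (N k) x * dens x \<partial>M) = (\<integral>x. indicator (A \<inter> N k) x * dens x \<partial>M)"
      by (auto simp: set_lebesgue_integral_def indicator_inter_arith mult.assoc)
    also have "\<dots> = (\<integral>x. (1/2)^k * indicator (A \<inter> N k) x \<partial>M)"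
      using integral_dens(2)[OF AN] AM by simp
    also have "\<dots> = (\<integral>x\<in>A. (1/2)^k * indicator (N k) x \<partial>M)"
      unfolding set_lebesgue_integral_def
      by (intro Bochner_Integration.integral_cong) (auto simp: indicator_def)
    finally show "(\<integral>x\<in>A. indicator (N k) x * dens x \<partial>M) = (\<integral>x\<in>A. (1/2)^k * indicator (N k) x \<partial>M)" .
  next
    show "integrable M (\<lambda>x. indicator (N k) x * dens x)" using integral_dens(1)[OF N_sets] by auto
    show "integrable M (\<lambda>x. (1/2::real)^k * indicator (N k) x)"
      by (auto simp: emeasure_finite less_top[symmetric])
  qed measurable
  have eq: "indicator C x * (dens x * h x) = (indicator C x * h x) * (indicator (N k) x * dens x)" for x
    using C(2) by (auto simp: indicator_def)
  have i: "integrable M (\<lambda>x. (indicator C x * h x) * (indicator (N k) x * dens x))"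
    unfolding eq[symmetric] using integrable_mult_indicator[OF _ int, of C] by simp
  have "(\<integral>x. indicator C x * (dens x * h x) \<partial>M) =
      (\<integral>x. (indicator C x * h x) * real_cond_exp M (G k) (\<lambda>x. indicator (N k) x * dens x) x \<partial>M)"
    unfolding eq by (rule fs.real_cond_exp_intg(2)[OF i, symmetric]) measurable
  also have "\<dots> = (\<integral>x. (1/2)^k * (indicator C x * h x) \<partial>M)"
  proof (rule integral_cong_AE)
    show "AE x in M. (indicator C x * h x) * real_cond_exp M (G k) (\<lambda>x. indicator (N k) x * dens x) x =
        (1/2)^k * (indicator C x * h x)"
      using AE
    proof eventually_elim
      case (elim x)
      show ?case unfolding elim using C(2) by (auto split: split_indicator)
    qed
  qed measurable
  finally show ?thesis by simp
qed

text \<open>\<open>Suc (exit_index x)\<close> counts the \<open>k\<close> with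
  \<open>x \<in> N k\<close>, and the new mass of \<open>N k\<close> is at most
  \<open>(1/2)^k\<close>. The number of steps is thus integrable under the new measure.\<close>

lemma integral_dens_count:
  "integrable M (\<lambda>x. dens x * (if x \<in> N 0 then real (Suc (exit_index x)) else 0))" (is "integrable M ?h")
proof -
  note [measurable] = exit_index_measurable[OF subalg]
  have [measurable]: "?h \<in> borel_measurable M" by measurable
  have pt: "ennreal (norm (?h x)) = (\<Sum>k. ennreal (indicator (N k) x * dens x))" for x
  proof (cases "x \<in> N 0")
    case True
    have in_iff: "x \<in> N k \<longleftrightarrow> k \<le> exit_index x" for k
      using exit_index[OF True] N_antimono[of k "exit_index x"] N_antimono[of "Suc (exit_index x)" k]
      by (auto simp: not_less_eq_eq[symmetric])
    have "(\<Sum>k. ennreal (indicator (N k) x * dens x)) = (\<Sum>k\<le>exit_index x. ennreal (indicator (N k) x * dens x))"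
      by (rule suminf_finite) (auto simp: in_iff)
    also have "\<dots> = (\<Sum>k\<le>exit_index x. ennreal (dens x))"
      by (intro sum.cong) (auto simp: in_iff)
    also have "\<dots> = ennreal (norm (?h x))"
      using True dens_pos[of x] by (simp add: ennreal_of_nat_eq_real_of_nat ennreal_mult[symmetric] abs_mult mult.commute del: of_nat_Suc)
    finally show ?thesis ..
  next
    case False
    then have "x \<notin> N k" for k using N_antimono[of 0 k] by auto
    then show ?thesis using False by simp
  qed
  have "(\<integral>\<^sup>+x. ennreal (norm (?h x)) \<partial>M) = (\<Sum>k. \<integral>\<^sup>+x. ennreal (indicator (N k) x * dens x) \<partial>M)"
    unfolding pt by (rule nn_integral_suminf) measurable
  also have "\<dots> \<le> (\<Sum>k. ennreal ((1/2)^k))"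
  proof (rule suminf_le[OF _ summableI summableI])
    fix k
    have "(\<integral>\<^sup>+x. ennreal (indicator (N k) x * dens x) \<partial>M) = ennreal ((1/2)^k * prob (N k))"
      using integral_dens[OF N_sets, of k] dens_pos
      by (subst nn_integral_eq_integral) (auto simp: less_imp_le)
    also have "\<dots> \<le> ennreal ((1/2)^k)" by (intro ennreal_leI mult_left_le) auto
    finally show "(\<integral>\<^sup>+x. ennreal (indicator (N k) x * dens x) \<partial>M) \<le> ennreal ((1/2)^k)" .
  qed
  also have "\<dots> < \<infinity>"
    by (subst suminf_ennreal2) (auto simp: summable_geometric)
  finally show ?thesis by (auto simp: integrable_iff_bounded)
qed

end

section \<open>Densities of conditional mean one on a sub-sigma-algebra\<close>

lemma
  fixes Z :: "'a \<Rightarrow> real" and f :: "'a \<Rightarrow> 'b::{banach, second_countable_topology}"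
  assumes M: "finite_measure M" and sub: "subalgebra M F" and Z: "integrable M Z" "\<And>x. Z x \<ge> 0"
    and eq: "\<And>C. C \<in> sets F \<Longrightarrow> (\<integral>x. indicator C x * Z x \<partial>M) = measure M C"
    and f: "f \<in> borel_measurable F"
  shows integrable_density_subalg_iff: "integrable M (\<lambda>x. Z x *\<^sub>R f x) \<longleftrightarrow> integrable M f"
    and integral_density_subalg: "(\<integral>x. Z x *\<^sub>R f x \<partial>M) = (\<integral>x. f x \<partial>M)"
proof -
  interpret finite_measure M by (rule M)
  let ?D = "density M (\<lambda>x. ennreal (Z x))"
  have [measurable]: "Z \<in> borel_measurable M" using Z by auto
  have fM[measurable]: "f \<in> borel_measurable M" by (rule measurable_from_subalg[OF sub f])
  have subD: "subalgebra ?D F" using sub by (simp add: subalgebra_def)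
  \<comment> \<open>The assumption on \<open>Z\<close> says that the two measures agree on
    \<open>F\<close>, and integrals of \<open>F\<close>-measurable functions see only the
    restriction to \<open>F\<close>.\<close>
  have "restr_to_subalg ?D F = restr_to_subalg M F"
  proof (rule measure_eqI)
    show "sets (restr_to_subalg ?D F) = sets (restr_to_subalg M F)"
      by (simp add: sets_restr_to_subalg[OF sub] sets_restr_to_subalg[OF subD])
    fix C assume "C \<in> sets (restr_to_subalg ?D F)"
    then have C: "C \<in> sets F" by (simp add: sets_restr_to_subalg[OF subD])
    then have CM[measurable]: "C \<in> sets M" using sub by (auto simp: subalgebra_def)
    have "emeasure ?D C = (\<integral>\<^sup>+x. ennreal (indicator C x * Z x) \<partial>M)"
      by (subst emeasure_density) (auto intro!: nn_integral_cong simp: indicator_def)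
    also have "\<dots> = ennreal (\<integral>x. indicator C x * Z x \<partial>M)"
      using integrable_mult_indicator[OF CM Z(1)] Z(2)
      by (intro nn_integral_eq_integral) auto
    also have "\<dots> = emeasure M C" using eq[OF C] by (simp add: emeasure_eq_measure)
    finally show "emeasure (restr_to_subalg ?D F) C = emeasure (restr_to_subalg M F) C"
      by (simp add: emeasure_restr_to_subalg[OF sub C] emeasure_restr_to_subalg[OF subD C])
  qed
  note R = this
  have "integrable M (\<lambda>x. Z x *\<^sub>R f x) \<longleftrightarrow> integrable ?D f"
    using Z by (subst integrable_density) auto
  also have "\<dots> \<longleftrightarrow> integrable (restr_to_subalg M F) f"
    using integrable_in_subalg[OF subD f] integrable_from_subalg[OF subD, of f] R by auto
  also have "\<dots> \<longleftrightarrow> integrable M f"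
    using integrable_in_subalg[OF sub f] integrable_from_subalg[OF sub, of f] by auto
  finally show "integrable M (\<lambda>x. Z x *\<^sub>R f x) \<longleftrightarrow> integrable M f" .
  have "(\<integral>x. Z x *\<^sub>R f x \<partial>M) = (\<integral>x. f x \<partial>?D)"
    using Z by (subst integral_density) auto
  also have "\<dots> = (\<integral>x. f x \<partial>M)"
    using integral_subalgebra2[OF subD f] integral_subalgebra2[OF sub f] R by simp
  finally show "(\<integral>x. Z x *\<^sub>R f x \<partial>M) = (\<integral>x. f x \<partial>M)" .
qed

section \<open>Walks with bounded steps and random retirement\<close>

locale retirement_process = retirement M G N
  for M :: "'a measure" and G :: "nat \<Rightarrow> 'a measure" and N :: "nat \<Rightarrow> 'a set" +
  fixes f :: "nat \<Rightarrow> 'a \<Rightarrow> real" and \<kappa> :: real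
  assumes f[measurable]: "\<And>k. f k \<in> borel_measurable (G k)"
    and f0_int: "integrable M (f 0)"
    and f_step: "\<And>k x. x \<in> space M \<Longrightarrow> \<bar>f (Suc k) x - f k x\<bar> \<le> \<kappa>"
begin

lemma f_M[measurable]: "f k \<in> borel_measurable M"
  by (rule measurable_from_subalg[OF subalg f])

lemma terminal_M[measurable]: "terminal f \<in> borel_measurable M"
  by (rule terminal_measurable[OF subalg f])

lemma f_bound: "x \<in> space M \<Longrightarrow> \<bar>f k x\<bar> \<le> \<bar>f 0 x\<bar> + real k * \<kappa>"
proof (induction k)
  case (Suc k)
  then show ?case using f_step[of x k] by (auto simp: algebra_simps)
qed simp

lemma \<kappa>_nonneg: "0 \<le> \<kappa>"
proof -
  obtain x where "x \<in> space M" using not_empty by blast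
  from f_step[OF this, of 0] show ?thesis by linarith
qed

lemma f_int: "integrable M (f k)"
proof (rule Bochner_Integration.integrable_bound)
  show "integrable M (\<lambda>x. \<bar>f 0 x\<bar> + real k * \<kappa>)" using f0_int by auto
  show "AE x in M. norm (f k x) \<le> norm (\<bar>f 0 x\<bar> + real k * \<kappa>)"
    using f_bound[of _ k] by (intro AE_I2) force
qed (rule f_M)

lemma dens_f0_int: "integrable M (\<lambda>x. dens x * f 0 x)"
proof -
  have "integrable M (\<lambda>x. dens x *\<^sub>R f 0 x) \<longleftrightarrow> integrable M (f 0)"
    by (rule integrable_density_subalg_iff[OF finite_measure_axioms subalg[of 0] dens_int _ integral_dens_0(2) f[of 0]])
      (rule less_imp_le[OF dens_pos])
  then show ?thesis using f0_int by simp
qed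

lemma dens_f_int: "integrable M (\<lambda>x. dens x * f k x)"
proof (rule Bochner_Integration.integrable_bound)
  show "integrable M (\<lambda>x. \<bar>dens x * f 0 x\<bar> + real k * \<kappa> * dens x)" using dens_f0_int dens_int by auto
  show "AE x in M. norm (dens x * f k x) \<le> norm (\<bar>dens x * f 0 x\<bar> + real k * \<kappa> * dens x)"
  proof (rule AE_I2)
    fix x assume "x \<in> space M"
    then have "dens x * \<bar>f k x\<bar> \<le> dens x * (\<bar>f 0 x\<bar> + real k * \<kappa>)"
      using f_bound[of x k] dens_pos[of x] by (intro mult_left_mono) auto
    then show "norm (dens x * f k x) \<le> norm (\<bar>dens x * f 0 x\<bar> + real k * \<kappa> * dens x)"
      using dens_pos[of x] by (auto simp: abs_mult algebra_simps)
  qed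
qed measurable

lemma drift_bound: "AE x in M. \<forall>k. \<bar>drift f k x\<bar> \<le> \<kappa>"
proof -
  have "AE x in M. \<bar>drift f k x\<bar> \<le> \<kappa>" for k
  proof -
    interpret fs: finite_measure_subalgebra M "G k" by (rule fin_subalg)
    have int: "integrable M (\<lambda>x. indicator (N (Suc k)) x * (f (Suc k) x - f k x))"
      using integrable_mult_indicator[OF N_sets_M, of "\<lambda>x. f (Suc k) x - f k x" "Suc k"] f_int by auto
    have bd: "\<bar>indicator (N (Suc k)) x * (f (Suc k) x - f k x)\<bar> \<le> \<kappa>" if "x \<in> space M" for x
      using f_step[OF that, of k] \<kappa>_nonneg by (cases "x \<in> N (Suc k)") simp_all
    have "AE x in M. drift f k x \<le> \<kappa>" unfolding drift_def
      by (intro fs.real_cond_exp_le_c[OF int] AE_I2 abs_le_D1[OF bd])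
    moreover have "AE x in M. drift f k x \<ge> - \<kappa>" unfolding drift_def
      by (intro fs.real_cond_exp_ge_c[OF int] AE_I2) (use bd abs_le_D2 in \<open>force simp: minus_le_iff\<close>)
    ultimately show ?thesis by eventually_elim auto
  qed
  then show ?thesis by (simp add: AE_all_countable)
qed

text \<open>The drift is divided by \<open>1 + retire_prob k\<close>, which is at least
  \<open>1\<close>, and not by a probability that may be tiny; so the correction inherits the bound
  on a single step.\<close>

lemma terminal_near: "AE x in M. \<forall>k. x \<in> N k - N (Suc k) \<longrightarrow> \<bar>terminal f x - f k x\<bar> \<le> \<kappa>"
  using drift_bound
proof eventually_elim
  case (elim x)
  show ?case
  proof (intro allI impI)
    fix k assume x: "x \<in> N k - N (Suc k)"
    then have "x \<in> N 0" "exit_index x = k" using N_antimono[of 0 k] exit_index_eq by auto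
    then have "\<bar>terminal f x - f k x\<bar> = \<bar>drift f k x\<bar> / (1 + retire_prob k x)"
      using retire_prob_pos[of k x] by (simp add: terminal_def)
    also have "\<dots> \<le> \<bar>drift f k x\<bar> / 1" using retire_prob_pos[of k x] by (intro divide_left_mono) auto
    finally show "\<bar>terminal f x - f k x\<bar> \<le> \<kappa>" using elim[rule_format, of k] by simp
  qed
qed

text \<open>Each step adds at most \<open>\<kappa>\<close> to \<open>\<bar>f 0 x\<bar>\<close> and
  the correction once more \<open>\<kappa>\<close>; \<open>integral_dens_count\<close> controls the
  total.\<close>

lemma dens_terminal_int: "integrable M (\<lambda>x. dens x * terminal f x)"
proof (rule Bochner_Integration.integrable_bound)
  let ?c = "\<lambda>x. dens x * (if x \<in> N 0 then real (Suc (exit_index x)) else 0)"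
  show "integrable M (\<lambda>x. \<bar>dens x * f 0 x\<bar> + \<kappa> * ?c x)"
    by (intro Bochner_Integration.integrable_add integrable_abs dens_f0_int integrable_mult_right integral_dens_count)
  show "AE x in M. norm (dens x * terminal f x) \<le> norm (\<bar>dens x * f 0 x\<bar> + \<kappa> * ?c x)"
    using terminal_near AE_space
  proof eventually_elim
    case (elim x)
    show ?case
    proof (cases "x \<in> N 0")
      case True
      let ?k = "exit_index x"
      have "\<bar>terminal f x\<bar> \<le> \<bar>f 0 x\<bar> + \<kappa> * real (Suc ?k)"
        using elim(1)[rule_format, of ?k] exit_index[OF True] f_bound[OF elim(2), of ?k] by (simp add: algebra_simps)
      then have "dens x * \<bar>terminal f x\<bar> \<le> dens x * (\<bar>f 0 x\<bar> + \<kappa> * real (Suc ?k))"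
        using dens_pos[of x] by (intro mult_left_mono) auto
      then show ?thesis using dens_pos[of x] \<kappa>_nonneg True by (simp add: abs_mult algebra_simps)
    next
      case False
      then show ?thesis by (simp add: terminal_def)
    qed
  qed
qed measurable

text \<open>The remainder of the telescoping vanishes, because the walk grows at most linearly in
  the step number while its factor decays geometrically.\<close>

lemma integral_dens_terminal:
  assumes C: "C \<in> sets (G k)" "C \<subseteq> N k"
  shows "(\<integral>x. indicator C x * (dens x * terminal f x) \<partial>M) = (1/2)^k * (\<integral>x. indicator C x * f k x \<partial>M)"
proof -
  have CM[measurable]: "C \<in> sets M" by (rule sets_G_M[OF C(1)])
  let ?u = "\<lambda>m x. indicator (C - N (k + m)) x * (dens x * terminal f x)"
  let ?a = "\<integral>x. \<bar>f 0 x\<bar> \<partial>M"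
  have l1: "(\<lambda>m. \<integral>x. ?u m x \<partial>M) \<longlonglongrightarrow> (\<integral>x. indicator C x * (dens x * terminal f x) \<partial>M)"
  proof (rule integral_dominated_convergence[where w="\<lambda>x. norm (dens x * terminal f x)"])
    show "integrable M (\<lambda>x. norm (dens x * terminal f x))" using dens_terminal_int by auto
    show "AE x in M. (\<lambda>m. ?u m x) \<longlonglongrightarrow> indicator C x * (dens x * terminal f x)"
      by (intro AE_I2 indicator_left_tendsto)
    show "AE x in M. norm (?u m x) \<le> norm (dens x * terminal f x)" for m
      by (intro AE_I2) (auto simp: indicator_def)
  qed measurable
  have bd: "norm ((1/2)^(k + m) * (\<integral>x. indicator (C \<inter> N (k + m)) x * f (k + m) x \<partial>M))
      \<le> ?a * (1/2)^(k + m) + \<kappa> * (real (k + m) * (1/2)^(k + m))" for m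
  proof -
    have "norm (\<integral>x. indicator (C \<inter> N (k + m)) x * f (k + m) x \<partial>M) \<le> (\<integral>x. norm (indicator (C \<inter> N (k + m)) x * f (k + m) x) \<partial>M)"
      by (rule integral_norm_bound)
    also have "\<dots> \<le> (\<integral>x. \<bar>f 0 x\<bar> + real (k + m) * \<kappa> \<partial>M)"
    proof (rule integral_mono)
      show "integrable M (\<lambda>x. norm (indicator (C \<inter> N (k + m)) x * f (k + m) x))"
        using integrable_mult_indicator[OF _ f_int, of "C \<inter> N (k + m)" "k+m"] by auto
      show "integrable M (\<lambda>x. \<bar>f 0 x\<bar> + real (k + m) * \<kappa>)" using f0_int by auto
      fix x assume "x \<in> space M"
      from f_bound[OF this, of "k + m"]
      show "norm (indicator (C \<inter> N (k + m)) x * f (k + m) x) \<le> \<bar>f 0 x\<bar> + real (k + m) * \<kappa>"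
        using \<kappa>_nonneg by (cases "x \<in> C \<inter> N (k + m)") auto
    qed
    also have "\<dots> = ?a + real (k + m) * \<kappa>" using f0_int by (simp add: prob_space)
    finally show ?thesis
      using mult_left_mono[of "norm (\<integral>x. indicator (C \<inter> N (k + m)) x * f (k + m) x \<partial>M)" "?a + real (k + m) * \<kappa>" "(1/2)^(k + m)"]
      by (simp add: abs_mult algebra_simps)
  qed
  have "(\<lambda>n. ?a * (1/2)^n + \<kappa> * (real n * (1/2)^n)) \<longlonglongrightarrow> ?a * 0 + \<kappa> * 0"
    by (intro tendsto_add tendsto_mult tendsto_const LIMSEQ_power_zero powser_times_n_limit_0) auto
  from LIMSEQ_ignore_initial_segment[OF this, of k]
  have "(\<lambda>m. ?a * (1/2)^(k + m) + \<kappa> * (real (k + m) * (1/2)^(k + m))) \<longlonglongrightarrow> 0"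
    by (simp add: add.commute)
  then have l2: "(\<lambda>m. (1/2)^(k + m) * (\<integral>x. indicator (C \<inter> N (k + m)) x * f (k + m) x \<partial>M)) \<longlonglongrightarrow> 0"
    by (rule Lim_null_comparison[rotated]) (use bd in auto)
  have "(\<lambda>m. \<integral>x. ?u m x \<partial>M) \<longlonglongrightarrow> (1/2)^k * (\<integral>x. indicator C x * f k x \<partial>M) - 0"
    using tendsto_diff[OF tendsto_const l2] by (simp only: dens_terminal_telescope[of f, OF f f_int C])
  from LIMSEQ_unique[OF l1 this] show ?thesis by simp
qed

text \<open>Under the new measure the walk is a martingale closed by its terminal value.\<close>

lemma integral_dens_terminal_eq:
  assumes C: "C \<in> sets (G k)" "C \<subseteq> N k"
  shows "(\<integral>x. indicator C x * (dens x * terminal f x) \<partial>M) = (\<integral>x. indicator C x * (dens x * f k x) \<partial>M)"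
  using integral_dens_terminal[OF C] integral_dens_mult[OF C f dens_f_int] by simp

lemma integral_dens_terminal_0:
  assumes C: "C \<in> sets (G 0)"
  shows "(\<integral>x. indicator C x * (dens x * terminal f x) \<partial>M) = (\<integral>x. indicator C x * f 0 x \<partial>M)"
proof -
  have CM[measurable]: "C \<in> sets M" by (rule sets_G_M[OF C])
  have CN: "C \<inter> N 0 \<in> sets (G 0)" "C \<inter> N 0 \<subseteq> N 0" using C N_sets by auto
  have eq1: "indicator C x * (dens x * terminal f x) = indicator (C \<inter> N 0) x * (dens x * terminal f x) + indicator (C - N 0) x * f 0 x" for x
    by (auto simp: indicator_def dens_eq_1 terminal_def)
  have eq2: "indicator C x * f 0 x = indicator (C \<inter> N 0) x * f 0 x + indicator (C - N 0) x * f 0 x" for x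
    by (auto simp: indicator_def)
  have i: "integrable M (\<lambda>x. indicator (C \<inter> N 0) x * (dens x * terminal f x))"
     "integrable M (\<lambda>x. indicator (C - N 0) x * f 0 x)" "integrable M (\<lambda>x. indicator (C \<inter> N 0) x * f 0 x)"
    using integrable_mult_indicator[OF _ dens_terminal_int, of "C \<inter> N 0"]
      integrable_mult_indicator[OF _ f0_int, of "C \<inter> N 0"] integrable_mult_indicator[OF _ f0_int, of "C - N 0"] by auto
  show ?thesis
    unfolding eq1 eq2 using integral_dens_terminal[OF CN] i by simp
qed

end

section \<open>Stopping times and cadlag processes\<close>

locale filtered_prob_space = prob_space P for P :: "'a measure" +
  fixes T :: real and F :: "real \<Rightarrow> 'a set set"
  assumes T_pos: "0 < T" and usual: "filtration_usual P T F"
begin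

abbreviation "Fm t \<equiv> sigma (space P) (F t)"
abbreviation "Fs \<tau> \<equiv> sigma (space P) (pre_sigma_on P F T \<tau>)"
abbreviation "stopping \<equiv> stopping_time_on P F T"

lemma F_sigma: "t \<in> {0..T} \<Longrightarrow> sigma_algebra (space P) (F t)"
  using usual by (auto simp: filtration_usual_def)

lemma F_subset: "t \<in> {0..T} \<Longrightarrow> F t \<subseteq> sets P"
  using usual by (auto simp: filtration_usual_def)

lemma F_mono: "0 \<le> s \<Longrightarrow> s \<le> t \<Longrightarrow> t \<le> T \<Longrightarrow> F s \<subseteq> F t"
  using usual by (auto simp: filtration_usual_def)

lemma null_sets_F: assumes "t \<in> {0..T}" shows "null_sets P \<subseteq> F t"
proof -
  have "null_sets P \<subseteq> F 0" using usual by (simp add: filtration_usual_def)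
  also have "F 0 \<subseteq> F t" using assms by (intro F_mono) auto
  finally show ?thesis .
qed

lemma sets_Fm: "t \<in> {0..T} \<Longrightarrow> sets (Fm t) = F t"
  using F_sigma[of t] sigma_algebra.sigma_sets_eq[of "space P" "F t"]
  by (subst sets_measure_of) (auto simp: sigma_algebra_iff2)

lemma F_Int: "t \<in> {0..T} \<Longrightarrow> A \<in> F t \<Longrightarrow> B \<in> F t \<Longrightarrow> A \<inter> B \<in> F t"
  using sets.Int[of A "Fm t" B] by (simp add: sets_Fm)

lemma space_Fm: "space (Fm t) = space P"
  by (simp add: space_measure_of_conv)

lemma subalg_Fm: "t \<in> {0..T} \<Longrightarrow> subalgebra P (Fm t)"
  using F_subset by (auto simp: subalgebra_def space_Fm sets_Fm)

lemma subalg_Fm_mono: "0 \<le> s \<Longrightarrow> s \<le> t \<Longrightarrow> t \<le> T \<Longrightarrow> subalgebra (Fm t) (Fm s)"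
  using F_mono[of s t] by (auto simp: subalgebra_def space_Fm sets_Fm)

lemma stopping_range: "stopping \<tau> \<Longrightarrow> \<omega> \<in> space P \<Longrightarrow> 0 \<le> \<tau> \<omega> \<and> \<tau> \<omega> \<le> T"
  by (auto simp: stopping_time_on_def)

lemma stopping_le: "stopping \<tau> \<Longrightarrow> t \<in> {0..T} \<Longrightarrow> {\<omega>\<in>space P. \<tau> \<omega> \<le> t} \<in> F t"
  by (auto simp: stopping_time_on_def)

lemma pre_sigma_sigma_algebra:
  assumes "stopping \<tau>" shows "sigma_algebra (space P) (pre_sigma_on P F T \<tau>)"
proof -
  have F: "sigma_algebra (space P) (F t)" if "t \<in> {0..T}" for t by (rule F_sigma[OF that])
  show ?thesis
    unfolding sigma_algebra_iff2
  proof (intro conjI ballI allI impI)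
    show "pre_sigma_on P F T \<tau> \<subseteq> Pow (space P)" by (auto simp: pre_sigma_on_def)
    show "{} \<in> pre_sigma_on P F T \<tau>"
      using F by (auto simp: pre_sigma_on_def sigma_algebra_iff2)
  next
    fix A assume A: "A \<in> pre_sigma_on P F T \<tau>"
    show "space P - A \<in> pre_sigma_on P F T \<tau>"
      unfolding pre_sigma_on_def
    proof (intro CollectI conjI ballI)
      fix t assume t: "t \<in> {0..T}"
      interpret sigma_algebra "space P" "F t" by (rule F[OF t])
      have "(space P - A) \<inter> {\<omega> \<in> space P. \<tau> \<omega> \<le> t} = {\<omega> \<in> space P. \<tau> \<omega> \<le> t} - A \<inter> {\<omega> \<in> space P. \<tau> \<omega> \<le> t}" by auto
      then show "(space P - A) \<inter> {\<omega> \<in> space P. \<tau> \<omega> \<le> t} \<in> F t"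
        using A stopping_le[OF assms t] t by (auto simp: pre_sigma_on_def)
    qed auto
  next
    fix A :: "nat \<Rightarrow> 'a set" assume A: "range A \<subseteq> pre_sigma_on P F T \<tau>"
    show "(\<Union>i. A i) \<in> pre_sigma_on P F T \<tau>"
      unfolding pre_sigma_on_def
    proof (intro CollectI conjI ballI)
      show "(\<Union>i. A i) \<subseteq> space P" using A by (auto simp: pre_sigma_on_def)
      fix t assume t: "t \<in> {0..T}"
      interpret sigma_algebra "space P" "F t" by (rule F[OF t])
      have "(\<Union>i. A i) \<inter> {\<omega> \<in> space P. \<tau> \<omega> \<le> t} = (\<Union>i. A i \<inter> {\<omega> \<in> space P. \<tau> \<omega> \<le> t})" by auto
      moreover have "A i \<inter> {\<omega> \<in> space P. \<tau> \<omega> \<le> t} \<in> F t" for i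
        using subsetD[OF A, of "A i"] t by (auto simp: pre_sigma_on_def)
      ultimately show "(\<Union>i. A i) \<inter> {\<omega> \<in> space P. \<tau> \<omega> \<le> t} \<in> F t"
        by (simp only:) (intro countable_UN image_subsetI, simp)
    qed
  qed
qed

lemma sets_Fs: "stopping \<tau> \<Longrightarrow> sets (Fs \<tau>) = pre_sigma_on P F T \<tau>"
  using pre_sigma_sigma_algebra[of \<tau>] sigma_algebra.sigma_sets_eq[of "space P" "pre_sigma_on P F T \<tau>"]
  by (subst sets_measure_of) (auto simp: sigma_algebra_iff2)

lemma space_Fs: "space (Fs \<tau>) = space P"
  by (simp add: space_measure_of_conv)

lemma Fs_I: "stopping \<tau> \<Longrightarrow> A \<subseteq> space P \<Longrightarrow> (\<And>t. t \<in> {0..T} \<Longrightarrow> A \<inter> {\<omega>\<in>space P. \<tau> \<omega> \<le> t} \<in> F t) \<Longrightarrow> A \<in> sets (Fs \<tau>)"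
  by (subst sets_Fs) (auto simp: pre_sigma_on_def)

lemma Fs_D: "stopping \<tau> \<Longrightarrow> A \<in> sets (Fs \<tau>) \<Longrightarrow> t \<in> {0..T} \<Longrightarrow> A \<inter> {\<omega>\<in>space P. \<tau> \<omega> \<le> t} \<in> F t"
  by (subst (asm) sets_Fs) (auto simp: pre_sigma_on_def)

lemma subalg_FT_Fs: assumes "stopping \<tau>" shows "subalgebra (Fm T) (Fs \<tau>)"
proof -
  have "A \<in> F T" if A: "A \<in> sets (Fs \<tau>)" for A
  proof -
    have "A \<inter> {\<omega>\<in>space P. \<tau> \<omega> \<le> T} = A"
      using sets.sets_into_space[OF A] stopping_range[OF assms] by (auto simp: space_Fs)
    then show ?thesis using Fs_D[OF assms A, of T] T_pos by auto
  qed
  then show ?thesis using T_pos by (auto simp: subalgebra_def space_Fm space_Fs sets_Fm)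
qed

lemma subalg_Fs: assumes "stopping \<tau>" shows "subalgebra P (Fs \<tau>)"
  using subalg_FT_Fs[OF assms] subalg_Fm[of T] T_pos by (auto simp: subalgebra_def)

lemma Fs_mono:
  assumes "stopping \<sigma>" "stopping \<tau>" "\<And>\<omega>. \<omega> \<in> space P \<Longrightarrow> \<sigma> \<omega> \<le> \<tau> \<omega>"
  shows "sets (Fs \<sigma>) \<subseteq> sets (Fs \<tau>)"
proof
  fix A assume A: "A \<in> sets (Fs \<sigma>)"
  show "A \<in> sets (Fs \<tau>)"
  proof (rule Fs_I[OF assms(2)])
    show "A \<subseteq> space P" using sets.sets_into_space[OF A] by (simp add: space_Fs)
    fix t assume t: "t \<in> {0..T}"
    interpret sigma_algebra "space P" "F t" by (rule F_sigma[OF t])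
    have "A \<inter> {\<omega>\<in>space P. \<tau> \<omega> \<le> t} = (A \<inter> {\<omega>\<in>space P. \<sigma> \<omega> \<le> t}) \<inter> {\<omega>\<in>space P. \<tau> \<omega> \<le> t}"
      using assms(3) by force
    then show "A \<inter> {\<omega>\<in>space P. \<tau> \<omega> \<le> t} \<in> F t"
      using Fs_D[OF assms(1) A t] stopping_le[OF assms(2) t] by auto
  qed
qed

text \<open>For \<open>t < s\<close> the intersection with \<open>\<tau> \<le> t\<close> is empty,
  and for later \<open>t\<close> the event is already known. This moves test sets from a fixed time
  into the past at \<open>\<tau>\<close>, where the change of measure is under control.\<close>

lemma F_before_Fs:
  assumes "stopping \<tau>" "s \<in> {0..T}" "A \<in> F s" and ge: "\<And>\<omega>. \<omega> \<in> A \<Longrightarrow> s \<le> \<tau> \<omega>"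
  shows "A \<in> sets (Fs \<tau>)"
proof (rule Fs_I[OF assms(1)])
  show "A \<subseteq> space P" using assms(2,3) F_subset sets.sets_into_space by blast
  fix t assume t: "t \<in> {0..T}"
  interpret sigma_algebra "space P" "F t" by (rule F_sigma[OF t])
  show "A \<inter> {\<omega>\<in>space P. \<tau> \<omega> \<le> t} \<in> F t"
  proof (cases "s \<le> t")
    case True
    then have "A \<in> F t" using F_mono[of s t] assms t by auto
    then show ?thesis using stopping_le[OF assms(1) t] by auto
  next
    case False
    then have "A \<inter> {\<omega>\<in>space P. \<tau> \<omega> \<le> t} = {}" using ge by force
    then show ?thesis by simp
  qed
qed

lemma min_stopping_measurable:
  assumes "stopping \<tau>" "t \<in> {0..T}"
  shows "(\<lambda>\<omega>. min (\<tau> \<omega>) t) \<in> borel_measurable (Fm t)"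
proof (rule borel_measurableI_le)
  fix a
  interpret sigma_algebra "space P" "F t" by (rule F_sigma[OF assms(2)])
  consider "a \<ge> t" | "0 \<le> a" "a < t" | "a < 0" by linarith
  then have "{\<omega>\<in>space P. min (\<tau> \<omega>) t \<le> a} \<in> F t"
  proof cases
    case 1
    then have "{\<omega>\<in>space P. min (\<tau> \<omega>) t \<le> a} = space P" by auto
    then show ?thesis by simp
  next
    case 2
    then have "{\<omega>\<in>space P. min (\<tau> \<omega>) t \<le> a} = {\<omega>\<in>space P. \<tau> \<omega> \<le> a}" by auto
    then show ?thesis using stopping_le[OF assms(1), of a] F_mono[of a t] 2 assms(2) by auto
  next
    case 3
    then have "{\<omega>\<in>space P. min (\<tau> \<omega>) t \<le> a} = {}"
      using stopping_range[OF assms(1)] assms(2) by force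
    then show ?thesis by (simp only: empty_sets)
  qed
  then show "{\<omega>\<in>space (Fm t). min (\<tau> \<omega>) t \<le> a} \<in> sets (Fm t)"
    by (simp add: space_Fm sets_Fm[OF assms(2)])
qed

lemma stopping_less: assumes "stopping \<tau>" "t \<in> {0..T}" shows "{\<omega>\<in>space P. \<tau> \<omega> < t} \<in> F t"
proof -
  note [measurable] = min_stopping_measurable[OF assms]
  have "{\<omega>\<in>space (Fm t). min (\<tau> \<omega>) t < t} \<in> sets (Fm t)" by measurable
  moreover have "{\<omega>\<in>space (Fm t). min (\<tau> \<omega>) t < t} = {\<omega>\<in>space P. \<tau> \<omega> < t}" by (auto simp: space_Fm)
  ultimately show ?thesis using sets_Fm[OF assms(2)] by metis
qed

lemma stopping_ge: assumes "stopping \<tau>" "t \<in> {0..T}" shows "{\<omega>\<in>space P. t \<le> \<tau> \<omega>} \<in> F t"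
proof -
  interpret sigma_algebra "space P" "F t" by (rule F_sigma[OF assms(2)])
  have "{\<omega>\<in>space P. t \<le> \<tau> \<omega>} = space P - {\<omega>\<in>space P. \<tau> \<omega> < t}" by auto
  then show ?thesis using stopping_less[OF assms] by auto
qed

lemma stopping_measurable:
  assumes "stopping \<tau>" shows "\<tau> \<in> borel_measurable (Fm T)"
proof -
  have "(\<lambda>\<omega>. min (\<tau> \<omega>) T) \<in> borel_measurable (Fm T)"
    using min_stopping_measurable[OF assms, of T] T_pos by auto
  moreover have "(\<lambda>\<omega>. min (\<tau> \<omega>) T) \<in> borel_measurable (Fm T) \<longleftrightarrow> \<tau> \<in> borel_measurable (Fm T)"
    using stopping_range[OF assms] by (intro measurable_cong) (auto simp: space_Fm)
  ultimately show ?thesis by simp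
qed

lemma less_T_Fs: assumes "stopping \<tau>" shows "{\<omega>\<in>space P. \<tau> \<omega> < T} \<in> sets (Fs \<tau>)"
proof -
  have T: "T \<in> {0..T}" using T_pos by auto
  have "{\<omega>\<in>space P. T \<le> \<tau> \<omega>} \<in> sets (Fs \<tau>)"
    by (rule F_before_Fs[OF assms T stopping_ge[OF assms T]]) auto
  then have "space (Fs \<tau>) - {\<omega>\<in>space P. T \<le> \<tau> \<omega>} \<in> sets (Fs \<tau>)" by (rule sets.compl_sets)
  moreover have "space (Fs \<tau>) - {\<omega>\<in>space P. T \<le> \<tau> \<omega>} = {\<omega>\<in>space P. \<tau> \<omega> < T}" by (auto simp: space_Fs)
  ultimately show ?thesis by metis
qed

text \<open>Membership in \<open>Fs \<tau>\<close> is tested on the events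
  \<open>\<tau> \<le> t\<close>, and there \<open>f\<close> may be replaced by a function
  \<open>g t\<close> that looks at the path up to \<open>t\<close> only.\<close>

lemma measurable_Fs_I:
  fixes f :: "'a \<Rightarrow> 'b::topological_space"
  assumes "stopping \<tau>"
    and g: "\<And>t. t \<in> {0..T} \<Longrightarrow> g t \<in> borel_measurable (Fm t)"
    and eq: "\<And>t \<omega>. t \<in> {0..T} \<Longrightarrow> \<omega> \<in> space P \<Longrightarrow> \<tau> \<omega> \<le> t \<Longrightarrow> f \<omega> = g t \<omega>"
  shows "f \<in> borel_measurable (Fs \<tau>)"
proof (rule measurableI)
  fix A :: "'b set" assume A: "A \<in> sets borel"
  show "f -` A \<inter> space (Fs \<tau>) \<in> sets (Fs \<tau>)"
  proof (rule Fs_I[OF assms(1)])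
    fix t assume t: "t \<in> {0..T}"
    interpret sigma_algebra "space P" "F t" by (rule F_sigma[OF t])
    have "g t -` A \<inter> space P \<in> F t"
      using measurable_sets[OF g[OF t] A] by (simp add: space_Fm sets_Fm[OF t])
    moreover have "f -` A \<inter> space (Fs \<tau>) \<inter> {\<omega>\<in>space P. \<tau> \<omega> \<le> t} = (g t -` A \<inter> space P) \<inter> {\<omega>\<in>space P. \<tau> \<omega> \<le> t}"
      using eq[OF t] by (auto simp: space_Fs)
    ultimately show "f -` A \<inter> space (Fs \<tau>) \<inter> {\<omega>\<in>space P. \<tau> \<omega> \<le> t} \<in> F t"
      using stopping_le[OF assms(1) t] by auto
  qed (auto simp: space_Fs)
qed simp

lemma adapted_onD: "adapted_on P F T X \<Longrightarrow> t \<in> {0..T} \<Longrightarrow> X t \<in> borel_measurable (Fm t)"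
  by (intro measurableI) (auto simp: adapted_on_def space_Fm sets_Fm)

lemma adapted_onI:
  fixes X :: "real \<Rightarrow> 'a \<Rightarrow> 'b::topological_space"
  shows "(\<And>t. t \<in> {0..T} \<Longrightarrow> X t \<in> borel_measurable (Fm t)) \<Longrightarrow> adapted_on P F T X"
  unfolding adapted_on_def
proof (intro ballI)
  fix t and A :: "'b set" assume *: "\<And>t. t \<in> {0..T} \<Longrightarrow> X t \<in> borel_measurable (Fm t)" and t: "t \<in> {0..T}" and A: "A \<in> sets borel"
  show "X t -` A \<inter> space P \<in> F t"
    using measurable_sets[OF *[OF t] A] by (simp add: space_Fm sets_Fm[OF t])
qed

lemma stopped_measurable_Fs:
  assumes "stopping \<tau>" "adapted_on P F T (\<lambda>t \<omega>. X (min t (\<tau> \<omega>)) \<omega>)" "t \<in> {0..T}"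
  shows "(\<lambda>\<omega>. X (min t (\<tau> \<omega>)) \<omega>) \<in> borel_measurable (Fs \<tau>)"
proof (rule measurable_Fs_I[OF assms(1)])
  show "(\<lambda>\<omega>. X (min (min t r) (\<tau> \<omega>)) \<omega>) \<in> borel_measurable (Fm r)" if "r \<in> {0..T}" for r
    by (rule measurable_from_subalg[OF subalg_Fm_mono[of "min t r" r]])
      (use adapted_onD[OF assms(2), of "min t r"] assms(3) that in auto)
qed (auto simp: min_def)

end

section \<open>Cadlag processes at random times and their excursions\<close>

locale cadlag_process = filtered_prob_space P T F for P :: "'a measure" and T F +
  fixes S :: "real \<Rightarrow> 'a \<Rightarrow> real ^ 'd"
  assumes S_adapted: "adapted_on P F T S"
    and S_cadlag: "\<And>\<omega>. \<omega> \<in> space P \<Longrightarrow> cadlag_on T (\<lambda>t. S t \<omega>)"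
begin

text \<open>Random times are approximated from the right, but never beyond \<open>t\<close>.\<close>

lemma process_at_random_time_measurable:
  assumes t: "t \<in> {0..T}" and \<rho>[measurable]: "\<rho> \<in> borel_measurable (Fm t)"
    and range: "\<And>\<omega>. \<omega> \<in> space P \<Longrightarrow> 0 \<le> \<rho> \<omega> \<and> \<rho> \<omega> \<le> t"
  shows "(\<lambda>\<omega>. S (\<rho> \<omega>) \<omega>) \<in> borel_measurable (Fm t)"
proof -
  \<comment> \<open>The \<open>+ 1\<close> puts the grid point strictly to the right of
    \<open>\<rho> \<omega>\<close>, as a limit along \<open>at_right\<close> requires; the cap keeps
    the sampled value known at \<open>t\<close>. Where \<open>\<rho> \<omega> = t\<close>, the cap
    makes the approximation constant.\<close>
  define r where "r n i = min t (max 0 ((real_of_int i + 1) / real (Suc n)))" for n and i :: int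
  define \<rho>' where "\<rho>' n \<omega> = r n \<lfloor>\<rho> \<omega> * real (Suc n)\<rfloor>" for n \<omega>
  have meas: "(\<lambda>\<omega>. S (\<rho>' n \<omega>) \<omega>) \<in> borel_measurable (Fm t)" for n
    unfolding \<rho>'_def
  proof (rule measurable_compose_countable)
    show "S (r n i) \<in> borel_measurable (Fm t)" for i
    proof (rule measurable_from_subalg[OF subalg_Fm_mono[of "r n i" t]])
      show "S (r n i) \<in> borel_measurable (Fm (r n i))"
        by (rule adapted_onD[OF S_adapted]) (use t in \<open>auto simp: r_def\<close>)
    qed (use t in \<open>auto simp: r_def\<close>)
    show "(\<lambda>\<omega>. \<lfloor>\<rho> \<omega> * real (Suc n)\<rfloor>) \<in> measurable (Fm t) (count_space UNIV)"
      by measurable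
  qed
  show ?thesis
  proof (rule borel_measurable_LIMSEQ_metric[OF meas])
    fix \<omega> assume "\<omega> \<in> space (Fm t)"
    then have \<omega>: "\<omega> \<in> space P" by (simp add: space_Fm)
    note rg = range[OF \<omega>]
    have gt: "\<rho> \<omega> < (real_of_int \<lfloor>\<rho> \<omega> * real (Suc n)\<rfloor> + 1) / real (Suc n)" for n
      using floor_correct[of "\<rho> \<omega> * real (Suc n)"] by (simp add: pos_less_divide_eq del: of_nat_Suc)
    have le: "(real_of_int \<lfloor>\<rho> \<omega> * real (Suc n)\<rfloor> + 1) / real (Suc n) \<le> \<rho> \<omega> + 1 / real (Suc n)" for n
      using floor_correct[of "\<rho> \<omega> * real (Suc n)"] by (simp add: divide_simps del: of_nat_Suc)
    show "(\<lambda>n. S (\<rho>' n \<omega>) \<omega>) \<longlonglongrightarrow> S (\<rho> \<omega>) \<omega>"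
    proof (cases "\<rho> \<omega> = t")
      case True
      then have "\<rho>' n \<omega> = t" for n
        using gt[of n] rg t unfolding \<rho>'_def r_def by auto
      then show ?thesis using True by simp
    next
      case False
      then have lt: "\<rho> \<omega> < t" using rg by auto
      have "(\<lambda>n. \<rho>' n \<omega>) \<longlonglongrightarrow> \<rho> \<omega>"
      proof (rule tendsto_sandwich[OF always_eventually always_eventually])
        show "\<forall>n. \<rho> \<omega> \<le> \<rho>' n \<omega>" using gt rg unfolding \<rho>'_def r_def by (auto intro: less_imp_le simp: le_max_iff_disj)
        show "\<forall>n. \<rho>' n \<omega> \<le> \<rho> \<omega> + 1 / real (Suc n)"
          using le rg unfolding \<rho>'_def r_def by (auto simp: min_le_iff_disj intro!: add_nonneg_nonneg)
        show "(\<lambda>n. \<rho> \<omega> + 1 / real (Suc n)) \<longlonglongrightarrow> \<rho> \<omega>"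
          using tendsto_add[OF tendsto_const LIMSEQ_inverse_real_of_nat, of "\<rho> \<omega>"] by (simp add: inverse_eq_divide)
      qed simp
      moreover have "\<forall>n. \<rho>' n \<omega> > \<rho> \<omega>" using gt lt unfolding \<rho>'_def r_def by (auto simp: less_max_iff_disj)
      ultimately have "filterlim (\<lambda>n. \<rho>' n \<omega>) (at_right (\<rho> \<omega>)) sequentially"
        by (auto simp: filterlim_at intro!: always_eventually less_imp_neq[THEN not_sym])
      moreover have "((\<lambda>u. S u \<omega>) \<longlongrightarrow> S (\<rho> \<omega>) \<omega>) (at_right (\<rho> \<omega>))"
        using S_cadlag[OF \<omega>] rg lt t by (auto simp: cadlag_on_def continuous_within)
      ultimately show ?thesis by (rule filterlim_compose[rotated])
    qed
  qed
qed

lemma process_min_stopping_measurable: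
  assumes "stopping \<tau>" "t \<in> {0..T}"
  shows "(\<lambda>\<omega>. S (min (\<tau> \<omega>) t) \<omega>) \<in> borel_measurable (Fm t)"
  using min_stopping_measurable[OF assms] stopping_range[OF assms(1)] assms(2)
  by (intro process_at_random_time_measurable) (auto simp: min_le_iff_disj)

lemma process_at_stopping_measurable:
  assumes "stopping \<tau>"
  shows "(\<lambda>\<omega>. S (\<tau> \<omega>) \<omega>) \<in> borel_measurable (Fs \<tau>)"
  by (rule measurable_Fs_I[OF assms, where g="\<lambda>t \<omega>. S (min (\<tau> \<omega>) t) \<omega>"])
    (auto intro: process_min_stopping_measurable[OF assms, simplified])

definition excursion :: "('a \<Rightarrow> real) \<Rightarrow> 'a \<Rightarrow> ennreal" where
  "excursion \<tau> \<omega> = (\<Squnion>u\<in>{\<tau> \<omega>..T}. ennreal (norm (S u \<omega> - S (\<tau> \<omega>) \<omega>)))"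

text \<open>By right-continuity rational times determine the supremum, except for \<open>T\<close>,
  which has no right neighbours in the interval and is inserted. The index set must not depend on
  \<open>\<omega>\<close>; with \<open>max q (\<tau> \<omega>)\<close> the times before
  \<open>\<tau> \<omega>\<close> simply contribute zero.\<close>

lemma excursion_countable:
  assumes "stopping \<tau>" "\<omega> \<in> space P"
  shows "excursion \<tau> \<omega> =
    (\<Squnion>q\<in>insert T (\<rat> \<inter> {0..T}). ennreal (norm (S (max q (\<tau> \<omega>)) \<omega> - S (\<tau> \<omega>) \<omega>)))" (is "_ = ?R")
proof (rule antisym)
  note rg = stopping_range[OF assms]
  let ?v = "\<lambda>u. ennreal (norm (S u \<omega> - S (\<tau> \<omega>) \<omega>))"
  show "?R \<le> excursion \<tau> \<omega>"
    unfolding excursion_def using rg by (intro SUP_least SUP_upper) auto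
  have q_le: "?v q \<le> ?R" if "q \<in> insert T (\<rat> \<inter> {0..T})" "\<tau> \<omega> \<le> q" for q
  proof -
    have "?v q = ?v (max q (\<tau> \<omega>))" using that by (simp add: max_absorb1)
    also have "\<dots> \<le> ?R" using that(1) by (rule SUP_upper)
    finally show ?thesis .
  qed
  show "excursion \<tau> \<omega> \<le> ?R"
    unfolding excursion_def
  proof (rule SUP_least)
    fix u assume u: "u \<in> {\<tau> \<omega>..T}"
    show "?v u \<le> ?R"
    proof (cases "u = T")
      case True
      then show ?thesis using q_le[of T] u by auto
    next
      case False
      then have uT: "u < T" "0 \<le> u" using u rg by auto
      show ?thesis
      proof (rule ccontr)
        assume "\<not> ?thesis"
        then have gt: "?R < ?v u" by simp
        have "((\<lambda>u. S u \<omega>) \<longlongrightarrow> S u \<omega>) (at_right u)"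
          using S_cadlag[OF assms(2)] uT by (auto simp: cadlag_on_def continuous_within)
        then have "(?v \<longlongrightarrow> ?v u) (at_right u)" by (intro tendsto_intros tendsto_ennrealI)
        from order_tendstoD(1)[OF this gt] obtain b where b: "b > u" "\<And>y. u < y \<Longrightarrow> y < b \<Longrightarrow> ?R < ?v y"
          unfolding eventually_at_right_field by auto
        obtain q where "q \<in> \<rat>" "u < q" "q < min b T"
          using Rats_dense_in_real[of u "min b T"] b uT by auto
        then show False using q_le[of q] b(2)[of q] u uT by (auto simp: not_less[symmetric])
      qed
    qed
  qed
qed

lemma excursion_measurable:
  assumes "stopping \<tau>" shows "excursion \<tau> \<in> borel_measurable (Fm T)"
proof -
  note [measurable] = stopping_measurable[OF assms]
  have T: "T \<in> {0..T}" using T_pos by auto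
  have m[measurable]: "(\<lambda>\<omega>. S (max q (\<tau> \<omega>)) \<omega>) \<in> borel_measurable (Fm T)" if "q \<le> T" for q
    using stopping_range[OF assms] that by (intro process_at_random_time_measurable[OF T]) (auto simp: le_max_iff_disj)
  have [measurable]: "(\<lambda>\<omega>. S (\<tau> \<omega>) \<omega>) \<in> borel_measurable (Fm T)"
    using stopping_range[OF assms] by (intro process_at_random_time_measurable[OF T]) auto
  have "(\<lambda>\<omega>. \<Squnion>q\<in>insert T (\<rat> \<inter> {0..T}). ennreal (norm (S (max q (\<tau> \<omega>)) \<omega> - S (\<tau> \<omega>) \<omega>))) \<in> borel_measurable (Fm T)"
    by (intro borel_measurable_SUP measurable_compose[OF _ measurable_ennreal] borel_measurable_norm borel_measurable_diff m)
      (auto simp: countable_rat intro!: countable_Int1)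
  then show ?thesis
    by (subst measurable_cong[OF excursion_countable[OF assms]]) (auto simp: space_Fm)
qed

end

section \<open>Hitting times and independent enlargements\<close>

text \<open>The inserted \<open>T\<close> caps the hitting time and keeps the infimum off the empty
  set; the value \<open>T\<close> covers both a path that never moves by \<open>\<kappa>\<close> and
  one that first does so at \<open>T\<close>.\<close>

definition hit :: "real \<Rightarrow> real \<Rightarrow> (real \<Rightarrow> 'b::real_normed_vector) \<Rightarrow> real \<Rightarrow> real" where
  "hit T \<kappa> f s = Inf (insert T {u\<in>{s..T}. \<kappa> \<le> norm (f u - f s)})"

lemma
  fixes f :: "real \<Rightarrow> 'b::real_normed_vector"
  assumes f: "continuous_on {0..T} f" and s: "0 \<le> s" "s \<le> T" and \<kappa>: "0 < \<kappa>"
  shows hit_range: "s \<le> hit T \<kappa> f s" "hit T \<kappa> f s \<le> T"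
    and hit_ge: "hit T \<kappa> f s < T \<Longrightarrow> \<kappa> \<le> norm (f (hit T \<kappa> f s) - f s)"
    and hit_le: "u \<in> {s..hit T \<kappa> f s} \<Longrightarrow> norm (f u - f s) \<le> \<kappa>"
    and hit_eq: "(\<And>u. u \<in> {s..T} \<Longrightarrow> norm (f u - f s) < \<kappa>) \<Longrightarrow> hit T \<kappa> f s = T"
    and hit_le_iff: "t < T \<Longrightarrow> hit T \<kappa> f s \<le> t \<longleftrightarrow> (\<exists>u\<in>{s..t}. \<kappa> \<le> norm (f u - f s))"
proof -
  let ?A = "insert T {u\<in>{s..T}. \<kappa> \<le> norm (f u - f s)}"
  have c: "continuous_on {s..T} (\<lambda>u. norm (f u - f s))"
    using s by (intro continuous_intros continuous_on_subset[OF f]) auto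
  have "closed {u\<in>{s..T}. norm (f u - f s) \<in> {\<kappa>..}}"
    using continuous_closed_preimage[OF c, of "{\<kappa>..}"] by (simp add: vimage_def Int_def)
  then have "closed ?A" by (simp add: closed_insert)
  moreover have bdd: "bdd_below ?A" using s by (intro bdd_belowI[of _ s]) auto
  ultimately have mem: "hit T \<kappa> f s \<in> ?A" unfolding hit_def by (intro closed_contains_Inf) auto
  have low: "hit T \<kappa> f s \<le> u" if "u \<in> ?A" for u
    unfolding hit_def by (rule cInf_lower[OF that bdd])
  show 1: "s \<le> hit T \<kappa> f s" and 2: "hit T \<kappa> f s \<le> T" using mem s by auto
  show "hit T \<kappa> f s < T \<Longrightarrow> \<kappa> \<le> norm (f (hit T \<kappa> f s) - f s)" using mem by auto
  show "(\<And>u. u \<in> {s..T} \<Longrightarrow> norm (f u - f s) < \<kappa>) \<Longrightarrow> hit T \<kappa> f s = T" using mem by force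
  show "t < T \<Longrightarrow> hit T \<kappa> f s \<le> t \<longleftrightarrow> (\<exists>u\<in>{s..t}. \<kappa> \<le> norm (f u - f s))"
    using mem low by force
  \<comment> \<open>Strictly before the hitting time the move is below \<open>\<kappa>\<close>;
    continuity carries the weak inequality to the endpoint.\<close>
  have lt: "norm (f u - f s) < \<kappa>" if "u \<in> {s..<hit T \<kappa> f s}" for u
    using low[of u] that 2 by force
  show "u \<in> {s..hit T \<kappa> f s} \<Longrightarrow> norm (f u - f s) \<le> \<kappa>"
  proof (cases "hit T \<kappa> f s = s")
    case False
    assume u: "u \<in> {s..hit T \<kappa> f s}"
    have "closure {s..<hit T \<kappa> f s} = {s..hit T \<kappa> f s}" using False 1 by simp
    moreover have "continuous_on {s..hit T \<kappa> f s} (\<lambda>u. norm (f u - f s))"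
      by (rule continuous_on_subset[OF c]) (use 2 in auto)
    ultimately show ?thesis
      using continuous_le_on_closure[of "{s..<hit T \<kappa> f s}" "\<lambda>u. norm (f u - f s)" u \<kappa>] u lt by (auto intro: less_imp_le)
  qed (use \<kappa> in auto)
qed

text \<open>Expresses the reaching of a level by countably many conditions. Points of
  \<open>D\<close> may all miss \<open>\<kappa>\<close> itself, hence the slack
  \<open>1 / real (Suc n)\<close>; conversely, the maximum of \<open>h\<close> is attained and has
  to be at least \<open>\<kappa>\<close>.\<close>

lemma continuous_ge_iff_countable_dense:
  fixes h :: "real \<Rightarrow> real"
  assumes h: "continuous_on {0..t} h" and D: "D \<subseteq> {0..t}" "{0..t} \<subseteq> closure D" and t: "0 \<le> t"
  shows "(\<exists>u\<in>{0..t}. \<kappa> \<le> h u) \<longleftrightarrow> (\<forall>n. \<exists>q\<in>D. \<kappa> - 1 / real (Suc n) < h q)"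
proof
  assume "\<exists>u\<in>{0..t}. \<kappa> \<le> h u"
  then obtain u where u: "u \<in> {0..t}" "\<kappa> \<le> h u" by auto
  show "\<forall>n. \<exists>q\<in>D. \<kappa> - 1 / real (Suc n) < h q"
  proof (rule ccontr)
    assume "\<not> ?thesis"
    then obtain n where n: "\<And>q. q \<in> D \<Longrightarrow> h q \<le> \<kappa> - 1 / real (Suc n)" by (auto simp: not_less)
    have "closure D \<subseteq> {0..t}" using closure_mono[OF D(1)] by simp
    then have "continuous_on (closure D) h" using h by (rule continuous_on_subset[rotated])
    from continuous_le_on_closure[OF this _ n, of u] have "h u \<le> \<kappa> - 1 / real (Suc n)" using u D by auto
    moreover have "0 < 1 / real (Suc n)" by simp
    ultimately show False using u by linarith
  qed
next
  assume *: "\<forall>n. \<exists>q\<in>D. \<kappa> - 1 / real (Suc n) < h q"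
  obtain u where u: "u \<in> {0..t}" "\<And>v. v \<in> {0..t} \<Longrightarrow> h v \<le> h u"
    using continuous_attains_sup[OF compact_Icc _ h] t by auto
  have "\<kappa> \<le> h u + e" if e: "e > 0" for e
  proof -
    obtain n where "inverse (real (Suc n)) < e" using reals_Archimedean[OF e] by auto
    moreover obtain q where "q \<in> D" "\<kappa> - 1 / real (Suc n) < h q" using * by blast
    ultimately show ?thesis using u(2)[of q] D(1) by (auto simp: inverse_eq_divide)
  qed
  then have "\<kappa> \<le> h u" by (rule field_le_epsilon)
  then show "\<exists>u\<in>{0..t}. \<kappa> \<le> h u" using u by auto
qed

locale continuous_process = cadlag_process +
  assumes S_cont: "\<And>\<omega>. \<omega> \<in> space P \<Longrightarrow> continuous_on {0..T} (\<lambda>t. S t \<omega>)"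
begin

lemma stopping_hit:
  assumes \<sigma>: "stopping \<sigma>" and \<kappa>: "0 < \<kappa>"
  shows "stopping (\<lambda>\<omega>. hit T \<kappa> (\<lambda>t. S t \<omega>) (\<sigma> \<omega>))" (is "stopping ?h")
proof -
  note rg = stopping_range[OF \<sigma>]
  have range: "\<sigma> \<omega> \<le> ?h \<omega> \<and> ?h \<omega> \<le> T" if "\<omega> \<in> space P" for \<omega>
    using hit_range[OF S_cont[OF that] _ _ \<kappa>] rg[OF that] by auto
  show ?thesis
    unfolding stopping_time_on_def
  proof (intro conjI ballI)
    show "?h \<omega> \<in> {0..T}" if "\<omega> \<in> space P" for \<omega> using range[OF that] rg[OF that] by auto
    fix t assume t: "t \<in> {0..T}"
    show "{\<omega>\<in>space P. ?h \<omega> \<le> t} \<in> F t"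
    proof (cases "t = T")
      case True
      have "space P \<in> F T" using F_sigma[of T] T_pos by (auto simp: sigma_algebra_iff2 dest: bspec[of _ _ "{}"])
      moreover have "{\<omega>\<in>space P. ?h \<omega> \<le> T} = space P" using range by auto
      ultimately show ?thesis using True by simp
    next
      case False
      then have tT: "t < T" using t by auto
      obtain D where D: "countable D" "D \<subseteq> {0..t}" "{0..t} \<subseteq> closure D"
        using separable[of "{0..t}"] by auto
      \<comment> \<open>Capping \<open>\<sigma>\<close> at \<open>t\<close> keeps everything
        \<open>Fm t\<close>-measurable and changes nothing on
        \<open>\<sigma> \<omega> \<le> t\<close>. The \<open>max\<close> in \<open>?g\<close> lets
        times before \<open>\<sigma> \<omega>\<close> contribute zero, so that the random interval
        can be replaced by the fixed \<open>{0..t}\<close>.\<close>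
      let ?m = "\<lambda>\<omega>. min (\<sigma> \<omega>) t"
      let ?g = "\<lambda>\<omega> u. norm (S (max u (?m \<omega>)) \<omega> - S (?m \<omega>) \<omega>)"
      note [measurable] = min_stopping_measurable[OF \<sigma> t] process_min_stopping_measurable[OF \<sigma> t]
      have m: "(\<lambda>\<omega>. S (max q (?m \<omega>)) \<omega>) \<in> borel_measurable (Fm t)" if "q \<in> D" for q
        using D(2) that t rg by (intro process_at_random_time_measurable[OF t]) (auto simp: le_max_iff_disj)
      have "{\<omega>\<in>space (Fm t). \<forall>n. \<exists>q\<in>D. \<kappa> - 1 / real (Suc n) < ?g \<omega> q} \<in> sets (Fm t)"
        using m D(1) by measurable
      moreover have "{\<omega>\<in>space P. ?h \<omega> \<le> t} = {\<omega>\<in>space P. \<sigma> \<omega> \<le> t} \<inter>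
          {\<omega>\<in>space (Fm t). \<forall>n. \<exists>q\<in>D. \<kappa> - 1 / real (Suc n) < ?g \<omega> q}"
      proof -
        have "?h \<omega> \<le> t \<longleftrightarrow> \<sigma> \<omega> \<le> t \<and> (\<forall>n. \<exists>q\<in>D. \<kappa> - 1 / real (Suc n) < ?g \<omega> q)" if \<omega>: "\<omega> \<in> space P" for \<omega>
        proof (cases "\<sigma> \<omega> \<le> t")
          case True
          have "continuous_on {0..t} (?g \<omega>)"
            using rg[OF \<omega>] t True
            by (intro continuous_intros continuous_on_compose2[OF S_cont[OF \<omega>]]) auto
          from continuous_ge_iff_countable_dense[OF this D(2,3)] t
          have "(\<forall>n. \<exists>q\<in>D. \<kappa> - 1 / real (Suc n) < ?g \<omega> q) \<longleftrightarrow> (\<exists>u\<in>{0..t}. \<kappa> \<le> ?g \<omega> u)" by auto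
          also have "\<dots> \<longleftrightarrow> (\<exists>u\<in>{\<sigma> \<omega>..t}. \<kappa> \<le> norm (S u \<omega> - S (\<sigma> \<omega>) \<omega>))"
          proof
            assume "\<exists>u\<in>{0..t}. \<kappa> \<le> ?g \<omega> u"
            then obtain u where "u \<in> {0..t}" "\<kappa> \<le> ?g \<omega> u" by auto
            then show "\<exists>u\<in>{\<sigma> \<omega>..t}. \<kappa> \<le> norm (S u \<omega> - S (\<sigma> \<omega>) \<omega>)"
              using True by (intro bexI[of _ "max u (\<sigma> \<omega>)"]) (auto simp: min_absorb1)
          next
            assume "\<exists>u\<in>{\<sigma> \<omega>..t}. \<kappa> \<le> norm (S u \<omega> - S (\<sigma> \<omega>) \<omega>)"
            then obtain u where "u \<in> {\<sigma> \<omega>..t}" "\<kappa> \<le> norm (S u \<omega> - S (\<sigma> \<omega>) \<omega>)" by auto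
            then show "\<exists>u\<in>{0..t}. \<kappa> \<le> ?g \<omega> u"
              using True rg[OF \<omega>] by (intro bexI[of _ u]) (auto simp: min_absorb1 max_absorb1)
          qed
          finally show ?thesis
            using hit_le_iff[OF S_cont[OF \<omega>] _ _ \<kappa> tT, of "\<sigma> \<omega>"] rg[OF \<omega>] True by auto
        next
          case False
          then show ?thesis using range[OF \<omega>] by auto
        qed
        then show ?thesis by (auto simp: space_Fm)
      qed
      ultimately show ?thesis
        using stopping_le[OF \<sigma> t] sets.Int[of _ "Fm t"] sets_Fm[OF t] by (metis (no_types, lifting))
    qed
  qed
qed

end

text \<open>A Dynkin class argument. On \<open>a \<inter> b\<close> with \<open>a \<in> F2\<close>
  and \<open>b \<in> G2\<close>, independence splits off the factor belonging to \<open>b\<close>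
  and leaves an integral over \<open>a\<close>, which is zero. Such sets are stable under
  intersection and generate the join, and vanishing passes to complements and disjoint unions. As
  \<open>E\<close> may depend on all of \<open>F1\<close>, the independence used is that of the
  large sigma-algebras.\<close>

lemma (in prob_space) integral_indicator_join_eq_0:
  fixes E :: "'a \<Rightarrow> real"
  assumes indep: "indep_set G1 F1"
    and F1: "sigma_algebra (space M) F1" and G1: "sigma_algebra (space M) G1"
    and F2: "sigma_algebra (space M) F2" "F2 \<subseteq> F1" and G2: "sigma_algebra (space M) G2" "G2 \<subseteq> G1"
    and E: "integrable M E" and E_meas: "E \<in> borel_measurable (sigma (space M) F1)"
    and zero: "\<And>A. A \<in> F2 \<Longrightarrow> (\<integral>x. indicator A x * E x \<partial>M) = 0"
    and A: "A \<in> sigma_sets (space M) (F2 \<union> G2)"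
  shows "(\<integral>x. indicator A x * E x \<partial>M) = 0"
proof -
  interpret F1: sigma_algebra "space M" F1 by fact
  interpret G1: sigma_algebra "space M" G1 by fact
  interpret F2: sigma_algebra "space M" F2 by fact
  interpret G2: sigma_algebra "space M" G2 by fact
  define I where "I = {a \<inter> b | a b. a \<in> F2 \<and> b \<in> G2}"
  have ev: "F1 \<subseteq> events" "G1 \<subseteq> events" using indep_setD_ev1[OF indep] indep_setD_ev2[OF indep] by auto
  have I_ev: "I \<subseteq> events" using ev F2(2) G2(2) unfolding I_def by blast
  then have I_Pow: "I \<subseteq> Pow (space M)" using sets.space_closed by blast
  have sub: "sigma_sets (space M) I \<subseteq> events" by (rule sets.sigma_sets_subset[OF I_ev])
  have "F2 \<union> G2 \<subseteq> I"
  proof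
    fix a assume a: "a \<in> F2 \<union> G2"
    then have "a = a \<inter> space M" "a = space M \<inter> a" using F2.sets_into_space G2.sets_into_space by auto
    then show "a \<in> I" unfolding I_def using a F2.top G2.top by blast
  qed
  then have AI: "A \<in> sigma_sets (space M) I" using A sigma_sets_mono'[of "F2 \<union> G2" I "space M"] by auto
  have "Int_stable I"
    unfolding Int_stable_def
  proof (intro ballI)
    fix x y assume "x \<in> I" "y \<in> I"
    then obtain a b a' b' where "x = a \<inter> b" "y = a' \<inter> b'" "a \<in> F2" "b \<in> G2" "a' \<in> F2" "b' \<in> G2"
      unfolding I_def by auto
    then show "x \<inter> y \<in> I"
      unfolding I_def by (intro CollectI exI[of _ "a \<inter> a'"] exI[of _ "b \<inter> b'"]) auto
  qed
  from this I_Pow AI show ?thesis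
  proof (induction rule: sigma_sets_induct_disjoint)
    case (basic A)
    then obtain a b where ab: "A = a \<inter> b" "a \<in> F2" "b \<in> G2" unfolding I_def by auto
    have am[measurable]: "a \<in> sets M" "b \<in> sets M" using ab F2(2) G2(2) ev by auto
    have ia: "integrable M (\<lambda>x. indicator a x * E x)"
      using integrable_mult_indicator[OF am(1) E] by simp
    have ib: "integrable M (indicator b :: 'a \<Rightarrow> real)" by (auto simp: emeasure_finite less_top[symmetric])
    have "indep_var borel (indicator b :: 'a \<Rightarrow> real) borel (\<lambda>x. indicator a x * E x)"
      unfolding indep_var_eq
    proof (intro conjI)
      show "indep_set (sigma_sets (space M) {(indicator b :: 'a \<Rightarrow> real) -` A \<inter> space M |A. A \<in> sets borel})
         (sigma_sets (space M) {(\<lambda>x. indicator a x * E x) -` A \<inter> space M |A. A \<in> sets borel})"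
        using indep unfolding indep_set_def
      proof (rule indep_sets_mono_sets)
        fix i :: bool
        have sF: "sets (sigma (space M) F1) = F1" using F1.sigma_sets_eq F1.space_closed by (simp add: sets_measure_of)
        have sG: "sets (sigma (space M) G1) = G1" using G1.sigma_sets_eq G1.space_closed by (simp add: sets_measure_of)
        have [measurable]: "a \<in> sets (sigma (space M) F1)" "b \<in> sets (sigma (space M) G1)"
          using ab F2(2) G2(2) unfolding sF sG by auto
        have 1: "(indicator b :: 'a \<Rightarrow> real) \<in> borel_measurable (sigma (space M) G1)" by measurable
        have 2: "(\<lambda>x. indicator a x * E x) \<in> borel_measurable (sigma (space M) F1)" using E_meas by measurable
        have "{(indicator b :: 'a \<Rightarrow> real) -` A \<inter> space M |A. A \<in> sets borel} \<subseteq> G1"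
          using measurable_sets[OF 1] unfolding sG by (auto simp: space_measure_of_conv)
        moreover have "{(\<lambda>x. indicator a x * E x) -` A \<inter> space M |A. A \<in> sets borel} \<subseteq> F1"
          using measurable_sets[OF 2] unfolding sF by (auto simp: space_measure_of_conv)
        ultimately show "case_bool (sigma_sets (space M) {(indicator b :: 'a \<Rightarrow> real) -` A \<inter> space M |A. A \<in> sets borel})
            (sigma_sets (space M) {(\<lambda>x. indicator a x * E x) -` A \<inter> space M |A. A \<in> sets borel}) i
            \<subseteq> case_bool G1 F1 i"
          using G1.sigma_sets_subset F1.sigma_sets_subset by (cases i) simp_all
      qed
    qed (use ia in auto)
    from indep_var_lebesgue_integral[OF this ib ia]
    have "(\<integral>x. indicator b x * (indicator a x * E x) \<partial>M) = (\<integral>x. indicator b x \<partial>M) * (\<integral>x. indicator a x * E x \<partial>M)" .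
    moreover have "(\<lambda>x. indicator A x * E x) = (\<lambda>x. indicator b x * (indicator a x * E x))"
      by (auto simp: ab(1) indicator_def)
    ultimately show ?case using zero[OF ab(2)] by simp
  next
    case empty
    then show ?case by simp
  next
    case (compl A)
    have Am: "A \<in> sets M" using compl sub by auto
    have "(\<integral>x. indicator (space M - A) x * E x \<partial>M) = (\<integral>x. indicator (space M) x * E x - indicator A x * E x \<partial>M)"
      using sets.sets_into_space[OF Am] by (intro Bochner_Integration.integral_cong) (auto simp: indicator_def)
    also have "\<dots> = 0"
      using compl zero[OF F2.top] integrable_mult_indicator[OF Am E] integrable_mult_indicator[OF sets.top E] by simp
    finally show ?case .
  next
    case (union A)
    have Am: "\<And>i. A i \<in> sets M" using union(2) sub by auto
    have "(LINT x:(\<Union>i. A i)|M. E x) = (\<Sum>i. LINT x:A i|M. E x)"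
      using union(1) Am integrable_mult_indicator[OF sets.countable_UN[of A UNIV] E]
      by (intro lebesgue_integral_countable_add) (auto simp: disjoint_family_on_def set_integrable_def)
    then show ?case using union(3) by (simp add: set_lebesgue_integral_def)
  qed
qed

section \<open>Martingales under a change of measure\<close>

lemma measurable_vec_nth [measurable]:
  fixes f :: "'a \<Rightarrow> real ^ 'd"
  assumes "f \<in> borel_measurable M"
  shows "(\<lambda>x. f x $ i) \<in> borel_measurable M"
  by (rule measurable_compose[OF assms], rule borel_measurable_continuous_onI) (intro continuous_intros)

text \<open>One-sided limits bound the function near each point, and compactness of
  \<open>{0..T}\<close> reduces to finitely many of these bounds. This is what makes excursions
  finite.\<close>

lemma cadlag_on_bounded:
  fixes f :: "real \<Rightarrow> 'b::real_normed_vector"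
  assumes "cadlag_on T f"
  shows "\<exists>K. \<forall>u\<in>{0..T}. norm (f u) \<le> K"
proof -
  have "\<exists>e K. e > 0 \<and> (\<forall>u\<in>{0..T} \<inter> ball t e. norm (f u) \<le> K)" if t: "t \<in> {0..T}" for t
  proof -
    have "\<exists>b K. b > t \<and> (\<forall>u\<in>{0..T}. t < u \<and> u < b \<longrightarrow> norm (f u) \<le> K)"
    proof (cases "t < T")
      case True
      then have "((\<lambda>u. norm (f u)) \<longlongrightarrow> norm (f t)) (at_right t)"
        using assms t by (intro tendsto_norm) (auto simp: cadlag_on_def continuous_within)
      from order_tendstoD(2)[OF this, of "norm (f t) + 1"] show ?thesis
        unfolding eventually_at_right_field by (auto intro: less_imp_le)
    qed (intro exI[of _ "t + 1"], auto)
    then obtain b K1 where b: "b > t" "\<And>u. u \<in> {0..T} \<Longrightarrow> t < u \<Longrightarrow> u < b \<Longrightarrow> norm (f u) \<le> K1" by blast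
    have "\<exists>a K. a < t \<and> (\<forall>u\<in>{0..T}. a < u \<and> u < t \<longrightarrow> norm (f u) \<le> K)"
    proof (cases "0 < t")
      case True
      then have "t \<in> {0<..T}" using t by auto
      then obtain l where "(f \<longlongrightarrow> l) (at_left t)" using assms unfolding cadlag_on_def by blast
      then have "((\<lambda>u. norm (f u)) \<longlongrightarrow> norm l) (at_left t)" by (rule tendsto_norm)
      from order_tendstoD(2)[OF this, of "norm l + 1"] show ?thesis
        unfolding eventually_at_left_field by (auto intro: less_imp_le)
    qed (intro exI[of _ "t - 1"], auto)
    then obtain a K2 where a: "a < t" "\<And>u. u \<in> {0..T} \<Longrightarrow> a < u \<Longrightarrow> u < t \<Longrightarrow> norm (f u) \<le> K2" by blast
    have "norm (f u) \<le> max (norm (f t)) (max K1 K2)" if "u \<in> {0..T}" "u \<in> ball t (min (b - t) (t - a))" for u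
    proof -
      have "u < b" "a < u" using that(2) by (auto simp: dist_real_def)
      then show ?thesis
        using b(2)[OF that(1)] a(2)[OF that(1)] by (cases u t rule: linorder_cases) (auto simp: le_max_iff_disj)
    qed
    then show ?thesis using a(1) b(1)
      by (intro exI[of _ "min (b - t) (t - a)"] exI[of _ "max (norm (f t)) (max K1 K2)"]) auto
  qed
  then obtain e K where e: "\<And>t. t \<in> {0..T} \<Longrightarrow> e t > 0"
    and K: "\<And>t u. t \<in> {0..T} \<Longrightarrow> u \<in> {0..T} \<Longrightarrow> u \<in> ball t (e t) \<Longrightarrow> norm (f u) \<le> K t"
    by (metis IntI)
  obtain C where C: "C \<subseteq> {0..T}" "finite C" "{0..T} \<subseteq> (\<Union>t\<in>C. ball t (e t))"
    by (rule compactE_image[OF compact_Icc, of "{0..T}" "\<lambda>t. ball t (e t)"]) (use e in force)+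
  show ?thesis
  proof (intro exI ballI)
    fix u assume u: "u \<in> {0..T}"
    then obtain t where t: "t \<in> C" "u \<in> ball t (e t)" using C by auto
    then have "norm (f u) \<le> \<bar>K t\<bar>" using K[of t u] C(1) u by force
    also have "\<dots> \<le> (\<Sum>t\<in>C. \<bar>K t\<bar>)" using t C(2) by (intro member_le_sum) auto
    finally show "norm (f u) \<le> (\<Sum>t\<in>C. \<bar>K t\<bar>)" .
  qed
qed

text \<open>Both estimates compare \<open>g\<close> with its chord from \<open>0\<close> to
  \<open>y\<close>, which starts at height \<open>0\<close>.\<close>

lemma convex_nonneg_mono:
  fixes g :: "real \<Rightarrow> real"
  assumes g: "convex_on {0..} g" "\<forall>x\<ge>0. g x \<ge> 0" "g 0 = 0" and xy: "0 \<le> x" "x \<le> y"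
  shows "g x \<le> g y" "y > 0 \<Longrightarrow> g x \<le> x / y * g y"
proof -
  show le: "g x \<le> x / y * g y" if "y > 0"
    using convex_onD[OF g(1), of "x / y" 0 y] xy that g(3) by simp
  show "g x \<le> g y"
  proof (cases "y = 0")
    case False
    then have "g x \<le> x / y * g y" using le xy by auto
    also have "\<dots> \<le> 1 * g y" using xy False g(2) by (intro mult_right_mono) (auto simp: divide_simps)
    finally show ?thesis by simp
  qed (use xy in auto)
qed

context filtered_prob_space
begin

lemma martingale_onI_terminal:
  assumes Q: "space Q = space P" and "adapted_on P F T X" "\<And>t. t \<in> {0..T} \<Longrightarrow> integrable Q (X t)"
    and "\<And>t A. t \<in> {0..T} \<Longrightarrow> A \<in> F t \<Longrightarrow> (LINT \<omega>:A|Q. X T \<omega>) = (LINT \<omega>:A|Q. X t \<omega>)"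
  shows "martingale_on Q F T X"
  unfolding martingale_on_def
proof (intro conjI allI impI ballI)
  show "adapted_on Q F T X" using assms(2) Q by (simp add: adapted_on_def)
  fix s t A assume *: "0 \<le> s" "s \<le> t" "t \<le> T" "A \<in> F s"
  then have "A \<in> F t" using F_mono by blast
  then show "(LINT \<omega>:A|Q. X t \<omega>) = (LINT \<omega>:A|Q. X s \<omega>)"
    using assms(4)[of t A] assms(4)[of s A] * by auto
qed (use assms in auto)

lemma prob_space_density_Fs:
  assumes \<tau>: "stopping \<tau>" and Z: "integrable P Z" "\<And>\<omega>. 0 \<le> Z \<omega>"
    and eq: "\<And>C. C \<in> sets (Fs \<tau>) \<Longrightarrow> (\<integral>\<omega>. indicator C \<omega> * Z \<omega> \<partial>P) = prob C"
  shows "prob_space (density P (\<lambda>\<omega>. ennreal (Z \<omega>)))"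
proof (rule prob_spaceI)
  have [measurable]: "Z \<in> borel_measurable P" using Z by auto
  have "(\<integral>\<omega>. Z \<omega> \<partial>P) = (\<integral>\<omega>. indicator (space P) \<omega> * Z \<omega> \<partial>P)"
    by (intro Bochner_Integration.integral_cong) auto
  also have "\<dots> = 1" using eq[of "space P"] sets.top[of "Fs \<tau>"] prob_space by (simp add: space_Fs)
  finally have "(\<integral>\<^sup>+\<omega>. ennreal (Z \<omega>) \<partial>P) = 1"
    using Z by (subst nn_integral_eq_integral) auto
  then show "emeasure (density P (\<lambda>\<omega>. ennreal (Z \<omega>))) (space (density P (\<lambda>\<omega>. ennreal (Z \<omega>)))) = 1"
    by (subst emeasure_density) (auto cong: nn_integral_cong)
qed

text \<open>Increments of the stopped process after time \<open>t\<close> live on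
  \<open>t \<le> \<tau>\<close>. Cut down to this event, a test set from \<open>F t\<close> lies in
  the past at \<open>\<tau>\<close>, where the new measure coincides with \<open>P\<close>; so the
  martingale property under \<open>P\<close> is all that has to be invoked.\<close>

lemma martingale_on_stopped_density:
  fixes S :: "real \<Rightarrow> 'a \<Rightarrow> real ^ 'd"
  assumes \<tau>: "stopping \<tau>" and mart: "martingale_on P F T (\<lambda>t \<omega>. S (min t (\<tau> \<omega>)) \<omega>)"
    and Z: "integrable P Z" "\<And>\<omega>. Z \<omega> \<ge> 0"
    and eq: "\<And>C. C \<in> sets (Fs \<tau>) \<Longrightarrow> (\<integral>\<omega>. indicator C \<omega> * Z \<omega> \<partial>P) = prob C"
  shows "martingale_on (density P (\<lambda>\<omega>. ennreal (Z \<omega>))) F T (\<lambda>t \<omega>. S (min t (\<tau> \<omega>)) \<omega>)"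
proof -
  let ?X = "\<lambda>t \<omega>. S (min t (\<tau> \<omega>)) \<omega>"
  let ?Q = "density P (\<lambda>\<omega>. ennreal (Z \<omega>))"
  have ad: "adapted_on P F T ?X" and int: "\<And>t. t \<in> {0..T} \<Longrightarrow> integrable P (?X t)"
    and mp: "\<And>s t A. 0 \<le> s \<Longrightarrow> s \<le> t \<Longrightarrow> t \<le> T \<Longrightarrow> A \<in> F s \<Longrightarrow> (LINT \<omega>:A|P. ?X t \<omega>) = (LINT \<omega>:A|P. ?X s \<omega>)"
    using mart unfolding martingale_on_def by blast+
  have [measurable]: "Z \<in> borel_measurable P" using Z by auto
  note XF = stopped_measurable_Fs[OF \<tau> ad]
  note sub = subalg_Fs[OF \<tau>]
  have iQ: "integrable ?Q (?X t)" if "t \<in> {0..T}" for t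
    using integrable_density_subalg_iff[OF finite_measure_axioms sub Z eq XF[OF that]] int[OF that] Z
    by (subst integrable_density) auto
  have T: "T \<in> {0..T}" using T_pos by auto
  show ?thesis
  proof (rule martingale_onI_terminal[OF _ ad iQ])
    fix t A assume t: "t \<in> {0..T}" and A: "A \<in> F t"
    let ?D = "\<lambda>\<omega>. ?X T \<omega> - ?X t \<omega>"
    define A1 where "A1 = A \<inter> {\<omega>\<in>space P. t \<le> \<tau> \<omega>}"
    have AP[measurable]: "A \<in> sets P" using A F_subset[OF t] by auto
    have A1t: "A1 \<in> F t"
      unfolding A1_def by (rule F_Int[OF t A stopping_ge[OF \<tau> t]])
    have A1s[measurable]: "A1 \<in> sets (Fs \<tau>)"
      by (rule F_before_Fs[OF \<tau> t A1t]) (auto simp: A1_def)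
    have A1P[measurable]: "A1 \<in> sets P" using A1t F_subset[OF t] by auto
    have DF: "(\<lambda>\<omega>. indicator A1 \<omega> *\<^sub>R ?D \<omega>) \<in> borel_measurable (Fs \<tau>)"
      using XF[OF t] XF[OF T] by measurable
    have DP: "(\<lambda>\<omega>. indicator A1 \<omega> *\<^sub>R ?D \<omega>) \<in> borel_measurable P"
      by (rule measurable_from_subalg[OF sub DF])
    have "(LINT \<omega>:A|?Q. ?X T \<omega>) - (LINT \<omega>:A|?Q. ?X t \<omega>) = (\<integral>\<omega>. indicator A \<omega> *\<^sub>R ?D \<omega> \<partial>?Q)"
      unfolding set_lebesgue_integral_def scaleR_diff_right
      using integrable_mult_indicator[OF _ iQ[OF T], of A] integrable_mult_indicator[OF _ iQ[OF t], of A]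
      by (subst Bochner_Integration.integral_diff) auto
    also have "\<dots> = (\<integral>\<omega>. indicator A1 \<omega> *\<^sub>R ?D \<omega> \<partial>?Q)"
    proof (rule Bochner_Integration.integral_cong)
      fix \<omega> assume "\<omega> \<in> space ?Q"
      then have "\<omega> \<in> space P" by simp
      moreover have "?D \<omega> = 0" if "\<tau> \<omega> \<le> t" using that t by (simp add: min_absorb2)
      ultimately show "indicator A \<omega> *\<^sub>R ?D \<omega> = indicator A1 \<omega> *\<^sub>R ?D \<omega>"
        by (cases "\<tau> \<omega> \<le> t") (auto simp: A1_def indicator_def)
    qed simp
    also have "\<dots> = (\<integral>\<omega>. Z \<omega> *\<^sub>R (indicator A1 \<omega> *\<^sub>R ?D \<omega>) \<partial>P)"
      using Z DP by (subst integral_density) auto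
    also have "\<dots> = (\<integral>\<omega>. indicator A1 \<omega> *\<^sub>R ?D \<omega> \<partial>P)"
      by (rule integral_density_subalg[OF finite_measure_axioms sub Z eq DF])
    also have "\<dots> = (LINT \<omega>:A1|P. ?X T \<omega>) - (LINT \<omega>:A1|P. ?X t \<omega>)"
      unfolding set_lebesgue_integral_def scaleR_diff_right
      using integrable_mult_indicator[OF A1P int[OF T]] integrable_mult_indicator[OF A1P int[OF t]]
      by (subst Bochner_Integration.integral_diff) auto
    also have "\<dots> = 0" using mp[of t T A1] A1t t by auto
    finally show "(LINT \<omega>:A|?Q. ?X T \<omega>) = (LINT \<omega>:A|?Q. ?X t \<omega>)" by simp
  qed simp
qed

text \<open>As \<open>Z\<close> is known at \<open>T\<close>, the increment multiplied by
  \<open>Z\<close> is \<open>Fm T\<close>-measurable with zero integral over the sets of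
  \<open>F s\<close>, and independence extends this to the join. Integrals are pulled back to
  \<open>P\<close>, for which independence is assumed, and treated by components.\<close>

lemma martingale_on_join_density:
  fixes X :: "real \<Rightarrow> 'a \<Rightarrow> real ^ 'd" and B :: "real \<Rightarrow> 'a \<Rightarrow> 'b::topological_space"
  assumes indep: "indep_set (augmented_natural_filtration P B T) (F T)"
    and Z[measurable]: "Z \<in> borel_measurable (Fm T)" and Z_nonneg: "\<And>\<omega>. 0 \<le> Z \<omega>"
    and mart: "martingale_on (density P (\<lambda>\<omega>. ennreal (Z \<omega>))) F T X"
  shows "martingale_on (density P (\<lambda>\<omega>. ennreal (Z \<omega>))) (join_filtration P F (augmented_natural_filtration P B)) T X"
proof -
  let ?Q = "density P (\<lambda>\<omega>. ennreal (Z \<omega>))"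
  let ?G = "augmented_natural_filtration P B"
  let ?H = "join_filtration P F ?G"
  have T: "T \<in> {0..T}" using T_pos by auto
  have ZP[measurable]: "Z \<in> borel_measurable P" by (rule measurable_from_subalg[OF subalg_Fm[OF T] Z])
  have ad: "adapted_on P F T X" and int: "\<And>t. t \<in> {0..T} \<Longrightarrow> integrable ?Q (X t)"
    and mp: "\<And>s t A. 0 \<le> s \<Longrightarrow> s \<le> t \<Longrightarrow> t \<le> T \<Longrightarrow> A \<in> F s \<Longrightarrow> (LINT \<omega>:A|?Q. X t \<omega>) = (LINT \<omega>:A|?Q. X s \<omega>)"
    using mart unfolding martingale_on_def adapted_on_def space_density by blast+
  have FH: "F t \<subseteq> ?H t" for t unfolding join_filtration_def by (auto intro: sigma_sets.Basic)
  have G_ev: "?G T \<subseteq> events" using indep_setD_ev1[OF indep] .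
  have G_mono: "?G s \<subseteq> ?G t" if "s \<le> t" for s t
    unfolding augmented_natural_filtration_def using that by (intro sigma_sets_mono') fastforce
  have G_sigma: "sigma_algebra (space P) (?G t)" for t
    unfolding augmented_natural_filtration_def
    by (rule sigma_algebra_sigma_sets) (auto dest: sets.sets_into_space null_setsD2)
  have H_ev: "?H t \<subseteq> events" if "t \<in> {0..T}" for t
    unfolding join_filtration_def using F_subset[OF that] G_ev G_mono[of t T] that
    by (intro sets.sigma_sets_subset) auto
  show ?thesis
    unfolding martingale_on_def
  proof (intro conjI allI impI ballI)
    show "adapted_on ?Q ?H T X" using ad FH by (auto simp: adapted_on_def)
    fix s t A assume st: "0 \<le> s" "s \<le> t" "t \<le> T" and A: "A \<in> ?H s"
    then have s': "s \<in> {0..T}" and t': "t \<in> {0..T}" by auto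
    have AP[measurable]: "A \<in> sets P" using A H_ev[OF s'] by auto
    let ?D = "\<lambda>\<omega>. X t \<omega> - X s \<omega>"
    have Xm[measurable]: "X t \<in> borel_measurable (Fm T)" "X s \<in> borel_measurable (Fm T)"
      using measurable_from_subalg[OF subalg_Fm_mono[of t T] adapted_onD[OF ad t']]
        measurable_from_subalg[OF subalg_Fm_mono[of s T] adapted_onD[OF ad s']] st by auto
    have [measurable]: "X t \<in> borel_measurable P" "X s \<in> borel_measurable P"
      using measurable_from_subalg[OF subalg_Fm[OF T] Xm(1)] measurable_from_subalg[OF subalg_Fm[OF T] Xm(2)] .
    have Dm: "?D \<in> borel_measurable (Fm T)" by measurable
    have Di: "integrable ?Q ?D" using int[OF t'] int[OF s'] by auto
    have conv: "((LINT \<omega>:A|?Q. X t \<omega>) - (LINT \<omega>:A|?Q. X s \<omega>)) $ i = (\<integral>\<omega>. indicator A \<omega> * (Z \<omega> * ?D \<omega> $ i) \<partial>P)"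
      if [measurable]: "A \<in> sets P" for A i
    proof -
      have iA: "integrable ?Q (\<lambda>\<omega>. indicator A \<omega> *\<^sub>R ?D \<omega>)"
        using integrable_mult_indicator[OF _ Di, of A] by auto
      have "(LINT \<omega>:A|?Q. X t \<omega>) - (LINT \<omega>:A|?Q. X s \<omega>) = (\<integral>\<omega>. indicator A \<omega> *\<^sub>R ?D \<omega> \<partial>?Q)"
        unfolding set_lebesgue_integral_def scaleR_diff_right
        using integrable_mult_indicator[OF _ int[OF t'], of A] integrable_mult_indicator[OF _ int[OF s'], of A]
        by (subst Bochner_Integration.integral_diff) auto
      then have "((LINT \<omega>:A|?Q. X t \<omega>) - (LINT \<omega>:A|?Q. X s \<omega>)) $ i = (\<integral>\<omega>. (indicator A \<omega> *\<^sub>R ?D \<omega>) $ i \<partial>?Q)"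
        using integral_bounded_linear[OF bounded_linear_vec_nth iA] by simp
      also have "\<dots> = (\<integral>\<omega>. Z \<omega> *\<^sub>R ((indicator A \<omega> *\<^sub>R ?D \<omega>) $ i) \<partial>P)"
        using Z_nonneg by (subst integral_density) auto
      finally show ?thesis by (simp add: mult_ac)
    qed
    have zero: "(\<integral>\<omega>. indicator A \<omega> * (Z \<omega> * ?D \<omega> $ i) \<partial>P) = 0" if "A \<in> F s" for A i
      using conv[of A i] mp[OF st that] that F_subset[OF s'] by auto
    have "(\<integral>\<omega>. indicator A \<omega> * (Z \<omega> * ?D \<omega> $ i) \<partial>P) = 0" for i
    proof (rule integral_indicator_join_eq_0[OF indep F_sigma[OF T] G_sigma F_sigma[OF s'] _ G_sigma[of s]])
      show "F s \<subseteq> F T" "?G s \<subseteq> ?G T" using F_mono[of s T] G_mono[of s T] st by auto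
      show "A \<in> sigma_sets (space P) (F s \<union> ?G s)" using A by (simp add: join_filtration_def)
      have "integrable ?Q (\<lambda>\<omega>. ?D \<omega> $ i)"
        using integrable_bounded_linear[OF bounded_linear_vec_nth Di] by simp
      then show "integrable P (\<lambda>\<omega>. Z \<omega> * ?D \<omega> $ i)"
        using Z_nonneg by (subst (asm) integrable_density) auto
      show "(\<lambda>\<omega>. Z \<omega> * ?D \<omega> $ i) \<in> borel_measurable (Fm T)"
        by (intro borel_measurable_times Z measurable_vec_nth Dm)
    qed (use zero in auto)
    then have "(LINT \<omega>:A|?Q. X t \<omega>) - (LINT \<omega>:A|?Q. X s \<omega>) = 0"
      using conv[OF AP] by (simp add: vec_eq_iff)
    then show "(LINT \<omega>:A|?Q. X t \<omega>) = (LINT \<omega>:A|?Q. X s \<omega>)" by simp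
  qed (use int in auto)
qed

text \<open>The case of density \<open>1\<close> along the given localizing times, which remain
  stopping times for the larger filtration.\<close>

lemma local_martingale_on_join:
  fixes X :: "real \<Rightarrow> 'a \<Rightarrow> real ^ 'd" and B :: "real \<Rightarrow> 'a \<Rightarrow> 'b::topological_space"
  assumes indep: "indep_set (augmented_natural_filtration P B T) (F T)"
    and loc: "local_martingale_on P F T X"
  shows "local_martingale_on P (join_filtration P F (augmented_natural_filtration P B)) T X"
proof -
  have FH: "F t \<subseteq> join_filtration P F (augmented_natural_filtration P B) t" for t
    unfolding join_filtration_def by (auto intro: sigma_sets.Basic)
  have "martingale_on P (join_filtration P F (augmented_natural_filtration P B)) T Y" if "martingale_on P F T Y"
    for Y :: "real \<Rightarrow> 'a \<Rightarrow> real ^ 'd"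
    using martingale_on_join_density[OF indep, of "\<lambda>_. 1" Y] that by (simp add: density_1)
  moreover have "stopping_time_on P (join_filtration P F (augmented_natural_filtration P B)) T \<tau>" if "stopping \<tau>" for \<tau>
    using that FH by (auto simp: stopping_time_on_def)
  ultimately show ?thesis
    using loc unfolding local_martingale_on_def by meson
qed

end

section \<open>Cadlag case: suppressing large excursions\<close>

context cadlag_process
begin

lemma excursion_finite: assumes "stopping \<tau>" "\<omega> \<in> space P" shows "excursion \<tau> \<omega> < \<infinity>"
proof -
  obtain K where K: "\<And>u. u \<in> {0..T} \<Longrightarrow> norm (S u \<omega>) \<le> K"
    using cadlag_on_bounded[OF S_cadlag[OF assms(2)]] by blast
  have "excursion \<tau> \<omega> \<le> ennreal (K + K)"
    unfolding excursion_def
  proof (rule SUP_least, rule ennreal_leI)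
    fix u assume "u \<in> {\<tau> \<omega>..T}"
    then have "norm (S u \<omega>) \<le> K" "norm (S (\<tau> \<omega>) \<omega>) \<le> K" using stopping_range[OF assms] K by auto
    then show "norm (S u \<omega> - S (\<tau> \<omega>) \<omega>) \<le> K + K" using norm_triangle_ineq4[of "S u \<omega>" "S (\<tau> \<omega>) \<omega>"] by linarith
  qed
  also have "\<dots> < \<infinity>" by simp
  finally show ?thesis .
qed

text \<open>Given the past at \<open>\<tau>\<close>, the density puts mass \<open>r / (1 + g (excursion))\<close> on large excursions and moves
  the remaining mass to the event of a small excursion, which stickiness makes non-negligible.\<close>

lemma small_excursion_density:
  fixes g :: "real \<Rightarrow> real"
  assumes \<tau>: "stopping \<tau>" and \<kappa>: "0 < \<kappa>" and r: "0 < r" "r < 1"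
    and sticky: "AE \<omega> in P. real_cond_exp P (Fs \<tau>) (indicator {\<omega>\<in>space P. excursion \<tau> \<omega> < ennreal \<kappa>}) \<omega> > 0"
    and g: "convex_on {0..} g" "\<forall>x\<ge>0. g x \<ge> 0" "g 0 = 0"
  obtains Z where "Z \<in> borel_measurable (Fm T)" "\<And>\<omega>. Z \<omega> > 0" "integrable P Z"
    "\<And>C. C \<in> sets (Fs \<tau>) \<Longrightarrow> (\<integral>\<omega>. indicator C \<omega> * Z \<omega> \<partial>P) = prob C"
    "\<And>\<omega>. \<tau> \<omega> = T \<Longrightarrow> Z \<omega> = 1"
    "(\<integral>\<^sup>+\<omega>. g_ext g (excursion \<tau> \<omega>) \<partial>density P (\<lambda>\<omega>. ennreal (Z \<omega>))) \<le> ennreal (g \<kappa> + r)"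
proof -
  interpret fs: finite_measure_subalgebra P "Fs \<tau>"
    using subalg_Fs[OF \<tau>] by unfold_locales auto
  have T: "T \<in> {0..T}" using T_pos by auto
  note sub = subalg_Fs[OF \<tau>] and subT = subalg_FT_Fs[OF \<tau>] and subTP = subalg_Fm[OF T]
  define y where "y \<omega> = enn2real (excursion \<tau> \<omega>)" for \<omega>
  define A where "A = {\<omega>\<in>space P. excursion \<tau> \<omega> < ennreal \<kappa>}"
  define N where "N = {\<omega>\<in>space P. \<tau> \<omega> < T}"
  \<comment> \<open>Continuing \<open>g\<close> by \<open>g 0\<close> to the left makes it monotone
    on the whole line and hence Borel; convexity on the half-line says nothing about negative
    arguments.\<close>
  define G where "G x = g (max 0 x)" for x
  have G_nonneg: "0 \<le> G x" for x using g(2) by (simp add: G_def)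
  have "mono G" by (intro monoI) (auto simp: G_def intro!: convex_nonneg_mono[OF g])
  then have Gm[measurable]: "G \<in> borel_measurable borel" by (rule borel_measurable_mono)
  have y_nonneg: "0 \<le> y \<omega>" for \<omega> by (simp add: y_def)
  have exc: "excursion \<tau> \<omega> = ennreal (y \<omega>)" if "\<omega> \<in> space P" for \<omega>
    using excursion_finite[OF \<tau> that] by (simp add: y_def)
  have yT[measurable]: "y \<in> borel_measurable (Fm T)"
    unfolding y_def using excursion_measurable[OF \<tau>] by measurable
  have yP[measurable]: "y \<in> borel_measurable P" by (rule measurable_from_subalg[OF subTP yT])
  have A_eq: "A = {\<omega>\<in>space P. y \<omega> < \<kappa>}" unfolding A_def using exc \<kappa> y_nonneg by (auto simp: ennreal_less_iff)
  have AT[measurable]: "A \<in> sets (Fm T)"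
  proof -
    have "{\<omega>\<in>space (Fm T). y \<omega> < \<kappa>} \<in> sets (Fm T)" by measurable
    then show ?thesis unfolding A_eq by (simp add: space_Fm)
  qed
  have AP[measurable]: "A \<in> sets P" using AT subTP by (auto simp: subalgebra_def)
  have Ns[measurable]: "N \<in> sets (Fs \<tau>)" unfolding N_def by (rule less_T_Fs[OF \<tau>])
  have NT[measurable]: "N \<in> sets (Fm T)" using Ns subT by (auto simp: subalgebra_def)
  have NP[measurable]: "N \<in> sets P" using Ns sub by (auto simp: subalgebra_def)
  \<comment> \<open>\<open>r * h\<close> is the mass given to large excursions; its conditional mean
    \<open>r * v\<close> is what remains to be taken from the small ones.\<close>
  define h where "h \<omega> = indicator (space P - A) \<omega> / (1 + G (y \<omega>))" for \<omega>
  have hP[measurable]: "h \<in> borel_measurable P" unfolding h_def by measurable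
  have h_bd: "0 \<le> h \<omega>" "h \<omega> \<le> 1" for \<omega>
    using G_nonneg[of "y \<omega>"] by (auto simp: h_def indicator_def divide_simps)
  have h_int: "integrable P h"
    by (rule integrable_const_bound[where B=1]) (use h_bd in auto)
  define p0 where "p0 = real_cond_exp P (Fs \<tau>) (indicator A)"
  \<comment> \<open>\<open>p\<close> and below \<open>v\<close> are versions that are positive,
    respectively in \<open>[0, 1]\<close>, at every point, so that \<open>Z\<close> is positive
    everywhere and not only almost surely.\<close>
  define p where "p \<omega> = (if p0 \<omega> > 0 then p0 \<omega> else 1)" for \<omega>
  define v0 where "v0 = real_cond_exp P (Fs \<tau>) h"
  define v where "v \<omega> = max 0 (min 1 (v0 \<omega>))" for \<omega>
  have [measurable]: "p0 \<in> borel_measurable (Fs \<tau>)" "v0 \<in> borel_measurable (Fs \<tau>)" unfolding p0_def v0_def by auto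
  have pm[measurable]: "p \<in> borel_measurable (Fs \<tau>)" and vm[measurable]: "v \<in> borel_measurable (Fs \<tau>)"
    unfolding p_def v_def by measurable
  note [measurable] = measurable_from_subalg[OF subT pm] measurable_from_subalg[OF subT vm]
    measurable_from_subalg[OF sub pm] measurable_from_subalg[OF sub vm]
  have p_pos: "p \<omega> > 0" for \<omega> by (simp add: p_def)
  have v_bd: "0 \<le> v \<omega>" "v \<omega> \<le> 1" for \<omega> by (auto simp: v_def)
  have rv: "0 < 1 - r * v \<omega>" "1 - r * v \<omega> \<le> 1" for \<omega>
  proof -
    have "r * v \<omega> \<le> r" using r v_bd[of \<omega>] by (intro mult_left_le) auto
    then show "0 < 1 - r * v \<omega>" using r by linarith
    show "1 - r * v \<omega> \<le> 1" using r v_bd[of \<omega>] by simp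
  qed
  have p_AE: "AE \<omega> in P. p0 \<omega> = p \<omega>"
    using sticky unfolding A_def[symmetric] p0_def[symmetric] by eventually_elim (simp add: p_def)
  have v_AE: "AE \<omega> in P. v0 \<omega> = v \<omega>"
  proof -
    have "AE \<omega> in P. v0 \<omega> \<le> 1" "AE \<omega> in P. v0 \<omega> \<ge> 0" unfolding v0_def
      using h_bd by (auto intro!: fs.real_cond_exp_le_c fs.real_cond_exp_ge_c h_int)
    then show ?thesis by eventually_elim (auto simp: v_def)
  qed
  \<comment> \<open>Given the past at \<open>\<tau>\<close>, small excursions have probability
    \<open>p\<close> and receive mass \<open>1 - r * v\<close>, large ones receive
    \<open>r * v\<close>; the total is \<open>1\<close>, and \<open>r < 1\<close> leaves a positive
    amount for the small ones.\<close>
  define Z where "Z \<omega> = (if \<omega> \<in> N then if \<omega> \<in> A then (1 - r * v \<omega>) / p \<omega> else r / (1 + G (y \<omega>)) else 1)" for \<omega>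
  have ZT: "Z \<in> borel_measurable (Fm T)" unfolding Z_def by measurable
  have ZP[measurable]: "Z \<in> borel_measurable P" by (rule measurable_from_subalg[OF subTP ZT])
  have Z_pos: "Z \<omega> > 0" for \<omega>
    using rv[of \<omega>] p_pos[of \<omega>] r G_nonneg[of "y \<omega>"] by (auto simp: Z_def intro!: divide_pos_pos add_pos_nonneg)
  have main: "integrable P (\<lambda>\<omega>. indicator C \<omega> * Z \<omega>) \<and> (\<integral>\<omega>. indicator C \<omega> * Z \<omega> \<partial>P) = prob C" if C: "C \<in> sets (Fs \<tau>)" for C
  proof -
    have CP[measurable]: "C \<in> sets P" using C sub by (auto simp: subalgebra_def)
    have CN[measurable]: "C \<inter> N \<in> sets (Fs \<tau>)" using C by auto
    let ?I = "indicator (C \<inter> N) :: 'a \<Rightarrow> real"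
    have i0: "integrable P (\<lambda>\<omega>. ?I \<omega> * (1 - r * v \<omega>))"
    proof (rule integrable_const_bound[where B=1])
      show "AE \<omega> in P. norm (?I \<omega> * (1 - r * v \<omega>)) \<le> 1"
        using rv by (auto simp: indicator_def abs_mult less_imp_le intro!: AE_I2)
    qed measurable
    have p_AE': "AE \<omega> in P. \<omega> \<in> C \<inter> N \<longrightarrow> real_cond_exp P (Fs \<tau>) (indicator A) \<omega> = p \<omega>"
      using p_AE unfolding p0_def by eventually_elim simp
    have "(\<lambda>\<omega>. 1 - r * v \<omega>) \<in> borel_measurable (Fs \<tau>)" by measurable
    note w = fs.integral_weight_by_inverse_cond_prob[OF AP CN pm this p_pos p_AE' i0]
    have i1: "integrable P (\<lambda>\<omega>. ?I \<omega> * h \<omega>)"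
      using integrable_mult_indicator[OF _ h_int, of "C \<inter> N"] by simp
    have i2: "integrable P (\<lambda>\<omega>. indicator (C - N) \<omega> :: real)" "integrable P ?I"
      by (auto simp: emeasure_finite less_top[symmetric])
    have i3: "integrable P (\<lambda>\<omega>. ?I \<omega> * v \<omega>)"
    proof (rule integrable_const_bound[where B=1])
      show "AE \<omega> in P. norm (?I \<omega> * v \<omega>) \<le> 1"
        using v_bd by (auto simp: indicator_def abs_mult intro!: AE_I2)
    qed measurable
    have e1: "(\<integral>\<omega>. ?I \<omega> * h \<omega> \<partial>P) = (\<integral>\<omega>. ?I \<omega> * v \<omega> \<partial>P)"
    proof -
      have "(\<integral>\<omega>. ?I \<omega> * h \<omega> \<partial>P) = (\<integral>\<omega>. ?I \<omega> * v0 \<omega> \<partial>P)"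
        unfolding v0_def by (rule fs.real_cond_exp_intg(2)[OF i1, symmetric]) auto
      also have "\<dots> = (\<integral>\<omega>. ?I \<omega> * v \<omega> \<partial>P)"
        using v_AE unfolding v0_def by (intro integral_cong_AE) auto
      finally show ?thesis .
    qed
    have eq: "indicator C \<omega> * Z \<omega> = ?I \<omega> * ((1 - r * v \<omega>) / p \<omega>) * indicator A \<omega> + r * (?I \<omega> * h \<omega>) + indicator (C - N) \<omega>"
      if "\<omega> \<in> space P" for \<omega>
      using that by (cases "\<omega> \<in> C"; cases "\<omega> \<in> N"; cases "\<omega> \<in> A") (simp_all add: Z_def h_def)
    have "integrable P (\<lambda>\<omega>. ?I \<omega> * ((1 - r * v \<omega>) / p \<omega>) * indicator A \<omega> + r * (?I \<omega> * h \<omega>) + indicator (C - N) \<omega>)"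
      by (intro Bochner_Integration.integrable_add w(1) integrable_mult_right i1 i2)
    then have iZ: "integrable P (\<lambda>\<omega>. indicator C \<omega> * Z \<omega>)" using eq by (simp cong: Bochner_Integration.integrable_cong)
    have CNs: "C \<inter> N \<inter> space P = C \<inter> N" "(C - N) \<inter> space P = C - N" using sets.sets_into_space[OF CP] by auto
    have "(\<integral>\<omega>. indicator C \<omega> * Z \<omega> \<partial>P) =
      (\<integral>\<omega>. ?I \<omega> * ((1 - r * v \<omega>) / p \<omega>) * indicator A \<omega> + r * (?I \<omega> * h \<omega>) + indicator (C - N) \<omega> \<partial>P)"
      by (rule Bochner_Integration.integral_cong[OF refl eq])
    also have "\<dots> = (\<integral>\<omega>. ?I \<omega> * (1 - r * v \<omega>) \<partial>P) + r * (\<integral>\<omega>. ?I \<omega> * v \<omega> \<partial>P) + prob (C - N)"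
      using w i1 i2 e1 CNs by (subst Bochner_Integration.integral_add; simp)+
    also have "(\<integral>\<omega>. ?I \<omega> * (1 - r * v \<omega>) \<partial>P) = (\<integral>\<omega>. ?I \<omega> - r * (?I \<omega> * v \<omega>) \<partial>P)"
      by (intro Bochner_Integration.integral_cong) (auto simp: algebra_simps)
    also have "\<dots> = prob (C \<inter> N) - r * (\<integral>\<omega>. ?I \<omega> * v \<omega> \<partial>P)" using i2 i3 CNs by simp
    finally show ?thesis using finite_measure_Diff'[OF CP NP] iZ by simp
  qed
  have sp: "space P \<in> sets (Fs \<tau>)" using sets.top[of "Fs \<tau>"] by (simp add: space_Fs)
  have Z_int: "integrable P Z" and Z_1: "(\<integral>\<omega>. Z \<omega> \<partial>P) = 1"
    using main[OF sp] by (auto simp: prob_space cong: Bochner_Integration.integrable_cong Bochner_Integration.integral_cong)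
  have "(\<integral>\<^sup>+\<omega>. g_ext g (excursion \<tau> \<omega>) \<partial>density P (\<lambda>\<omega>. ennreal (Z \<omega>))) = (\<integral>\<^sup>+\<omega>. ennreal (G (y \<omega>)) \<partial>density P (\<lambda>\<omega>. ennreal (Z \<omega>)))"
    by (intro nn_integral_cong) (use exc y_nonneg in \<open>auto simp: g_ext_def G_def\<close>)
  also have "\<dots> = (\<integral>\<^sup>+\<omega>. ennreal (Z \<omega>) * ennreal (G (y \<omega>)) \<partial>P)"
    by (intro nn_integral_density) auto
  also have "\<dots> \<le> (\<integral>\<^sup>+\<omega>. ennreal (g \<kappa> * Z \<omega> + r) \<partial>P)"
  proof (rule nn_integral_mono)
    fix \<omega> assume \<omega>: "\<omega> \<in> space P"
    have gk: "0 \<le> g \<kappa>" using g(2) \<kappa> by auto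
    \<comment> \<open>Small excursions cost at most \<open>g \<kappa>\<close> per unit of mass; on
      large ones the denominator of \<open>Z\<close> cancels the growth of \<open>g\<close> and at
      most \<open>r\<close> is left.\<close>
    have "Z \<omega> * G (y \<omega>) \<le> g \<kappa> * Z \<omega> + r"
    proof (cases "\<omega> \<in> A")
      case True
      then have "G (y \<omega>) \<le> g \<kappa>" using y_nonneg[of \<omega>] unfolding A_eq G_def by (auto intro: convex_nonneg_mono[OF g])
      then have "Z \<omega> * G (y \<omega>) \<le> Z \<omega> * g \<kappa>" using Z_pos[of \<omega>] by (intro mult_left_mono) auto
      then show ?thesis using r by (simp add: mult.commute)
    next
      case nA: False
      show ?thesis
      proof (cases "\<omega> \<in> N")
        case True
        then have "Z \<omega> * G (y \<omega>) = r * (G (y \<omega>) / (1 + G (y \<omega>)))" using nA by (simp add: Z_def)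
        also have "\<dots> \<le> r * 1" using r G_nonneg[of "y \<omega>"] by (intro mult_left_mono) (auto simp: divide_simps)
        finally show ?thesis using gk Z_pos[of \<omega>] by (auto intro: add_increasing mult_nonneg_nonneg)
      next
        case False
        then have "\<tau> \<omega> = T" using \<omega> stopping_range[OF \<tau> \<omega>] by (auto simp: N_def)
        then have "excursion \<tau> \<omega> = 0" unfolding excursion_def by simp
        then have "\<omega> \<in> A" using \<kappa> \<omega> by (simp add: A_def)
        then show ?thesis using nA by simp
      qed
    qed
    then show "ennreal (Z \<omega>) * ennreal (G (y \<omega>)) \<le> ennreal (g \<kappa> * Z \<omega> + r)"
      using Z_pos[of \<omega>] G_nonneg[of "y \<omega>"] by (simp add: ennreal_mult[symmetric] ennreal_leI)
  qed
  also have "\<dots> = ennreal (\<integral>\<omega>. g \<kappa> * Z \<omega> + r \<partial>P)"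
    using Z_int Z_pos g(2) \<kappa> r by (intro nn_integral_eq_integral) (auto simp: less_imp_le)
  also have "\<dots> = ennreal (g \<kappa> + r)" using Z_int Z_1 by (simp add: prob_space)
  finally have "(\<integral>\<^sup>+\<omega>. g_ext g (excursion \<tau> \<omega>) \<partial>density P (\<lambda>\<omega>. ennreal (Z \<omega>))) \<le> ennreal (g \<kappa> + r)" .
  moreover have "Z \<omega> = 1" if "\<tau> \<omega> = T" for \<omega> using that by (simp add: Z_def N_def)
  ultimately show thesis using that[of Z] ZT Z_pos Z_int main by blast
qed

end

section \<open>Continuous case: a martingale shadowing the process\<close>

text \<open>A local estimate: \<open>Y\<close> will be the process at a fixed time, whose
  integrability is at hand on one piece \<open>C0\<close> at a time.\<close>

lemma (in finite_measure_subalgebra) real_cond_exp_near: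
  fixes X Y :: "'a \<Rightarrow> real"
  assumes X: "integrable M X" and Y[measurable]: "Y \<in> borel_measurable F" and C0[measurable]: "C0 \<in> sets F"
    and YC: "integrable M (\<lambda>x. indicator C0 x * Y x)"
    and le: "\<And>C. C \<in> sets F \<Longrightarrow> C \<subseteq> C0 \<Longrightarrow> \<bar>\<integral>x. indicator C x * (X x - Y x) \<partial>M\<bar> \<le> c * measure M C"
  shows "AE x in M. x \<in> C0 \<longrightarrow> \<bar>real_cond_exp M F X x - Y x\<bar> \<le> c"
proof -
  let ?V = "real_cond_exp M F X"
  have C0M[measurable]: "C0 \<in> sets M" using C0 subalg by (auto simp: subalgebra_def)
  have V: "integrable M ?V" by (rule real_cond_exp_int(1)[OF X])
  have "AE x in M. x \<in> C0 \<longrightarrow> \<bar>indicator C0 x * (?V x - Y x)\<bar> \<le> c"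
  proof (rule AE_abs_le_of_set_integral_le[OF _ _ C0])
    show "integrable M (\<lambda>x. indicator C0 x * (?V x - Y x))"
      using integrable_mult_indicator[OF C0M V] YC by (simp add: right_diff_distrib)
    show "(\<lambda>x. indicator C0 x * (?V x - Y x)) \<in> borel_measurable F" by measurable
    fix C assume C[measurable]: "C \<in> sets F" and sub: "C \<subseteq> C0"
    have CM[measurable]: "C \<in> sets M" using C subalg by (auto simp: subalgebra_def)
    have YC': "integrable M (\<lambda>x. indicator C x * Y x)"
    proof -
      have "(\<lambda>x. indicator C x * Y x) = (\<lambda>x. indicator C x * (indicator C0 x * Y x))"
        using sub by (auto simp: fun_eq_iff indicator_def)
      then show ?thesis using integrable_mult_indicator[OF CM YC] by simp
    qed
    have iX: "integrable M (\<lambda>x. indicator C x * X x)" and iV: "integrable M (\<lambda>x. indicator C x * ?V x)"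
      using integrable_mult_indicator[OF CM X] integrable_mult_indicator[OF CM V] by auto
    have "(\<integral>x. indicator C x * (indicator C0 x * (?V x - Y x)) \<partial>M) = (\<integral>x. indicator C x * ?V x - indicator C x * Y x \<partial>M)"
      using sub by (intro Bochner_Integration.integral_cong) (auto simp: indicator_def)
    also have "\<dots> = (\<integral>x. indicator C x * ?V x \<partial>M) - (\<integral>x. indicator C x * Y x \<partial>M)"
      using iV YC' by simp
    also have "(\<integral>x. indicator C x * ?V x \<partial>M) = (\<integral>x. indicator C x * X x \<partial>M)"
      using X by (intro real_cond_exp_intg(2)[OF iX]) auto
    also have "\<dots> - (\<integral>x. indicator C x * Y x \<partial>M) = (\<integral>x. indicator C x * (X x - Y x) \<partial>M)"
      using iX YC' by (simp add: right_diff_distrib)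
    finally show "\<bar>\<integral>x. indicator C x * (indicator C0 x * (?V x - Y x)) \<partial>M\<bar> \<le> c * measure M C"
      using le[OF C sub] by simp
  qed
  then show ?thesis by eventually_elim simp
qed

lemma vec_lambda_eq_sum_axis: "(\<chi> i. h i) = (\<Sum>i\<in>UNIV. h i *\<^sub>R axis i (1::real))"
  by (subst basis_expansion[symmetric]) (simp add: scalar_mult_eq_scaleR)

lemma measurable_vec_lambda:
  fixes h :: "'d::finite \<Rightarrow> 'a \<Rightarrow> real"
  assumes "\<And>i. h i \<in> borel_measurable M"
  shows "(\<lambda>x. \<chi> i. h i x) \<in> borel_measurable M"
  unfolding vec_lambda_eq_sum_axis using assms by measurable

lemma integrable_vec_lambda:
  fixes h :: "'d::finite \<Rightarrow> 'a \<Rightarrow> real"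
  assumes "\<And>i. integrable M (h i)"
  shows "integrable M (\<lambda>x. \<chi> i. h i x)"
  unfolding vec_lambda_eq_sum_axis using assms by auto

section \<open>The walk made of moves of size \<open>\<kappa>\<close>, and its shadow\<close>

locale sticky_continuous_process = continuous_process P T F S
  for P :: "'a measure" and T F and S :: "real \<Rightarrow> 'a \<Rightarrow> real ^ 'd" +
  fixes \<tau> :: "'a \<Rightarrow> real" and \<kappa> :: real
  assumes \<tau>: "stopping \<tau>" and \<kappa>: "0 < \<kappa>"
    and mart: "martingale_on P F T (\<lambda>t \<omega>. S (min t (\<tau> \<omega>)) \<omega>)"
    and sticky: "\<And>\<sigma>. stopping \<sigma> \<Longrightarrow>
      AE \<omega> in P. real_cond_exp P (Fs \<sigma>) (indicator {\<omega>\<in>space P. excursion \<sigma> \<omega> < ennreal \<kappa>}) \<omega> > 0"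
begin

primrec \<sigma> :: "nat \<Rightarrow> 'a \<Rightarrow> real" where
  "\<sigma> 0 = \<tau>"
| "\<sigma> (Suc k) = (\<lambda>\<omega>. hit T \<kappa> (\<lambda>t. S t \<omega>) (\<sigma> k \<omega>))"

definition moving :: "nat \<Rightarrow> 'a set" where
  "moving k = {\<omega>\<in>space P. \<sigma> k \<omega> < T}"

lemma stopping_\<sigma>: "stopping (\<sigma> k)"
  by (induction k) (auto intro: \<tau> stopping_hit[OF _ \<kappa>])

lemma \<sigma>_range: "\<omega> \<in> space P \<Longrightarrow> 0 \<le> \<sigma> k \<omega> \<and> \<sigma> k \<omega> \<le> T"
  by (rule stopping_range[OF stopping_\<sigma>])

lemma
  assumes "\<omega> \<in> space P"
  shows \<sigma>_Suc: "\<sigma> k \<omega> \<le> \<sigma> (Suc k) \<omega>"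
    and \<sigma>_step_ge: "\<sigma> (Suc k) \<omega> < T \<Longrightarrow> \<kappa> \<le> norm (S (\<sigma> (Suc k) \<omega>) \<omega> - S (\<sigma> k \<omega>) \<omega>)"
    and \<sigma>_step_le: "u \<in> {\<sigma> k \<omega>..\<sigma> (Suc k) \<omega>} \<Longrightarrow> norm (S u \<omega> - S (\<sigma> k \<omega>) \<omega>) \<le> \<kappa>"
    and \<sigma>_retire: "excursion (\<sigma> k) \<omega> < ennreal \<kappa> \<Longrightarrow> \<sigma> (Suc k) \<omega> = T"
proof -
  have rg: "0 \<le> \<sigma> k \<omega>" "\<sigma> k \<omega> \<le> T" using \<sigma>_range[OF assms, of k] by auto
  note h = S_cont[OF assms] rg \<kappa>
  show "\<sigma> k \<omega> \<le> \<sigma> (Suc k) \<omega>" using hit_range(1)[OF h] by simp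
  show "\<sigma> (Suc k) \<omega> < T \<Longrightarrow> \<kappa> \<le> norm (S (\<sigma> (Suc k) \<omega>) \<omega> - S (\<sigma> k \<omega>) \<omega>)" using hit_ge[OF h] by simp
  show "u \<in> {\<sigma> k \<omega>..\<sigma> (Suc k) \<omega>} \<Longrightarrow> norm (S u \<omega> - S (\<sigma> k \<omega>) \<omega>) \<le> \<kappa>" using hit_le[OF h] by simp
  show "\<sigma> (Suc k) \<omega> = T" if "excursion (\<sigma> k) \<omega> < ennreal \<kappa>"
  proof -
    have "hit T \<kappa> (\<lambda>t. S t \<omega>) (\<sigma> k \<omega>) = T"
    proof (rule hit_eq[OF h])
      fix u assume "u \<in> {\<sigma> k \<omega>..T}"
      then have "ennreal (norm (S u \<omega> - S (\<sigma> k \<omega>) \<omega>)) \<le> excursion (\<sigma> k) \<omega>"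
        unfolding excursion_def by (rule SUP_upper)
      also note that
      finally show "norm (S u \<omega> - S (\<sigma> k \<omega>) \<omega>) < \<kappa>" by (simp add: ennreal_less_iff)
    qed
    then show ?thesis by simp
  qed
qed

text \<open>By uniform continuity on the compact interval a move of size \<open>\<kappa>\<close>
  takes at least some time \<open>d\<close>, so only finitely many fit before
  \<open>T\<close>.\<close>

lemma \<sigma>_eventually: assumes \<omega>: "\<omega> \<in> space P" shows "\<exists>k. \<sigma> k \<omega> = T"
proof (rule ccontr)
  assume "\<not> ?thesis"
  then have lt: "\<sigma> k \<omega> < T" for k using \<sigma>_range[OF \<omega>, of k] by (metis less_eq_real_def)
  have "uniformly_continuous_on {0..T} (\<lambda>t. S t \<omega>)"
    by (rule compact_uniformly_continuous[OF S_cont[OF \<omega>] compact_Icc])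
  then obtain d where d: "d > 0"
    "\<And>u v. u \<in> {0..T} \<Longrightarrow> v \<in> {0..T} \<Longrightarrow> dist v u < d \<Longrightarrow> dist (S v \<omega>) (S u \<omega>) < \<kappa>"
    unfolding uniformly_continuous_on_def using \<kappa> by metis
  have step: "\<sigma> k \<omega> + d \<le> \<sigma> (Suc k) \<omega>" for k
  proof (rule ccontr)
    assume "\<not> ?thesis"
    then have "dist (\<sigma> (Suc k) \<omega>) (\<sigma> k \<omega>) < d" using \<sigma>_Suc[OF \<omega>, of k] by (simp add: dist_real_def)
    then have "dist (S (\<sigma> (Suc k) \<omega>) \<omega>) (S (\<sigma> k \<omega>) \<omega>) < \<kappa>"
      using \<sigma>_range[OF \<omega>] by (intro d(2)) (auto simp del: \<sigma>.simps)
    then show False using \<sigma>_step_ge[OF \<omega> lt[of "Suc k"]] by (simp add: dist_norm del: \<sigma>.simps)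
  qed
  have "real k * d \<le> \<sigma> k \<omega>" for k
  proof (induction k)
    case 0
    then show ?case using \<sigma>_range[OF \<omega>, of 0] by simp
  next
    case (Suc k)
    then show ?case using step[of k] by (simp add: algebra_simps del: \<sigma>.simps)
  qed
  moreover obtain k :: nat where "T < real k * d" using reals_Archimedean3[OF d(1)] by auto
  ultimately show False using lt[of k] by (meson less_le_trans not_less_iff_gr_or_eq)
qed

sublocale R: retirement P "\<lambda>k. Fs (\<sigma> k)" moving
proof unfold_locales
  show "subalgebra P (Fs (\<sigma> k))" for k by (rule subalg_Fs[OF stopping_\<sigma>])
  show "sets (Fs (\<sigma> k)) \<subseteq> sets (Fs (\<sigma> (Suc k)))" for k
    by (rule Fs_mono[OF stopping_\<sigma> stopping_\<sigma> \<sigma>_Suc])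
  show mv: "moving k \<in> sets (Fs (\<sigma> k))" for k unfolding moving_def by (rule less_T_Fs[OF stopping_\<sigma>])
  show "moving (Suc k) \<subseteq> moving k" for k
    unfolding moving_def using \<sigma>_Suc[of _ k] by (auto simp del: \<sigma>.simps dest: le_less_trans)
  show "(\<Inter>k. moving k) = {}"
  proof (rule equals0I)
    fix \<omega> assume \<omega>: "\<omega> \<in> (\<Inter>k. moving k)"
    then have "\<omega> \<in> moving 0" by blast
    then obtain k where "\<sigma> k \<omega> = T" using \<sigma>_eventually[of \<omega>] unfolding moving_def by blast
    then show False using INT_D[OF \<omega>, of k] by (simp add: moving_def)
  qed
  fix k
  interpret fs: finite_measure_subalgebra P "Fs (\<sigma> k)"
    using subalg_Fs[OF stopping_\<sigma>] by unfold_locales auto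
  have T: "T \<in> {0..T}" using T_pos by auto
  let ?A = "{\<omega>\<in>space P. excursion (\<sigma> k) \<omega> < ennreal \<kappa>}"
  note [measurable] = measurable_from_subalg[OF subalg_Fm[OF T] excursion_measurable[OF stopping_\<sigma>]]
  have [measurable]: "moving (Suc k) \<in> sets P"
    using mv[of "Suc k"] subalg_Fs[OF stopping_\<sigma>, of "Suc k"] unfolding subalgebra_def by blast
  \<comment> \<open>An excursion after \<open>\<sigma> k\<close> that stays below
    \<open>\<kappa>\<close> never triggers another hit and forces retirement; positivity passes on
    to this larger event.\<close>
  have "AE \<omega> in P. real_cond_exp P (Fs (\<sigma> k)) (indicator ?A) \<omega>
      \<le> real_cond_exp P (Fs (\<sigma> k)) (indicator (space P - moving (Suc k))) \<omega>"
  proof (rule fs.real_cond_exp_mono)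
    show "AE \<omega> in P. indicator ?A \<omega> \<le> (indicator (space P - moving (Suc k)) \<omega> :: real)"
      using \<sigma>_retire[of _ k] by (intro AE_I2) (auto simp: indicator_def moving_def simp del: \<sigma>.simps)
    show "integrable P (indicator ?A :: 'a \<Rightarrow> real)" "integrable P (indicator (space P - moving (Suc k)) :: 'a \<Rightarrow> real)"
      by (auto simp: emeasure_finite less_top[symmetric])
  qed
  with sticky[OF stopping_\<sigma>[of k]]
  show "AE \<omega> in P. 0 < real_cond_exp P (Fs (\<sigma> k)) (indicator (space P - moving (Suc k))) \<omega>"
    by eventually_elim simp
qed

abbreviation "pos i k \<omega> \<equiv> S (\<sigma> k \<omega>) \<omega> $ i"

lemma retirement_process_pos: "retirement_process P (\<lambda>k. Fs (\<sigma> k)) moving (pos i) \<kappa>"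
proof unfold_locales
  show "pos i k \<in> borel_measurable (Fs (\<sigma> k))" for k
    by (rule measurable_vec_nth[OF process_at_stopping_measurable[OF stopping_\<sigma>]])
  have "integrable P (\<lambda>\<omega>. S (min T (\<tau> \<omega>)) \<omega>)" using mart T_pos unfolding martingale_on_def by auto
  from integrable_bounded_linear[OF bounded_linear_vec_nth this, of i]
  show "integrable P (pos i 0)"
    using stopping_range[OF \<tau>] by (simp add: min_absorb2 cong: Bochner_Integration.integrable_cong)
  show "\<bar>pos i (Suc k) \<omega> - pos i k \<omega>\<bar> \<le> \<kappa>" if "\<omega> \<in> space P" for k \<omega>
    using \<sigma>_step_le[OF that, of "\<sigma> (Suc k) \<omega>" k] \<sigma>_Suc[OF that, of k]
      component_le_norm_cart[of "S (\<sigma> (Suc k) \<omega>) \<omega> - S (\<sigma> k \<omega>) \<omega>" i]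
    by (simp del: \<sigma>.simps)
qed

abbreviation "Q \<equiv> density P (\<lambda>\<omega>. ennreal (R.dens \<omega>))"

lemma dens_FT: "R.dens \<in> borel_measurable (Fm T)"
  by (rule R.dens_measurable[OF subalg_FT_Fs[OF stopping_\<sigma>]])

lemma integral_Q:
  fixes h :: "'a \<Rightarrow> real"
  assumes "h \<in> borel_measurable P" shows "(\<integral>\<omega>. h \<omega> \<partial>Q) = (\<integral>\<omega>. R.dens \<omega> * h \<omega> \<partial>P)"
  using assms R.dens_pos by (subst integral_density) (auto simp: less_imp_le)

lemma integrable_Q:
  fixes h :: "'a \<Rightarrow> real"
  assumes "h \<in> borel_measurable P" shows "integrable Q h \<longleftrightarrow> integrable P (\<lambda>\<omega>. R.dens \<omega> * h \<omega>)"
  using assms R.dens_pos by (subst integrable_density) (auto simp: less_imp_le)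

lemma AE_Q: "(AE \<omega> in P. \<phi> \<omega>) \<Longrightarrow> AE \<omega> in Q. \<phi> \<omega>"
  by (subst AE_density) auto

lemma prob_space_Q: "prob_space Q"
  by (rule prob_space_density_Fs[OF stopping_\<sigma>[of 0] R.dens_int less_imp_le[OF R.dens_pos] R.integral_dens_0(2)])

abbreviation "target i t \<equiv> real_cond_exp Q (Fm t) (R.terminal (pos i))"

text \<open>The bound is checked separately on \<open>t \<le> \<tau>\<close> and on each event \<open>\<sigma> k < t \<le> \<sigma> (Suc k)\<close>.\<close>

lemma target_near:
  assumes t: "t \<in> {0..T}"
  shows "AE \<omega> in Q. \<bar>target i t \<omega> - S t \<omega> $ i\<bar> \<le> 2 * \<kappa>"
proof -
  interpret Q: prob_space Q by (rule prob_space_Q)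
  interpret RP: retirement_process P "\<lambda>k. Fs (\<sigma> k)" moving "pos i" \<kappa> by (rule retirement_process_pos)
  let ?X = "R.terminal (pos i)"
  let ?Y = "\<lambda>\<omega>. S t \<omega> $ i"
  have subt: "subalgebra P (Fm t)" and subQ: "subalgebra Q (Fm t)" using subalg_Fm[OF t] by (auto simp: subalgebra_def)
  interpret fs: finite_measure_subalgebra Q "Fm t" using subQ by unfold_locales
  have X_int: "integrable Q ?X" using RP.dens_terminal_int by (simp add: integrable_Q)
  have Yt[measurable]: "?Y \<in> borel_measurable (Fm t)" by (rule measurable_vec_nth[OF adapted_onD[OF S_adapted t]])
  have YP[measurable]: "?Y \<in> borel_measurable P" by (rule measurable_from_subalg[OF subt Yt])
  have F_P: "A \<in> sets P" if "A \<in> sets (Fm t)" for A using that subt by (auto simp: subalgebra_def)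
  have conv: "(\<integral>\<omega>. indicator C \<omega> * (?X \<omega> - ?Y \<omega>) \<partial>Q) = (\<integral>\<omega>. indicator C \<omega> * (R.dens \<omega> * ?X \<omega>) \<partial>P) - (\<integral>\<omega>. indicator C \<omega> * (R.dens \<omega> * ?Y \<omega>) \<partial>P)"
    if [measurable]: "C \<in> sets P" and i: "integrable P (\<lambda>\<omega>. indicator C \<omega> * (R.dens \<omega> * ?Y \<omega>))" for C
  proof -
    have "(\<integral>\<omega>. indicator C \<omega> * (?X \<omega> - ?Y \<omega>) \<partial>Q) = (\<integral>\<omega>. indicator C \<omega> * (R.dens \<omega> * ?X \<omega>) - indicator C \<omega> * (R.dens \<omega> * ?Y \<omega>) \<partial>P)"
      by (subst integral_Q) (auto intro!: Bochner_Integration.integral_cong simp: algebra_simps)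
    then show ?thesis using i integrable_mult_indicator[OF that(1) RP.dens_terminal_int] by simp
  qed
  \<comment> \<open>Up to \<open>\<tau>\<close> there is no error at all: the process agrees with
    its stopped version, which is \<open>Fs \<tau>\<close>-measurable, and on that sigma-algebra
    \<open>Q\<close> and \<open>P\<close> coincide.\<close>
  have before: "AE \<omega> in Q. \<omega> \<in> {\<omega>\<in>space P. t \<le> \<tau> \<omega>} \<longrightarrow> \<bar>target i t \<omega> - ?Y \<omega>\<bar> \<le> 2 * \<kappa>"
  proof (rule fs.real_cond_exp_near[OF X_int Yt])
    let ?C0 = "{\<omega>\<in>space P. t \<le> \<tau> \<omega>}"
    let ?W = "\<lambda>\<omega>. S (min t (\<tau> \<omega>)) \<omega>"
    show C0t: "?C0 \<in> sets (Fm t)" using stopping_ge[OF \<tau> t] sets_Fm[OF t] by simp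
    have ad: "adapted_on P F T (\<lambda>t \<omega>. S (min t (\<tau> \<omega>)) \<omega>)"
      and int: "\<And>t. t \<in> {0..T} \<Longrightarrow> integrable P (\<lambda>\<omega>. S (min t (\<tau> \<omega>)) \<omega>)"
      and mp: "\<And>s t A. 0 \<le> s \<Longrightarrow> s \<le> t \<Longrightarrow> t \<le> T \<Longrightarrow> A \<in> F s \<Longrightarrow>
        (LINT \<omega>:A|P. S (min t (\<tau> \<omega>)) \<omega>) = (LINT \<omega>:A|P. S (min s (\<tau> \<omega>)) \<omega>)"
      using mart unfolding martingale_on_def by blast+
    have Wi: "(\<lambda>\<omega>. ?W \<omega> $ i) \<in> borel_measurable (Fs \<tau>)"
      by (rule measurable_vec_nth[OF stopped_measurable_Fs[OF \<tau> ad t]])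
    have W_int: "integrable P (\<lambda>\<omega>. ?W \<omega> $ i)"
      by (rule integrable_bounded_linear[OF bounded_linear_vec_nth int[OF t]])
    have dW_int: "integrable P (\<lambda>\<omega>. R.dens \<omega> * ?W \<omega> $ i)"
      using integrable_density_subalg_iff[OF finite_measure_axioms subalg_Fs[OF \<tau>] R.dens_int _ _ Wi] W_int
        R.integral_dens_0(2) R.dens_pos by (auto simp: less_imp_le)
    have YW: "indicator C \<omega> * (a * ?Y \<omega>) = indicator C \<omega> * (a * ?W \<omega> $ i)" if "C \<subseteq> ?C0" for C \<omega> and a :: real
      using that by (auto simp: indicator_def min_absorb1)
    have iC: "integrable P (\<lambda>\<omega>. indicator C \<omega> * (R.dens \<omega> * ?Y \<omega>))" if "C \<subseteq> ?C0" "C \<in> sets P" for C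
      unfolding YW[OF that(1)] using integrable_mult_indicator[OF that(2) dW_int] by simp
    show "integrable Q (\<lambda>\<omega>. indicator ?C0 \<omega> * ?Y \<omega>)"
      using iC[of ?C0] F_P[OF C0t] by (subst integrable_Q) (auto simp: mult.left_commute)
    fix C assume C: "C \<in> sets (Fm t)" "C \<subseteq> ?C0"
    note CP[measurable] = F_P[OF C(1)]
    have Ct: "C \<in> F t" using C(1) sets_Fm[OF t] by simp
    have Cs[measurable]: "C \<in> sets (Fs \<tau>)" by (rule F_before_Fs[OF \<tau> t Ct]) (use C(2) in auto)
    have "(\<integral>\<omega>. indicator C \<omega> * (R.dens \<omega> * ?X \<omega>) \<partial>P) = (\<integral>\<omega>. indicator C \<omega> * pos i 0 \<omega> \<partial>P)"
      using RP.integral_dens_terminal_0[of C] Cs by simp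
    also have "\<dots> = (\<integral>\<omega>. (indicator C \<omega> *\<^sub>R S (min T (\<tau> \<omega>)) \<omega>) $ i \<partial>P)"
      using stopping_range[OF \<tau>] by (intro Bochner_Integration.integral_cong) (auto simp: min_absorb2)
    also have "\<dots> = (LINT \<omega>:C|P. S (min T (\<tau> \<omega>)) \<omega>) $ i"
      unfolding set_lebesgue_integral_def using T_pos
      by (intro integral_bounded_linear[OF bounded_linear_vec_nth] integrable_mult_indicator[OF CP] int) auto
    also have "\<dots> = (LINT \<omega>:C|P. ?W \<omega>) $ i" using mp[of t T C] t Ct by auto
    also have "\<dots> = (\<integral>\<omega>. (indicator C \<omega> *\<^sub>R ?W \<omega>) $ i \<partial>P)"
      unfolding set_lebesgue_integral_def
      by (intro integral_bounded_linear[OF bounded_linear_vec_nth, symmetric] integrable_mult_indicator[OF CP] int t)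
    also have "\<dots> = (\<integral>\<omega>. R.dens \<omega> *\<^sub>R (indicator C \<omega> * ?W \<omega> $ i) \<partial>P)"
    proof -
      have "(\<lambda>\<omega>. indicator C \<omega> * ?W \<omega> $ i) \<in> borel_measurable (Fs \<tau>)" using Wi by measurable
      from integral_density_subalg[OF finite_measure_axioms subalg_Fs[OF \<tau>] R.dens_int _ _ this]
      show ?thesis using R.integral_dens_0(2) R.dens_pos by (simp add: less_imp_le)
    qed
    also have "\<dots> = (\<integral>\<omega>. indicator C \<omega> * (R.dens \<omega> * ?Y \<omega>) \<partial>P)"
      unfolding YW[OF C(2)] by (simp add: mult.left_commute)
    finally have "(\<integral>\<omega>. indicator C \<omega> * (?X \<omega> - ?Y \<omega>) \<partial>Q) = 0"
      using conv[OF CP iC[OF C(2) CP]] by simp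
    then show "\<bar>\<integral>\<omega>. indicator C \<omega> * (?X \<omega> - ?Y \<omega>) \<partial>Q\<bar> \<le> 2 * \<kappa> * measure Q C" using \<kappa> by simp
  qed
  have during: "AE \<omega> in Q. \<omega> \<in> {\<omega>\<in>space P. \<sigma> k \<omega> < t} \<inter> {\<omega>\<in>space P. t \<le> \<sigma> (Suc k) \<omega>} \<longrightarrow> \<bar>target i t \<omega> - ?Y \<omega>\<bar> \<le> 2 * \<kappa>" for k
  proof (rule fs.real_cond_exp_near[OF X_int Yt])
    let ?C0 = "{\<omega>\<in>space P. \<sigma> k \<omega> < t} \<inter> {\<omega>\<in>space P. t \<le> \<sigma> (Suc k) \<omega>}"
    let ?N = "moving (Suc k)"
    have "{\<omega>\<in>space P. \<sigma> k \<omega> < t} \<in> sets (Fm t)" "{\<omega>\<in>space P. t \<le> \<sigma> (Suc k) \<omega>} \<in> sets (Fm t)"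
      using stopping_less[OF stopping_\<sigma> t, of k] stopping_ge[OF stopping_\<sigma> t, of "Suc k"] sets_Fm[OF t] by auto
    then show C0t: "?C0 \<in> sets (Fm t)" by (rule sets.Int)
    have Yk: "\<bar>?Y \<omega> - pos i k \<omega>\<bar> \<le> \<kappa>" if "\<omega> \<in> ?C0" for \<omega>
      using \<sigma>_step_le[of \<omega> t k] component_le_norm_cart[of "S t \<omega> - S (\<sigma> k \<omega>) \<omega>" i] that
      by (auto simp del: \<sigma>.simps)
    have dY: "integrable P (\<lambda>\<omega>. indicator C \<omega> * (R.dens \<omega> * ?Y \<omega>))" if C: "C \<subseteq> ?C0" and [measurable]: "C \<in> sets P" for C
    proof (rule Bochner_Integration.integrable_bound)
      show "integrable P (\<lambda>\<omega>. \<bar>R.dens \<omega> * pos i k \<omega>\<bar> + \<kappa> * R.dens \<omega>)"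
        using RP.dens_f_int[of k] R.dens_int by auto
      show "AE \<omega> in P. norm (indicator C \<omega> * (R.dens \<omega> * ?Y \<omega>)) \<le> norm (\<bar>R.dens \<omega> * pos i k \<omega>\<bar> + \<kappa> * R.dens \<omega>)"
      proof (rule AE_I2)
        fix \<omega>
        have "R.dens \<omega> * \<bar>?Y \<omega>\<bar> \<le> R.dens \<omega> * (\<bar>pos i k \<omega>\<bar> + \<kappa>)" if "\<omega> \<in> C"
          using Yk[OF subsetD[OF C that]] R.dens_pos[of \<omega>] by (intro mult_left_mono) linarith+
        then show "norm (indicator C \<omega> * (R.dens \<omega> * ?Y \<omega>)) \<le> norm (\<bar>R.dens \<omega> * pos i k \<omega>\<bar> + \<kappa> * R.dens \<omega>)"
          using R.dens_pos[of \<omega>] \<kappa> by (cases "\<omega> \<in> C") (auto simp: abs_mult algebra_simps)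
      qed
    qed measurable
    show "integrable Q (\<lambda>\<omega>. indicator ?C0 \<omega> * ?Y \<omega>)"
      using dY[of ?C0] F_P[OF C0t] by (subst integrable_Q) (auto simp: mult.left_commute)
    fix C assume C: "C \<in> sets (Fm t)" "C \<subseteq> ?C0"
    note CP[measurable] = F_P[OF C(1)]
    have Ct: "C \<in> F t" using C(1) sets_Fm[OF t] by simp
    \<comment> \<open>On \<open>C\<close> time \<open>t\<close> has come no later than the end of
      the step, so the terminal value may be averaged there.\<close>
    have "C \<in> sets (Fs (\<sigma> (Suc k)))" by (rule F_before_Fs[OF stopping_\<sigma> t Ct]) (use C(2) in auto)
    then have CN: "C \<inter> ?N \<in> sets (Fs (\<sigma> (Suc k)))" "C \<inter> ?N \<subseteq> ?N" using R.N_sets[of "Suc k"] by auto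
    have C_sub: "C \<subseteq> moving k" using C(2) t by (auto simp: moving_def)
    \<comment> \<open>\<open>W\<close> is the terminal value averaged at the end of the current
      step: paths that walk on are represented by their position at \<open>\<sigma> (Suc k)\<close>,
      retiring ones keep their terminal value. Either is within \<open>\<kappa>\<close> of
      \<open>pos i k\<close>, and so is \<open>?Y\<close>; this is where \<open>2 * \<kappa>\<close>
      comes from.\<close>
    define W where "W \<omega> = (if \<omega> \<in> ?N then pos i (Suc k) \<omega> else ?X \<omega>)" for \<omega>
    have Wm[measurable]: "W \<in> borel_measurable P" unfolding W_def by measurable
    have iX: "integrable P (\<lambda>\<omega>. indicator (C - ?N) \<omega> * (R.dens \<omega> * ?X \<omega>))"
      "integrable P (\<lambda>\<omega>. indicator (C \<inter> ?N) \<omega> * (R.dens \<omega> * ?X \<omega>))"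
      using integrable_mult_indicator[OF _ RP.dens_terminal_int, of "C - ?N"]
        integrable_mult_indicator[OF _ RP.dens_terminal_int, of "C \<inter> ?N"] by auto
    have if': "integrable P (\<lambda>\<omega>. indicator (C \<inter> ?N) \<omega> * (R.dens \<omega> * pos i (Suc k) \<omega>))"
      using integrable_mult_indicator[OF _ RP.dens_f_int[of "Suc k"], of "C \<inter> ?N"] by auto
    have W_eq: "(\<lambda>\<omega>. indicator C \<omega> * (R.dens \<omega> * W \<omega>)) =
        (\<lambda>\<omega>. indicator (C - ?N) \<omega> * (R.dens \<omega> * ?X \<omega>) + indicator (C \<inter> ?N) \<omega> * (R.dens \<omega> * pos i (Suc k) \<omega>))"
      by (auto simp: W_def indicator_def)
    have W_int: "integrable P (\<lambda>\<omega>. indicator C \<omega> * (R.dens \<omega> * W \<omega>))"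
      unfolding W_eq using iX if' by auto
    have "(\<integral>\<omega>. indicator C \<omega> * (R.dens \<omega> * ?X \<omega>) \<partial>P) =
        (\<integral>\<omega>. indicator (C - ?N) \<omega> * (R.dens \<omega> * ?X \<omega>) + indicator (C \<inter> ?N) \<omega> * (R.dens \<omega> * ?X \<omega>) \<partial>P)"
      by (intro Bochner_Integration.integral_cong) (auto simp: indicator_def)
    also have "\<dots> = (\<integral>\<omega>. indicator C \<omega> * (R.dens \<omega> * W \<omega>) \<partial>P)"
      unfolding W_eq using iX if' RP.integral_dens_terminal_eq[OF CN] by simp
    finally have "(\<integral>\<omega>. indicator C \<omega> * (?X \<omega> - ?Y \<omega>) \<partial>Q) =
        (\<integral>\<omega>. indicator C \<omega> * (R.dens \<omega> * W \<omega>) \<partial>P) - (\<integral>\<omega>. indicator C \<omega> * (R.dens \<omega> * ?Y \<omega>) \<partial>P)"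
      using conv[OF CP dY[OF C(2) CP]] by simp
    also have "\<dots> = (\<integral>\<omega>. indicator C \<omega> * (R.dens \<omega> * (W \<omega> - ?Y \<omega>)) \<partial>P)"
      using W_int dY[OF C(2) CP] by (simp add: right_diff_distrib)
    finally have eq: "(\<integral>\<omega>. indicator C \<omega> * (?X \<omega> - ?Y \<omega>) \<partial>Q) = (\<integral>\<omega>. indicator C \<omega> * (R.dens \<omega> * (W \<omega> - ?Y \<omega>)) \<partial>P)" .
    have dI: "integrable P (\<lambda>\<omega>. indicator C \<omega> * R.dens \<omega>)"
      using integrable_mult_indicator[OF CP R.dens_int] by simp
    have "norm (\<integral>\<omega>. indicator C \<omega> * (R.dens \<omega> * (W \<omega> - ?Y \<omega>)) \<partial>P) \<le> (\<integral>\<omega>. norm (indicator C \<omega> * (R.dens \<omega> * (W \<omega> - ?Y \<omega>))) \<partial>P)"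
      by (rule integral_norm_bound)
    also have "\<dots> \<le> (\<integral>\<omega>. 2 * \<kappa> * (indicator C \<omega> * R.dens \<omega>) \<partial>P)"
    proof (rule integral_mono_AE)
      show "integrable P (\<lambda>\<omega>. norm (indicator C \<omega> * (R.dens \<omega> * (W \<omega> - ?Y \<omega>))))"
        using W_int dY[OF C(2) CP] by (intro integrable_norm) (simp add: right_diff_distrib)
      show "integrable P (\<lambda>\<omega>. 2 * \<kappa> * (indicator C \<omega> * R.dens \<omega>))" by (intro integrable_mult_right dI)
      show "AE \<omega> in P. norm (indicator C \<omega> * (R.dens \<omega> * (W \<omega> - ?Y \<omega>))) \<le> 2 * \<kappa> * (indicator C \<omega> * R.dens \<omega>)"
        using RP.terminal_near AE_space
      proof eventually_elim
        case (elim \<omega>)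
        show ?case
        proof (cases "\<omega> \<in> C")
          case True
          have "\<bar>W \<omega> - pos i k \<omega>\<bar> \<le> \<kappa>"
            using elim(1)[rule_format, of k] RP.f_step[OF elim(2), of k] True C_sub by (auto simp: W_def simp del: \<sigma>.simps)
          then have "\<bar>W \<omega> - ?Y \<omega>\<bar> \<le> 2 * \<kappa>" using Yk[OF subsetD[OF C(2) True]] by linarith
          then show ?thesis using True R.dens_pos[of \<omega>] by (simp add: abs_mult mult.commute)
        qed simp
      qed
    qed
    also have "\<dots> = 2 * \<kappa> * (\<integral>\<omega>. indicator C \<omega> * R.dens \<omega> \<partial>P)" by simp
    also have "(\<integral>\<omega>. indicator C \<omega> * R.dens \<omega> \<partial>P) = (\<integral>\<omega>. indicator C \<omega> \<partial>Q)"
      by (subst integral_Q) (auto simp: mult.commute)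
    also have "\<dots> = measure Q C" using sets.sets_into_space[OF CP] by (simp add: Int_absorb2)
    finally show "\<bar>\<integral>\<omega>. indicator C \<omega> * (?X \<omega> - ?Y \<omega>) \<partial>Q\<bar> \<le> 2 * \<kappa> * measure Q C" unfolding eq by simp
  qed
  then have "AE \<omega> in Q. \<forall>k. \<omega> \<in> {\<omega>\<in>space P. \<sigma> k \<omega> < t} \<inter> {\<omega>\<in>space P. t \<le> \<sigma> (Suc k) \<omega>} \<longrightarrow> \<bar>target i t \<omega> - ?Y \<omega>\<bar> \<le> 2 * \<kappa>"
    by (simp only: AE_all_countable) simp
  with before AE_space show ?thesis
  proof eventually_elim
    case (elim \<omega>)
    then have \<omega>: "\<omega> \<in> space P" by simp
    \<comment> \<open>The times \<open>\<sigma>\<close> start at \<open>\<tau>\<close> and reach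
      \<open>T\<close>, so any \<open>t\<close> after \<open>\<tau> \<omega>\<close> falls into some
      step.\<close>
    obtain j where "\<sigma> j \<omega> = T" using \<sigma>_eventually[OF \<omega>] by auto
    then have ex: "t \<le> \<sigma> j \<omega>" using t by simp
    show ?case
    proof (cases "t \<le> \<tau> \<omega>")
      case False
      then have "\<exists>k. \<sigma> k \<omega> < t \<and> t \<le> \<sigma> (Suc k) \<omega>"
        using ex
      proof (induction j)
        case (Suc j)
        then show ?case by (cases "t \<le> \<sigma> j \<omega>") (auto simp: not_le simp del: \<sigma>.simps)
      qed simp
      then show ?thesis using elim \<omega> by blast
    qed (use elim \<omega> in auto)
  qed
qed

text \<open>The truncation changes each component on a null set only, but gives a bound at all times simultaneously.\<close>

definition shadow :: "real \<Rightarrow> 'a \<Rightarrow> real ^ 'd" where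
  "shadow t \<omega> = (\<chi> i. if \<bar>target i t \<omega> - S t \<omega> $ i\<bar> \<le> 2 * \<kappa> then target i t \<omega> else S t \<omega> $ i)"

text \<open>The componentwise bounds are summed through the \<open>l1\<close> norm, which costs a
  factor of the dimension; \<open>\<kappa>\<close> is chosen to compensate for it.\<close>

lemma shadow_near: "norm (S t \<omega> - shadow t \<omega>) \<le> real CARD('d) * (2 * \<kappa>)"
proof -
  have "norm (S t \<omega> - shadow t \<omega>) \<le> (\<Sum>i\<in>UNIV. \<bar>(S t \<omega> - shadow t \<omega>) $ i\<bar>)" by (rule norm_le_l1_cart)
  also have "\<dots> \<le> (\<Sum>i\<in>(UNIV :: 'd set). 2 * \<kappa>)"
    using \<kappa> by (intro sum_mono) (auto simp: shadow_def)
  finally show ?thesis by simp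
qed

text \<open>\<open>shadow\<close> is a version of the martingale closed by the terminal values, so
  every test integral reduces to one that does not involve the time.\<close>

lemma martingale_on_shadow: "martingale_on Q F T shadow"
proof -
  interpret Q: prob_space Q by (rule prob_space_Q)
  have T: "T \<in> {0..T}" using T_pos by auto
  have Tm[measurable]: "target i t \<in> borel_measurable (Fm t)" for i t by simp
  have sh_meas: "shadow t \<in> borel_measurable (Fm t)" if t: "t \<in> {0..T}" for t
  proof -
    have [measurable]: "(\<lambda>\<omega>. S t \<omega> $ i) \<in> borel_measurable (Fm t)" for i
      by (rule measurable_vec_nth[OF adapted_onD[OF S_adapted t]])
    show ?thesis unfolding shadow_def[abs_def] by (rule measurable_vec_lambda) measurable
  qed
  have comp: "integrable Q (\<lambda>\<omega>. shadow t \<omega> $ i)"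
    "A \<in> F t \<Longrightarrow> (\<integral>\<omega>. indicator A \<omega> * shadow t \<omega> $ i \<partial>Q) = (\<integral>\<omega>. indicator A \<omega> * R.terminal (pos i) \<omega> \<partial>Q)"
    if t: "t \<in> {0..T}" for t i A
  proof -
    interpret RP: retirement_process P "\<lambda>k. Fs (\<sigma> k)" moving "pos i" \<kappa> by (rule retirement_process_pos)
    have subQ: "subalgebra Q (Fm t)" using subalg_Fm[OF t] by (auto simp: subalgebra_def)
    interpret fs: finite_measure_subalgebra Q "Fm t" using subQ by unfold_locales
    have X_int: "integrable Q (R.terminal (pos i))" using RP.dens_terminal_int by (simp add: integrable_Q)
    have tQ: "target i t \<in> borel_measurable Q" "(\<lambda>\<omega>. shadow t \<omega> $ i) \<in> borel_measurable Q"
      using measurable_from_subalg[OF subQ Tm] measurable_from_subalg[OF subQ measurable_vec_nth[OF sh_meas[OF t]]] by auto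
    have AE: "AE \<omega> in Q. shadow t \<omega> $ i = target i t \<omega>"
      using target_near[OF t, of i] by eventually_elim (simp add: shadow_def)
    show "integrable Q (\<lambda>\<omega>. shadow t \<omega> $ i)"
      using integrable_cong_AE[OF tQ(2,1) AE] fs.real_cond_exp_int(1)[OF X_int] by simp
    assume A: "A \<in> F t"
    then have At[measurable]: "A \<in> sets (Fm t)" using sets_Fm[OF t] by simp
    have AQ[measurable]: "A \<in> sets Q" using At subQ by (auto simp: subalgebra_def)
    have "(\<integral>\<omega>. indicator A \<omega> * shadow t \<omega> $ i \<partial>Q) = (\<integral>\<omega>. indicator A \<omega> * target i t \<omega> \<partial>Q)"
      using AE tQ by (intro integral_cong_AE) auto
    also have "\<dots> = (\<integral>\<omega>. indicator A \<omega> * R.terminal (pos i) \<omega> \<partial>Q)"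
      using integrable_mult_indicator[OF AQ X_int] X_int by (intro fs.real_cond_exp_intg(2)) auto
    finally show "(\<integral>\<omega>. indicator A \<omega> * shadow t \<omega> $ i \<partial>Q) = (\<integral>\<omega>. indicator A \<omega> * R.terminal (pos i) \<omega> \<partial>Q)" .
  qed
  have int: "integrable Q (shadow t)" if "t \<in> {0..T}" for t
    using integrable_vec_lambda[of Q "\<lambda>i \<omega>. shadow t \<omega> $ i", OF comp(1)[OF that]] by simp
  show ?thesis
  proof (rule martingale_onI_terminal[OF _ adapted_onI[OF sh_meas] int])
    fix t A assume t: "t \<in> {0..T}" and A: "A \<in> F t"
    have AT: "A \<in> F T" using F_mono[of t T] t A by auto
    have AQ: "A \<in> sets Q" using A F_subset[OF t] by auto
    have "(LINT \<omega>:A|Q. shadow s \<omega>) $ i = (\<integral>\<omega>. indicator A \<omega> * shadow s \<omega> $ i \<partial>Q)" if "s \<in> {0..T}" for s i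
      unfolding set_lebesgue_integral_def
      using integral_bounded_linear[OF bounded_linear_vec_nth integrable_mult_indicator[OF AQ int[OF that]], of i] by simp
    then show "(LINT \<omega>:A|Q. shadow T \<omega>) = (LINT \<omega>:A|Q. shadow t \<omega>)"
      using comp(2)[OF T AT] comp(2)[OF t A] t T by (simp add: vec_eq_iff)
  qed auto
qed

end

section \<open>Total variation distance and localization\<close>

text \<open>As \<open>Z = 1\<close> off \<open>N\<close>, only \<open>A \<inter> N\<close>
  contributes to a difference. Summing over disjoint sets leaves at most the two masses of
  \<open>N\<close>, which are equal by \<open>QN\<close>.\<close>

lemma (in prob_space) tv_norm_diff_density_le:
  fixes Z :: "'a \<Rightarrow> real"
  assumes Z: "integrable M Z" "\<And>x. 0 \<le> Z x" and N[measurable]: "N \<in> sets M"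
    and one: "\<And>x. x \<in> space M - N \<Longrightarrow> Z x = 1" and Q: "prob_space (density M (\<lambda>x. ennreal (Z x)))"
    and QN: "(\<integral>x. indicator N x * Z x \<partial>M) = prob N"
  shows "tv_norm_diff (density M (\<lambda>x. ennreal (Z x))) M \<le> 2 * prob N"
proof -
  let ?Q = "density M (\<lambda>x. ennreal (Z x))"
  interpret Q: prob_space ?Q by (rule Q)
  have [measurable]: "Z \<in> borel_measurable M" using Z by auto
  have mQ: "measure ?Q A = (\<integral>x. indicator A x * Z x \<partial>M)" if A[measurable]: "A \<in> sets M" for A
  proof -
    have "measure ?Q A = (\<integral>x. indicator A x \<partial>?Q)" using sets.sets_into_space[OF A] by (simp add: Int_absorb2)
    also have "\<dots> = (\<integral>x. Z x *\<^sub>R indicator A x \<partial>M)" using Z by (intro integral_density) auto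
    finally show ?thesis by (simp add: mult.commute)
  qed
  have diff: "\<bar>measure ?Q A - measure M A\<bar> \<le> measure ?Q (A \<inter> N) + measure M (A \<inter> N)" if A[measurable]: "A \<in> sets M" for A
  proof -
    have "(\<integral>x. indicator (A - N) x * Z x \<partial>M) = (\<integral>x. indicator (A - N) x \<partial>M)"
      using one by (intro Bochner_Integration.integral_cong) (auto simp: indicator_def)
    then have "measure ?Q (A - N) = (\<integral>x. indicator (A - N) x \<partial>M)"
      by (subst mQ) simp_all
    also have "\<dots> = measure M (A - N)" using sets.sets_into_space[OF A] by (simp add: Int_absorb2 subset_iff)
    finally have "measure ?Q (A - N) = measure M (A - N)" .
    moreover have "measure ?Q (A - N) = measure ?Q A - measure ?Q (A \<inter> N)"
      by (rule Q.finite_measure_Diff') auto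
    moreover have "measure M (A - N) = measure M A - measure M (A \<inter> N)" by (rule finite_measure_Diff') auto
    ultimately show ?thesis using measure_nonneg[of ?Q "A \<inter> N"] measure_nonneg[of M "A \<inter> N"] by linarith
  qed
  show ?thesis
    unfolding tv_norm_diff_def
  proof (rule cSup_least)
    show "{(\<Sum>A\<in>\<A>. \<bar>measure ?Q A - measure M A\<bar>) |\<A>. finite \<A> \<and> \<A> \<subseteq> sets M \<and> disjoint \<A>} \<noteq> {}"
      by (auto intro!: exI[of _ "{}"])
    fix d assume "d \<in> {(\<Sum>A\<in>\<A>. \<bar>measure ?Q A - measure M A\<bar>) |\<A>. finite \<A> \<and> \<A> \<subseteq> sets M \<and> disjoint \<A>}"
    then obtain \<A> where \<A>: "finite \<A>" "\<A> \<subseteq> sets M" "disjoint \<A>"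
      and d: "d = (\<Sum>A\<in>\<A>. \<bar>measure ?Q A - measure M A\<bar>)" by auto
    have dis: "disjoint_family_on (\<lambda>A. A \<inter> N) \<A>"
      using \<A>(3) unfolding disjoint_family_on_def disjoint_def by blast
    have im: "(\<lambda>A. A \<inter> N) ` \<A> \<subseteq> sets M" using \<A>(2) by auto
    have "d \<le> (\<Sum>A\<in>\<A>. measure ?Q (A \<inter> N)) + (\<Sum>A\<in>\<A>. measure M (A \<inter> N))"
      unfolding d sum.distrib[symmetric] using \<A>(2) diff by (intro sum_mono) auto
    also have "\<dots> = measure ?Q (\<Union>A\<in>\<A>. A \<inter> N) + measure M (\<Union>A\<in>\<A>. A \<inter> N)"
      using finite_measure_finite_Union[OF \<A>(1) im dis] Q.finite_measure_finite_Union[OF \<A>(1) _ dis] im by simp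
    also have "\<dots> \<le> measure ?Q N + measure M N"
      by (intro add_mono Q.finite_measure_mono finite_measure_mono) auto
    also have "\<dots> = 2 * prob N" using mQ[OF N] QN by simp
    finally show "d \<le> 2 * prob N" .
  qed
qed

lemma absolutely_continuous_density_pos:
  assumes [measurable]: "Z \<in> borel_measurable M" and pos: "\<And>x. 0 < Z x"
  shows "absolutely_continuous M (density M (\<lambda>x. ennreal (Z x)))"
    and "absolutely_continuous (density M (\<lambda>x. ennreal (Z x))) M"
proof -
  show "absolutely_continuous M (density M (\<lambda>x. ennreal (Z x)))"
    by (rule absolutely_continuousI_density) measurable
  show "absolutely_continuous (density M (\<lambda>x. ennreal (Z x))) M"
    unfolding absolutely_continuous_def
  proof
    fix A assume "A \<in> null_sets (density M (\<lambda>x. ennreal (Z x)))"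
    then have A: "A \<in> sets M" "AE x in M. x \<in> A \<longrightarrow> ennreal (Z x) = 0"
      by (auto simp: null_sets_density_iff)
    from A(2) have "AE x in M. x \<notin> A"
    proof eventually_elim
      case (elim x)
      then show ?case using pos[of x] by (auto simp: ennreal_eq_0_iff)
    qed
    then show "A \<in> null_sets M" using A(1) by (simp add: AE_iff_null_sets)
  qed
qed

lemma g_ext_mono:
  assumes g: "convex_on {0..} g" "\<forall>x\<ge>0. g x \<ge> 0" "g 0 = 0" and uv: "u \<le> v" "v < \<infinity>"
  shows "g_ext g u \<le> g_ext g v"
proof -
  have "u < \<infinity>" using uv by (rule le_less_trans)
  moreover have "enn2real u \<le> enn2real v" using uv by (intro enn2real_mono) auto
  ultimately show ?thesis
    using uv by (auto simp: g_ext_def intro!: ennreal_leI convex_nonneg_mono[OF g])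
qed

lemma convex_small:
  assumes g: "convex_on {0..} g" "\<forall>x\<ge>0. g x \<ge> 0" "g 0 = (0::real)" and e: "(0::real) < e"
  obtains \<kappa> where "0 < \<kappa>" "\<kappa> < e" "g \<kappa> < e"
proof
  \<comment> \<open>On the unit interval \<open>g\<close> lies below the chord
    \<open>x * g 1\<close>; the \<open>+ 1\<close> guards against \<open>g 1 = 0\<close>.\<close>
  let ?k = "min (1/2) (e / (2 * (g 1 + 1)))"
  have g1: "0 \<le> g 1" using g(2) by simp
  show pos: "0 < ?k" using e g1 by (auto intro!: divide_pos_pos)
  have "e / (2 * (g 1 + 1)) \<le> e / 2" using e g1 by (intro divide_left_mono) auto
  then show "?k < e" using e by linarith
  have "g ?k \<le> ?k / 1 * g 1" using pos by (intro convex_nonneg_mono(2)[OF g]) auto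
  also have "\<dots> \<le> e / (2 * (g 1 + 1)) * g 1" using g1 by (intro mult_right_mono) auto
  also have "\<dots> < e" using e g1 by (simp add: divide_simps algebra_simps add_nonneg_pos)
  finally show "g ?k < e" .
qed

context filtered_prob_space
begin

lemma sticky_on_modification:
  fixes S S1 :: "real \<Rightarrow> 'a \<Rightarrow> real ^ 'd"
  assumes sticky: "sticky_on P F T S" and S1: "cadlag_process P T F S1"
    and N0: "N0 \<in> null_sets P" and eq: "\<And>\<omega> t. \<omega> \<notin> N0 \<Longrightarrow> S1 t \<omega> = S t \<omega>"
    and \<tau>: "stopping \<tau>" and \<kappa>: "0 < \<kappa>"
  shows "AE \<omega> in P. real_cond_exp P (Fs \<tau>) (indicator {\<omega>\<in>space P. cadlag_process.excursion T S1 \<tau> \<omega> < ennreal \<kappa>}) \<omega> > 0"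
proof -
  interpret S1: cadlag_process P T F S1 by (rule S1)
  interpret fs: finite_measure_subalgebra P "Fs \<tau>" using subalg_Fs[OF \<tau>] by unfold_locales auto
  have T: "T \<in> {0..T}" using T_pos by auto
  let ?E = "{\<omega>\<in>space P. (\<Squnion>u\<in>{\<tau> \<omega>..T}. ennreal (norm (S u \<omega> - S (\<tau> \<omega>) \<omega>))) < ennreal \<kappa>}"
  let ?E1 = "{\<omega>\<in>space P. S1.excursion \<tau> \<omega> < ennreal \<kappa>}"
  have pos: "AE \<omega> in P. real_cond_exp P (Fs \<tau>) (indicator ?E) \<omega> > 0"
    using sticky \<tau> \<kappa> unfolding sticky_on_def by (auto dest!: spec[of _ \<tau>] spec[of _ "\<lambda>_. \<kappa>"])
  note [measurable] = measurable_from_subalg[OF subalg_Fm[OF T] S1.excursion_measurable[OF \<tau>]]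
  have E1: "?E1 \<in> sets P" by measurable
  \<comment> \<open>\<open>?E\<close> is defined by the unmodified process, which is adapted only
    off a null set, so its measurability is extracted from stickiness: on a non-measurable function
    \<open>nn_cond_exp\<close> takes the default value \<open>0\<close>, contradicting
    positivity.\<close>
  have E: "?E \<in> sets P"
  proof (rule ccontr)
    assume nE: "?E \<notin> sets P"
    have "(\<lambda>x. ennreal (indicator ?E x)) \<notin> borel_measurable P"
    proof
      assume "(\<lambda>x. ennreal (indicator ?E x)) \<in> borel_measurable P"
      then have "(\<lambda>x. ennreal (indicator ?E x)) -` {1} \<inter> space P \<in> sets P" by (rule measurable_sets) auto
      moreover have "(\<lambda>x. ennreal (indicator ?E x)) -` {1} \<inter> space P = ?E" by (auto simp: indicator_def split: if_splits)
      ultimately show False using nE by simp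
    qed
    then have "nn_cond_exp P (Fs \<tau>) (\<lambda>x. ennreal (indicator ?E x)) \<omega> = 0" for \<omega>
      by (simp only: nn_cond_exp_def) simp
    then have "\<not> real_cond_exp P (Fs \<tau>) (indicator ?E) \<omega> > 0" for \<omega>
      by (simp add: real_cond_exp_def not_less)
    then have "AE \<omega> in P. False" using pos by simp
    then show False by simp
  qed
  have "AE \<omega> in P. \<omega> \<notin> N0" by (rule AE_not_in[OF N0])
  then have "AE \<omega> in P. indicator ?E \<omega> = (indicator ?E1 \<omega> :: real)"
    by eventually_elim (simp add: S1.excursion_def eq indicator_def)
  then have "AE \<omega> in P. real_cond_exp P (Fs \<tau>) (indicator ?E) \<omega> = real_cond_exp P (Fs \<tau>) (indicator ?E1) \<omega>"
    using E E1 by (intro fs.real_cond_exp_cong) auto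
  with pos show ?thesis by eventually_elim simp
qed

end

text \<open>Outside a null set, a local martingale is adapted; as the probability space need not be complete, it is
  replaced by \<open>0\<close> on that null set.\<close>

lemma (in filtered_prob_space) local_martingale_modification:
  fixes S :: "real \<Rightarrow> 'a \<Rightarrow> real ^ 'd"
  assumes loc: "local_martingale_on P F T S" and cadlag: "\<forall>\<omega>\<in>space P. cadlag_on T (\<lambda>t. S t \<omega>)" and e: "0 < e"
  obtains N0 \<tau> where "N0 \<in> null_sets P" "stopping \<tau>" "prob {\<omega>\<in>space P. \<tau> \<omega> < T} < e"
    "cadlag_process P T F (\<lambda>t \<omega>. if \<omega> \<in> N0 then 0 else S t \<omega>)"
    "martingale_on P F T (\<lambda>t \<omega>. if \<omega> \<in> N0 then 0 else S (min t (\<tau> \<omega>)) \<omega>)"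
proof -
  have T: "T \<in> {0..T}" using T_pos by auto
  obtain \<tau> :: "nat \<Rightarrow> 'a \<Rightarrow> real" where st: "\<And>n. stopping (\<tau> n)"
    and mono: "\<And>\<omega>. \<omega> \<in> space P \<Longrightarrow> mono (\<lambda>n. \<tau> n \<omega>)" and reach: "AE \<omega> in P. \<exists>n. \<tau> n \<omega> = T"
    and mart: "\<And>n. martingale_on P F T (\<lambda>t \<omega>. S (min t (\<tau> n \<omega>)) \<omega>)"
    using loc unfolding local_martingale_on_def by blast
  define N where "N n = {\<omega>\<in>space P. \<tau> n \<omega> < T}" for n
  have N_sets[measurable]: "N n \<in> sets P" for n
    unfolding N_def using stopping_less[OF st T] F_subset[OF T] by blast
  \<comment> \<open>On \<open>N0\<close> no localizing time reaches \<open>T\<close>. The set is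
    null and hence in every \<open>F t\<close>, so changing the process there respects the
    filtration.\<close>
  define N0 where "N0 = (\<Inter>n. N n)"
  have N0: "N0 \<in> null_sets P"
  proof -
    have "AE \<omega> in P. \<omega> \<notin> N0"
      using reach by eventually_elim (auto simp: N0_def N_def)
    moreover have "N0 \<in> sets P" unfolding N0_def by measurable
    ultimately show ?thesis by (simp add: AE_iff_null_sets)
  qed
  have "decseq N"
    unfolding decseq_def N_def
  proof (intro allI impI subsetI CollectI conjI)
    fix m n \<omega> assume mn: "m \<le> n" and "\<omega> \<in> {\<omega>\<in>space P. \<tau> n \<omega> < T}"
    then have \<omega>: "\<omega> \<in> space P" "\<tau> n \<omega> < T" by auto
    then show "\<tau> m \<omega> < T" "\<omega> \<in> space P" using monoD[OF mono[OF \<omega>(1)] mn] by auto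
  qed
  then have "(\<lambda>n. prob (N n)) \<longlonglongrightarrow> prob (\<Inter>n. N n)"
    by (intro finite_Lim_measure_decseq) auto
  moreover have "prob (\<Inter>n. N n) = 0" using N0 by (simp add: N0_def measure_eq_0_null_sets)
  ultimately obtain n where n: "prob (N n) < e"
    using order_tendstoD(2)[of _ 0 sequentially e] e by (metis eventually_happens sequentially_bot)
  have N0_F: "N0 \<in> sets (Fm t)" if "t \<in> {0..T}" for t
    using N0 null_sets_F[OF that] sets_Fm[OF that] by auto
  let ?X = "\<lambda>n t \<omega>. S (min t (\<tau> n \<omega>)) \<omega>"
  let ?Y = "\<lambda>n t \<omega>. if \<omega> \<in> N0 then 0 else S (min t (\<tau> n \<omega>)) \<omega>"
  have ad: "adapted_on P F T (?X n)" and int: "\<And>t. t \<in> {0..T} \<Longrightarrow> integrable P (?X n t)"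
    and mp: "\<And>s t A. 0 \<le> s \<Longrightarrow> s \<le> t \<Longrightarrow> t \<le> T \<Longrightarrow> A \<in> F s \<Longrightarrow> (LINT \<omega>:A|P. ?X n t \<omega>) = (LINT \<omega>:A|P. ?X n s \<omega>)" for n
    using mart[of n] unfolding martingale_on_def by blast+
  have Ym: "?Y n t \<in> borel_measurable (Fm t)" if t: "t \<in> {0..T}" for n t
  proof -
    note [measurable] = N0_F[OF t] adapted_onD[OF ad t]
    show ?thesis by measurable
  qed
  have AE_eq: "AE \<omega> in P. ?Y n t \<omega> = ?X n t \<omega>" for n t
    using AE_not_in[OF N0] by eventually_elim simp
  have YP: "?Y n t \<in> borel_measurable P" if t: "t \<in> {0..T}" for n t
    by (rule measurable_from_subalg[OF subalg_Fm[OF t] Ym[OF t]])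
  have Y_set: "(LINT \<omega>:A|P. ?Y n t \<omega>) = (LINT \<omega>:A|P. ?X n t \<omega>)" if t: "t \<in> {0..T}" and [measurable]: "A \<in> sets P" for A n t
    unfolding set_lebesgue_integral_def
  proof (rule integral_cong_AE)
    show "AE \<omega> in P. indicator A \<omega> *\<^sub>R ?Y n t \<omega> = indicator A \<omega> *\<^sub>R ?X n t \<omega>"
      using AE_eq[of t n] by eventually_elim simp
  qed (use YP[OF t, of n] borel_measurable_integrable[OF int[OF t, of n]] in measurable)
  have "martingale_on P F T (?Y n)"
    unfolding martingale_on_def
  proof (intro conjI allI impI ballI)
    show "adapted_on P F T (?Y n)" by (rule adapted_onI[OF Ym])
    show "integrable P (?Y n t)" if t: "t \<in> {0..T}" for t
      using integrable_cong_AE[OF YP[OF t] borel_measurable_integrable[OF int[OF t]] AE_eq] int[OF t] by simp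
    fix s t A assume *: "0 \<le> s" "s \<le> t" "t \<le> T" "A \<in> F s"
    then have s: "s \<in> {0..T}" and t: "t \<in> {0..T}" by auto
    then show "(LINT \<omega>:A|P. ?Y n t \<omega>) = (LINT \<omega>:A|P. ?Y n s \<omega>)"
      using Y_set[OF t] Y_set[OF s] mp[OF *] F_subset[OF s] *(4) by auto
  qed
  moreover have "cadlag_process P T F (\<lambda>t \<omega>. if \<omega> \<in> N0 then 0 else S t \<omega>)"
  proof unfold_locales
    show "adapted_on P F T (\<lambda>t \<omega>. if \<omega> \<in> N0 then 0 else S t \<omega>)"
    proof (rule adapted_onI)
      fix t assume t: "t \<in> {0..T}"
      show "(\<lambda>\<omega>. if \<omega> \<in> N0 then 0 else S t \<omega>) \<in> borel_measurable (Fm t)"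
      \<comment> \<open>Off \<open>N0\<close> some localizing time equals \<open>T\<close>, and from
        then on the stopped value at \<open>t\<close> is that of \<open>S\<close>; the limit
        inherits measurability.\<close>
      proof (rule borel_measurable_LIMSEQ_metric[OF Ym[OF t]])
        fix \<omega> assume "\<omega> \<in> space (Fm t)"
        then have \<omega>: "\<omega> \<in> space P" by (simp add: space_Fm)
        show "(\<lambda>n. ?Y n t \<omega>) \<longlonglongrightarrow> (if \<omega> \<in> N0 then 0 else S t \<omega>)"
        proof (cases "\<omega> \<in> N0")
          case False
          then obtain m where m: "T \<le> \<tau> m \<omega>" using \<omega> by (auto simp: N0_def N_def not_less)
          have "?Y k t \<omega> = S t \<omega>" if "k \<ge> m" for k
            using monoD[OF mono[OF \<omega>] that] m t False by (auto simp: min_absorb1)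
          then have "\<forall>\<^sub>F k in sequentially. ?Y k t \<omega> = S t \<omega>"
            unfolding eventually_sequentially by blast
          from tendsto_eventually[OF this] show ?thesis using False by simp
        qed simp
      qed
    qed
    show "cadlag_on T (\<lambda>t. if \<omega> \<in> N0 then 0 else S t \<omega>)" if "\<omega> \<in> space P" for \<omega>
      using cadlag that by (cases "\<omega> \<in> N0") (auto simp: cadlag_on_def)
  qed
  ultimately show thesis using that[OF N0 st[of n]] n unfolding N_def by blast
qed

section \<open>Choice of the constants and combination of the two cases\<close>

theorem theorem5p1:
  fixes P :: "'a measure" and T :: real and F :: "real \<Rightarrow> 'a set set"
    and g :: "real \<Rightarrow> real" and chi :: real
    and B :: "real \<Rightarrow> 'a \<Rightarrow> real ^ 'd" and S :: "real \<Rightarrow> 'a \<Rightarrow> real ^ 'd"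
  assumes P: "prob_space P"
    and T: "0 < T"
    and F: "filtration_usual P T F"
    and g_convex: "convex_on {0..} g" and g_nonneg: "\<forall>x\<ge>0. g x \<ge> 0" and g0: "g 0 = 0"
    and chi_pos: "chi > 0"
    and BM: "brownian_motion_on P T B"
    and indep: "prob_space.indep_set P (augmented_natural_filtration P B T) (F T)"
    and S_cadlag: "\<forall>\<omega>\<in>space P. cadlag_on T (\<lambda>t. S t \<omega>)"
    and S_loc: "local_martingale_on P F T S"
    and S_sticky: "sticky_on P F T S"
  shows "(\<exists>Q (S' :: real \<Rightarrow> 'a \<Rightarrow> real ^ 'd).
            prob_space Q \<and> sets Q = sets P \<and>
            absolutely_continuous P Q \<and> absolutely_continuous Q P \<and>
            tv_norm_diff Q P < chi \<and>
            martingale_on Q (join_filtration P F (augmented_natural_filtration P B)) T S' \<and>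
            (\<integral>\<^sup>+ \<omega>. g_ext g (\<Squnion>t\<in>{0..T}. ennreal (norm (S t \<omega> - S' t \<omega>))) \<partial>Q) < ennreal chi \<and>
            ((\<forall>\<omega>\<in>space P. continuous_on {0..T} (\<lambda>t. S t \<omega>)) \<longrightarrow>
               (AE \<omega> in P. (\<Squnion>t\<in>{0..T}. ennreal (norm (S t \<omega> - S' t \<omega>))) < ennreal chi)))
         \<and> local_martingale_on P (join_filtration P F (augmented_natural_filtration P B)) T S"
proof -
  interpret prob_space P by (rule P)
  interpret filtered_prob_space P T F using T F by unfold_locales
  note g = g_convex g_nonneg g0
  let ?H = "join_filtration P F (augmented_natural_filtration P B)"
  let ?cont = "\<forall>\<omega>\<in>space P. continuous_on {0..T} (\<lambda>t. S t \<omega>)"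
  let ?dev = "\<lambda>S' \<omega>. \<Squnion>t\<in>{0..T}. ennreal (norm (S t \<omega> - S' t \<omega>))"
  \<comment> \<open>Half of \<open>chi\<close>, because the total variation distance will be at most
    twice this probability.\<close>
  obtain N0 \<tau> where N0: "N0 \<in> null_sets P" and \<tau>: "stopping \<tau>" and small: "prob {\<omega>\<in>space P. \<tau> \<omega> < T} < chi / 2"
    and S1_cadlag: "cadlag_process P T F (\<lambda>t \<omega>. if \<omega> \<in> N0 then 0 else S t \<omega>)"
    and S1_mart': "martingale_on P F T (\<lambda>t \<omega>. if \<omega> \<in> N0 then 0 else S (min t (\<tau> \<omega>)) \<omega>)"
    by (rule local_martingale_modification[OF S_loc S_cadlag half_gt_zero[OF chi_pos]])
  define S1 where "S1 t \<omega> = (if \<omega> \<in> N0 then 0 else S t \<omega>)" for t \<omega>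
  interpret S1: cadlag_process P T F S1 unfolding S1_def[abs_def] by (rule S1_cadlag)
  have S1_mart: "martingale_on P F T (\<lambda>t \<omega>. S1 (min t (\<tau> \<omega>)) \<omega>)" using S1_mart' by (simp add: S1_def)
  have S1_eq: "S1 t \<omega> = S t \<omega>" if "\<omega> \<notin> N0" for t \<omega> using that by (simp add: S1_def)
  have S1_sticky: "AE \<omega> in P. real_cond_exp P (Fs \<sigma>) (indicator {\<omega>\<in>space P. S1.excursion \<sigma> \<omega> < ennreal \<kappa>}) \<omega> > 0"
    if "stopping \<sigma>" "0 < \<kappa>" for \<sigma> \<kappa>
    by (rule sticky_on_modification[OF S_sticky S1.cadlag_process_axioms N0 S1_eq that])
  \<comment> \<open>Both cases produce a density of the same shape, so that total variation,
    equivalence and the passage to the larger filtration are treated once. For continuous paths a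
    single \<open>S'\<close> has to satisfy the moment bound and the uniform bound together.\<close>
  have "\<exists>Z S'. Z \<in> borel_measurable (Fm T) \<and> (\<forall>\<omega>. 0 < Z \<omega>) \<and> integrable P Z \<and>
      (\<forall>C\<in>sets (Fs \<tau>). (\<integral>\<omega>. indicator C \<omega> * Z \<omega> \<partial>P) = prob C) \<and> (\<forall>\<omega>\<in>space P. \<tau> \<omega> = T \<longrightarrow> Z \<omega> = 1) \<and>
      martingale_on (density P (\<lambda>\<omega>. ennreal (Z \<omega>))) F T S' \<and>
      (\<integral>\<^sup>+ \<omega>. g_ext g (?dev S' \<omega>) \<partial>density P (\<lambda>\<omega>. ennreal (Z \<omega>))) < ennreal chi \<and>
      (?cont \<longrightarrow> (AE \<omega> in P. ?dev S' \<omega> < ennreal chi))"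
  proof (cases ?cont)
    case True
    \<comment> \<open>A deterministic bound \<open>c\<close> on the deviation settles both
      estimates: the uniform one by \<open>c < chi\<close>, the moment one by
      \<open>g c < chi\<close>.\<close>
    obtain c where c: "0 < c" "c < chi" "g c < chi" by (rule convex_small[OF g chi_pos])
    \<comment> \<open>Chosen so that the bound of \<open>shadow_near\<close> is exactly
      \<open>c\<close>.\<close>
    define \<kappa> where "\<kappa> = c / (2 * real CARD('d))"
    have \<kappa>: "0 < \<kappa>" "real CARD('d) * (2 * \<kappa>) = c" using c by (auto simp: \<kappa>_def)
    interpret C: sticky_continuous_process P T F S1 \<tau> \<kappa>
    proof unfold_locales
      show "continuous_on {0..T} (\<lambda>t. S1 t \<omega>)" if "\<omega> \<in> space P" for \<omega>
        using True that by (cases "\<omega> \<in> N0") (auto simp: S1_def)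
    qed (use \<tau> \<kappa> S1_mart S1_sticky in auto)
    have dev: "?dev C.shadow \<omega> \<le> ennreal c" if "\<omega> \<notin> N0" for \<omega>
      using C.shadow_near[of _ \<omega>] unfolding \<kappa>(2) S1_eq[OF that] by (intro SUP_least ennreal_leI)
    have dev_AE: "AE \<omega> in P. ?dev C.shadow \<omega> \<le> ennreal c"
      using AE_not_in[OF N0] by eventually_elim (rule dev)
    interpret Q: prob_space C.Q by (rule C.prob_space_Q)
    have "(\<integral>\<^sup>+ \<omega>. g_ext g (?dev C.shadow \<omega>) \<partial>C.Q) \<le> (\<integral>\<^sup>+ \<omega>. g_ext g (ennreal c) \<partial>C.Q)"
    proof (rule nn_integral_mono_AE)
      show "AE \<omega> in C.Q. g_ext g (?dev C.shadow \<omega>) \<le> g_ext g (ennreal c)"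
        using C.AE_Q[OF dev_AE] by eventually_elim (rule g_ext_mono[OF g], auto)
    qed
    also have "\<dots> = ennreal (g c)" using c by (simp add: g_ext_def Q.emeasure_space_1 del: space_density)
    also have "\<dots> < ennreal chi" using c g_nonneg by (simp add: ennreal_less_iff)
    finally have "(\<integral>\<^sup>+ \<omega>. g_ext g (?dev C.shadow \<omega>) \<partial>C.Q) < ennreal chi" .
    moreover have "AE \<omega> in P. ?dev C.shadow \<omega> < ennreal chi"
      using dev_AE by eventually_elim (use c in \<open>auto simp: ennreal_less_iff elim!: le_less_trans\<close>)
    moreover have "\<forall>\<omega>\<in>space P. \<tau> \<omega> = T \<longrightarrow> C.R.dens \<omega> = 1"
    proof (intro ballI impI C.R.dens_eq_1)
      show "\<omega> \<notin> C.moving 0" if "\<tau> \<omega> = T" for \<omega> using that by (simp add: C.moving_def)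
    qed
    moreover have "\<forall>D\<in>sets (Fs \<tau>). (\<integral>\<omega>. indicator D \<omega> * C.R.dens \<omega> \<partial>P) = prob D"
      using C.R.integral_dens_0(2) by simp
    ultimately show ?thesis
      using C.dens_FT C.R.dens_pos C.R.dens_int C.martingale_on_shadow
      by (intro exI[of _ C.R.dens] exI[of _ C.shadow]) blast
  next
    case False
    \<comment> \<open>The moment is bounded by \<open>g \<kappa> + r\<close>; with each summand at
      most a quarter of \<open>chi\<close> the inequality is strict.\<close>
    have chi4: "0 < chi / 4" using chi_pos by simp
    obtain \<kappa> where \<kappa>: "0 < \<kappa>" "\<kappa> < chi / 4" "g \<kappa> < chi / 4" by (rule convex_small[OF g chi4])
    define r where "r = min (1/2) (chi / 4)"
    have r: "0 < r" "r < 1" "r \<le> chi / 4" using chi_pos by (auto simp: r_def)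
    obtain Z where Z: "Z \<in> borel_measurable (Fm T)" "\<And>\<omega>. Z \<omega> > 0" "integrable P Z"
      "\<And>C. C \<in> sets (Fs \<tau>) \<Longrightarrow> (\<integral>\<omega>. indicator C \<omega> * Z \<omega> \<partial>P) = prob C"
      "\<And>\<omega>. \<tau> \<omega> = T \<Longrightarrow> Z \<omega> = 1"
      "(\<integral>\<^sup>+\<omega>. g_ext g (S1.excursion \<tau> \<omega>) \<partial>density P (\<lambda>\<omega>. ennreal (Z \<omega>))) \<le> ennreal (g \<kappa> + r)"
      by (rule S1.small_excursion_density[OF \<tau> \<kappa>(1) r(1,2) S1_sticky[OF \<tau> \<kappa>(1)] g]) blast
    let ?Q = "density P (\<lambda>\<omega>. ennreal (Z \<omega>))"
    let ?S' = "\<lambda>t \<omega>. S1 (min t (\<tau> \<omega>)) \<omega>"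
    have [measurable]: "Z \<in> borel_measurable P" using Z(3) by auto
    \<comment> \<open>Before \<open>\<tau>\<close> the stopped process does not deviate, so the
      deviation over all times is governed by the excursion after \<open>\<tau>\<close>.\<close>
    have dev: "?dev ?S' \<omega> \<le> S1.excursion \<tau> \<omega>" if "\<omega> \<notin> N0" "\<omega> \<in> space P" for \<omega>
    proof (rule SUP_least)
      fix t assume t: "t \<in> {0..T}"
      show "ennreal (norm (S t \<omega> - ?S' t \<omega>)) \<le> S1.excursion \<tau> \<omega>"
      proof (cases "\<tau> \<omega> \<le> t")
        case True
        then have "ennreal (norm (S t \<omega> - ?S' t \<omega>)) = ennreal (norm (S1 t \<omega> - S1 (\<tau> \<omega>) \<omega>))"
          using S1_eq[OF that(1)] by (simp add: min_absorb2)
        also have "\<dots> \<le> S1.excursion \<tau> \<omega>" unfolding S1.excursion_def using True t by (intro SUP_upper) auto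
        finally show ?thesis .
      next
        case False
        then show ?thesis using S1_eq[OF that(1)] by (simp add: min_absorb1)
      qed
    qed
    have "AE \<omega> in ?Q. \<omega> \<notin> N0" using AE_not_in[OF N0] by (subst AE_density) auto
    then have "AE \<omega> in ?Q. g_ext g (?dev ?S' \<omega>) \<le> g_ext g (S1.excursion \<tau> \<omega>)"
      using AE_space
    proof eventually_elim
      case (elim \<omega>)
      then show ?case
        by (intro g_ext_mono[OF g] dev S1.excursion_finite[OF \<tau>]) auto
    qed
    then have "(\<integral>\<^sup>+ \<omega>. g_ext g (?dev ?S' \<omega>) \<partial>?Q) \<le> (\<integral>\<^sup>+\<omega>. g_ext g (S1.excursion \<tau> \<omega>) \<partial>?Q)"
      by (rule nn_integral_mono_AE)
    also note Z(6)
    also have "ennreal (g \<kappa> + r) < ennreal chi"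
      using \<kappa> r chi_pos g_nonneg by (intro ennreal_lessI) auto
    finally have "(\<integral>\<^sup>+ \<omega>. g_ext g (?dev ?S' \<omega>) \<partial>?Q) < ennreal chi" .
    moreover have "martingale_on ?Q F T ?S'"
      by (rule martingale_on_stopped_density[OF \<tau> S1_mart Z(3) less_imp_le[OF Z(2)] Z(4)])
    ultimately show ?thesis
      using Z False by (intro exI[of _ Z] exI[of _ ?S']) blast
  qed
  then obtain Z S' where Z: "Z \<in> borel_measurable (Fm T)" "\<And>\<omega>. 0 < Z \<omega>" "integrable P Z"
    "\<And>C. C \<in> sets (Fs \<tau>) \<Longrightarrow> (\<integral>\<omega>. indicator C \<omega> * Z \<omega> \<partial>P) = prob C" "\<And>\<omega>. \<omega> \<in> space P \<Longrightarrow> \<tau> \<omega> = T \<Longrightarrow> Z \<omega> = 1"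
    and S': "martingale_on (density P (\<lambda>\<omega>. ennreal (Z \<omega>))) F T S'"
    "(\<integral>\<^sup>+ \<omega>. g_ext g (?dev S' \<omega>) \<partial>density P (\<lambda>\<omega>. ennreal (Z \<omega>))) < ennreal chi"
    "?cont \<longrightarrow> (AE \<omega> in P. ?dev S' \<omega> < ennreal chi)"
    by blast
  note Z_nn = less_imp_le[OF Z(2)]
  let ?Q = "density P (\<lambda>\<omega>. ennreal (Z \<omega>))"
  let ?N = "{\<omega>\<in>space P. \<tau> \<omega> < T}"
  have Q: "prob_space ?Q" by (rule prob_space_density_Fs[OF \<tau> Z(3) Z_nn Z(4)])
  have N: "?N \<in> sets (Fs \<tau>)" by (rule less_T_Fs[OF \<tau>])
  have NP: "?N \<in> sets P" using N subalg_Fs[OF \<tau>] by (auto simp: subalgebra_def)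
  have "tv_norm_diff ?Q P \<le> 2 * prob ?N"
  proof (rule tv_norm_diff_density_le[OF Z(3) Z_nn NP _ Q Z(4)[OF N]])
    fix \<omega> assume "\<omega> \<in> space P - ?N"
    then show "Z \<omega> = 1" using stopping_range[OF \<tau>, of \<omega>] by (intro Z(5)) auto
  qed
  then have "tv_norm_diff ?Q P < chi" using small by simp
  moreover have "martingale_on ?Q ?H T S'" by (rule martingale_on_join_density[OF indep Z(1) Z_nn S'(1)])
  moreover have "absolutely_continuous P ?Q" "absolutely_continuous ?Q P"
    using absolutely_continuous_density_pos[of Z P] Z by auto
  moreover have "local_martingale_on P ?H T S" by (rule local_martingale_on_join[OF indep S_loc])
  ultimately show ?thesis using Q S'(2,3) by (intro conjI exI[of _ ?Q] exI[of _ S']) auto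
qed

end
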